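(* Let $K\in\mathbb{R}$ and let $(X_i,\mathsf{d}_i,\mathfrak m_i)_{i\in\mathbb N}$ be a sequence of compact metric measure spaces each satisfying the $\mathrm{BCD}(K,\infty)$ condition, converging to $(X,\mathsf{d},\mathfrak m)$ in the measured Gromov–Hausdorff sense. Then $(X,\mathsf{d},\mathfrak m)$ satisfies the $\mathrm{BCD}(K,\infty)$ condition.
   Context: $\mathcal P(X)$: Borel probability measures, $W_2$ the quadratic Wasserstein distance. For $\Omega$ a probability measure on $\mathcal P(X)$, $\mathrm{Var}(\Omega)=\inf_\nu\int W_2^2(\mu,\nu)\,d\Omega(\mu)$, and a (Wasserstein) barycenter is a minimizer. $\mathrm{Ent}_{\mathfrak m}(\mu)=\int\rho\ln\rho\,d\mathfrak m$ if $\mu=\rho\mathfrak m$, else $+\infty$. $\mathrm{BCD}(K,\infty)$: for every probability measure $\Omega$ on $\mathcal P(X)$ with finite support and finite variance there exists a barycenter $\bar\mu$ of $\Omega$ with $\mathrm{Ent}_{\mathfrak m}(\bar\mu)\le\int\mathrm{Ent}_{\mathfrak m}(\mu)\,d\Omega(\mu)-\frac K2\mathrm{Var}(\Omega)$. A map $\varphi:(X_1,\mathsf d_1)\to(X_2,\mathsf d_2)$ is an $\epsilon$-approximation if $|\mathsf d_2(\varphi(x),\varphi(y))-\mathsf d_1(x,y)|\le\epsilon$ for all $x,y$ and every $x_2\in X_2$ is within $\epsilon$ of $\varphi(X_1)$. $(X_i,\mathsf d_i,\mathfrak m_i)\to(X,\mathsf d,\mathfrak m)$ in measured Gromov–Hausdorff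 sense if there are $\epsilon_i$-approximations $\varphi_i:X_i\to X$ with $\epsilon_i\downarrow0$ and $(\varphi_i)_\sharp\mathfrak m_i\to\mathfrak m$ weakly (against bounded continuous functions). *)

theory Defs
  imports "HOL-Probability.Probability"
begin

definition mborel :: "'a set \<Rightarrow> ('a \<Rightarrow> 'a \<Rightarrow> real) \<Rightarrow> 'a measure" where
  "mborel X d = sigma X {U. openin (Metric_space.mtopology X d) U}"

definition Prob :: "'a set \<Rightarrow> ('a \<Rightarrow> 'a \<Rightarrow> real) \<Rightarrow> 'a measure set" where
  "Prob X d = {\<mu>. prob_space \<mu> \<and> space \<mu> = X \<and> sets \<mu> = sets (mborel X d)}"

definition couplings :: "'a set \<Rightarrow> ('a \<Rightarrow> 'a \<Rightarrow> real) \<Rightarrow> 'a measure \<Rightarrow> 'a measure \<Rightarrow> ('a \<times> 'a) measure set" where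
  "couplings X d \<mu> \<nu> = {\<pi>. prob_space \<pi> \<and> space \<pi> = X \<times> X
      \<and> sets \<pi> = sets (mborel X d \<Otimes>\<^sub>M mborel X d)
      \<and> distr \<pi> (mborel X d) fst = \<mu> \<and> distr \<pi> (mborel X d) snd = \<nu>}"

definition W2sq :: "'a set \<Rightarrow> ('a \<Rightarrow> 'a \<Rightarrow> real) \<Rightarrow> 'a measure \<Rightarrow> 'a measure \<Rightarrow> ennreal" where
  "W2sq X d \<mu> \<nu> = (INF \<pi> \<in> couplings X d \<mu> \<nu>. \<integral>\<^sup>+ p. ennreal ((d (fst p) (snd p))\<^sup>2) \<partial>\<pi>)"

text \<open>A finitely supported probability measure Omega on P(X) is represented as
  Omega = sum_{j in I} lam j * delta_{mus j}, I finite, lam j >= 0, sum lam = 1.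
  Integrals against Omega are the corresponding weighted sums.\<close>
definition fin_prob_on_P :: "'a set \<Rightarrow> ('a \<Rightarrow> 'a \<Rightarrow> real) \<Rightarrow> nat set \<Rightarrow> (nat \<Rightarrow> real) \<Rightarrow> (nat \<Rightarrow> 'a measure) \<Rightarrow> bool" where
  "fin_prob_on_P X d I lam mus \<longleftrightarrow> finite I \<and> (\<forall>j\<in>I. 0 \<le> lam j \<and> mus j \<in> Prob X d) \<and> (\<Sum>j\<in>I. lam j) = 1"

definition Var :: "'a set \<Rightarrow> ('a \<Rightarrow> 'a \<Rightarrow> real) \<Rightarrow> nat set \<Rightarrow> (nat \<Rightarrow> real) \<Rightarrow> (nat \<Rightarrow> 'a measure) \<Rightarrow> ennreal" where
  "Var X d I lam mus = (INF \<nu> \<in> Prob X d. \<Sum>j\<in>I. ennreal (lam j) * W2sq X d (mus j) \<nu>)"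

definition is_barycenter :: "'a set \<Rightarrow> ('a \<Rightarrow> 'a \<Rightarrow> real) \<Rightarrow> nat set \<Rightarrow> (nat \<Rightarrow> real) \<Rightarrow> (nat \<Rightarrow> 'a measure) \<Rightarrow> 'a measure \<Rightarrow> bool" where
  "is_barycenter X d I lam mus \<nu> \<longleftrightarrow> \<nu> \<in> Prob X d \<and>
     (\<Sum>j\<in>I. ennreal (lam j) * W2sq X d (mus j) \<nu>) = Var X d I lam mus"

definition Ent :: "'a measure \<Rightarrow> 'a measure \<Rightarrow> ereal" where
  "Ent m \<mu> =
    (if \<exists>\<rho>. \<rho> \<in> borel_measurable m \<and> (\<forall>x\<in>space m. 0 \<le> \<rho> x) \<and> \<mu> = density m (\<lambda>x. ennreal (\<rho> x))
     then (let \<rho> = (SOME \<rho>. \<rho> \<in> borel_measurable m \<and> (\<forall>x\<in>space m. 0 \<le> \<rho> x)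
                           \<and> \<mu> = density m (\<lambda>x. ennreal (\<rho> x)))
           in enn2ereal (\<integral>\<^sup>+ x. ennreal (\<rho> x * ln (\<rho> x)) \<partial>m)
              - enn2ereal (\<integral>\<^sup>+ x. ennreal (- (\<rho> x * ln (\<rho> x))) \<partial>m))
     else \<infinity>)"

definition BCD :: "real \<Rightarrow> 'a set \<Rightarrow> ('a \<Rightarrow> 'a \<Rightarrow> real) \<Rightarrow> 'a measure \<Rightarrow> bool" where
  "BCD K X d m \<longleftrightarrow>
    (\<forall>I lam mus. fin_prob_on_P X d I lam mus \<and> Var X d I lam mus < \<top> \<longrightarrow>
       (\<exists>\<nu>. is_barycenter X d I lam mus \<nu> \<and>
            Ent m \<nu> \<le> (\<Sum>j\<in>I. ereal (lam j) * Ent m (mus j))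
                       - ereal (K / 2 * enn2real (Var X d I lam mus))))"

definition compact_mms :: "'a set \<Rightarrow> ('a \<Rightarrow> 'a \<Rightarrow> real) \<Rightarrow> 'a measure \<Rightarrow> bool" where
  "compact_mms X d m \<longleftrightarrow> Metric_space X d \<and> compact_space (Metric_space.mtopology X d)
     \<and> finite_measure m \<and> space m = X \<and> sets m = sets (mborel X d)"

definition eps_approx :: "real \<Rightarrow> 'a set \<Rightarrow> ('a \<Rightarrow> 'a \<Rightarrow> real) \<Rightarrow> 'b set \<Rightarrow> ('b \<Rightarrow> 'b \<Rightarrow> real) \<Rightarrow> ('a \<Rightarrow> 'b) \<Rightarrow> bool" where
  "eps_approx \<epsilon> X1 d1 X2 d2 \<phi> \<longleftrightarrow> \<phi> ` X1 \<subseteq> X2 \<and>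
     (\<forall>x\<in>X1. \<forall>y\<in>X1. \<bar>d2 (\<phi> x) (\<phi> y) - d1 x y\<bar> \<le> \<epsilon>) \<and>
     (\<forall>z\<in>X2. \<exists>x\<in>X1. d2 z (\<phi> x) \<le> \<epsilon>)"

definition mGH_converges ::
  "(nat \<Rightarrow> 'a set) \<Rightarrow> (nat \<Rightarrow> 'a \<Rightarrow> 'a \<Rightarrow> real) \<Rightarrow> (nat \<Rightarrow> 'a measure) \<Rightarrow>
   'b set \<Rightarrow> ('b \<Rightarrow> 'b \<Rightarrow> real) \<Rightarrow> 'b measure \<Rightarrow> bool" where
  "mGH_converges Xs ds ms X d m \<longleftrightarrow>
    (\<exists>\<epsilon> \<phi>. (\<forall>i. 0 \<le> \<epsilon> i) \<and> decseq \<epsilon> \<and> \<epsilon> \<longlonglongrightarrow> 0 \<and>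
       (\<forall>i. eps_approx (\<epsilon> i) (Xs i) (ds i) X d (\<phi> i)
            \<and> \<phi> i \<in> measurable (ms i) (mborel X d)) \<and>
       (\<forall>f. continuous_map (Metric_space.mtopology X d) euclideanreal f \<and> bounded (f ` X) \<longrightarrow>
          (\<lambda>i. integral\<^sup>L (distr (ms i) (mborel X d) (\<phi> i)) f) \<longlonglongrightarrow> integral\<^sup>L m f))"

end

theory Submission
  imports Defs
begin

text \<open>
  Given finitely many measures \<open>\<mu>\<^sub>j = \<rho>\<^sub>j m\<close> of finite entropy on the limit space, take a partition of unity
  \<open>\<psi>\<^sub>a\<close> on \<open>X\<close> subordinate to balls of radius \<open>\<delta>\<close> and move \<open>\<mu>\<^sub>j\<close> to \<open>X\<^sub>i\<close> as the measure with density
  \<open>\<Sum>a. c\<^sub>a / r\<^sub>a * \<psi>\<^sub>a \<circ> \<phi>\<^sub>i\<close>, where \<open>c\<^sub>a\<close> is the integral of \<open>\<psi>\<^sub>a\<close> against \<open>\<mu>\<^sub>j\<close> and \<open>r\<^sub>a\<close> the integral of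
  \<open>\<psi>\<^sub>a \<circ> \<phi>\<^sub>i\<close> against \<open>m\<^sub>i\<close>. By Jensen's inequality (used twice) its entropy is at most
  \<open>Ent \<mu>\<^sub>j + o(1)\<close>. Exchanging mass only inside the balls turns a coupling on \<open>X\<close> into one on \<open>X\<^sub>i\<close> and
  conversely, at a cost of order \<open>\<delta>\<close>; hence the variances converge, and the images in \<open>X\<close> of the
  barycenters given by BCD on \<open>X\<^sub>i\<close> are almost optimal. A weak limit of these is a barycenter
  because the transport cost is weakly lower semicontinuous. Its entropy bound follows from the duality
  \<open>Ent\<^sub>m \<nu> = sup\<^sub>g (\<integral>g d\<nu> - \<integral>exp (g - 1) dm)\<close> over continuous \<open>g\<close>, which is stable under weak convergence
  of both measures.

  Weak compactness is reduced to Helly's theorem on the real line: a ternary expansion encodes the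
  points of a compact metric space as real numbers, with a uniformly continuous inverse.
\<close>

section \<open>Entropy and finite sums of measures\<close>

text \<open>The obstacle is that nothing passes pointwise from X to X_i: the maps
  \<open>\<phi> i\<close> are Borel but neither continuous nor invertible, and weak convergence sees
  only continuous functions, whereas a density \<open>\<rho>\<close> is merely integrable. Replacing
  each measure by the finitely many numbers c_a and r_a reduces the entropy comparison to the
  convergence of finitely many integrals of continuous functions. The image in X of a barycenter on
  X_i is absolutely continuous with respect to the image of \<open>ms i\<close>, not to
  \<open>m\<close>, so its entropy relative to \<open>m\<close> may be infinite. The dual form moves
  the reference measure into an integral of the continuous function exp (g - 1), which converges.
  The shift by 1 comes from the Legendre transform of t ln t. As \<open>K\<close> has no sign, the
  variances must be compared in both directions. If some entropy of positive weight is infinite, the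
  required bound is vacuous and only the existence of a barycenter remains; atoms of weight zero are
  removed beforehand, since 0 times infinity is 0.\<close>

text \<open>Fenchel's inequality: \<open>exp (s - 1)\<close> is the convex conjugate of
  \<open>t * ln t\<close>, with equality at \<open>s = 1 + ln t\<close>. Every Jensen argument below
  is the instance where \<open>s\<close> is \<open>1 + ln\<close> of an average;
  \<open>s = 0\<close> gives the lower bound \<open>- exp (-1)\<close>.\<close>

lemma entropy_young:
  fixes s t :: real
  assumes "0 \<le> t"
  shows "s * t \<le> t * ln t + exp (s - 1)"
proof (cases "t = 0")
  case False
  then have t: "t > 0" using assms by simp
  have "t * (1 + (s - 1 - ln t)) \<le> t * exp (s - 1 - ln t)"
    using t by (intro mult_left_mono exp_ge_add_one_self) auto
  also have "\<dots> = exp (s - 1)"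
    using t by (simp add: exp_diff)
  finally show ?thesis by (simp add: algebra_simps)
qed simp

text \<open>\<open>Ent\<close> picks a density by \<open>SOME\<close>; two densities of the same
  measure agree almost everywhere, so the choice does not affect the integrals.\<close>

lemma Ent_density_nn:
  assumes "finite_measure m" "\<rho> \<in> borel_measurable m" "\<forall>x\<in>space m. 0 \<le> \<rho> x"
  shows "Ent m (density m (\<lambda>x. ennreal (\<rho> x))) =
    enn2ereal (\<integral>\<^sup>+ x. ennreal (\<rho> x * ln (\<rho> x)) \<partial>m) - enn2ereal (\<integral>\<^sup>+ x. ennreal (- (\<rho> x * ln (\<rho> x))) \<partial>m)"
proof -
  interpret finite_measure m by fact
  let ?P = "\<lambda>r. r \<in> borel_measurable m \<and> (\<forall>x\<in>space m. 0 \<le> r x)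
      \<and> density m (\<lambda>x. ennreal (\<rho> x)) = density m (\<lambda>x. ennreal (r x))"
  have ex: "?P \<rho>" using assms by auto
  define r where "r = (SOME r. ?P r)"
  have r: "?P r" unfolding r_def by (rule someI[of ?P, OF ex])
  have "AE x in m. ennreal (\<rho> x) = ennreal (r x)"
    using r assms by (subst density_unique_iff[symmetric]) auto
  then have ae: "AE x in m. \<rho> x = r x"
    by (rule AE_mp) (use r assms in \<open>auto intro!: AE_I2\<close>)
  have "Ent m (density m (\<lambda>x. ennreal (\<rho> x))) =
      enn2ereal (\<integral>\<^sup>+ x. ennreal (r x * ln (r x)) \<partial>m) - enn2ereal (\<integral>\<^sup>+ x. ennreal (- (r x * ln (r x))) \<partial>m)"
    using ex unfolding Ent_def Let_def r_def by auto
  moreover have "(\<integral>\<^sup>+ x. ennreal (r x * ln (r x)) \<partial>m) = (\<integral>\<^sup>+ x. ennreal (\<rho> x * ln (\<rho> x)) \<partial>m)"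
    using ae by (intro nn_integral_cong_AE) auto
  moreover have "(\<integral>\<^sup>+ x. ennreal (- (r x * ln (r x))) \<partial>m) = (\<integral>\<^sup>+ x. ennreal (- (\<rho> x * ln (\<rho> x))) \<partial>m)"
    using ae by (intro nn_integral_cong_AE) auto
  ultimately show ?thesis by simp
qed

text \<open>\<open>t * ln t\<close> is bounded below by \<open>- exp (-1)\<close> and
  \<open>m\<close> is finite.\<close>

lemma nn_integral_neg_entropy_finite:
  assumes "finite_measure m" "\<forall>x\<in>space m. 0 \<le> \<rho> x"
  shows "(\<integral>\<^sup>+ x. ennreal (- (\<rho> x * ln (\<rho> x))) \<partial>m) < \<infinity>"
proof -
  interpret finite_measure m by fact
  have "(\<integral>\<^sup>+ x. ennreal (- (\<rho> x * ln (\<rho> x))) \<partial>m) \<le> (\<integral>\<^sup>+ x. ennreal (exp (-1)) \<partial>m)"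
    using entropy_young[where s=0] assms(2)
    by (intro nn_integral_mono ennreal_leI) (smt (verit) mult_zero_left)
  also have "\<dots> < \<infinity>" by (simp add: ennreal_mult_less_top less_top[symmetric] ennreal_mult_eq_top_iff)
  finally show ?thesis .
qed

lemma Ent_density:
  assumes "finite_measure m" "\<rho> \<in> borel_measurable m" "\<forall>x\<in>space m. 0 \<le> \<rho> x"
    and int: "integrable m (\<lambda>x. \<rho> x * ln (\<rho> x))"
  shows "Ent m (density m (\<lambda>x. ennreal (\<rho> x))) = ereal (\<integral>x. \<rho> x * ln (\<rho> x) \<partial>m)"
proof -
  let ?p = "\<integral>\<^sup>+ x. ennreal (\<rho> x * ln (\<rho> x)) \<partial>m" and ?n = "\<integral>\<^sup>+ x. ennreal (- (\<rho> x * ln (\<rho> x))) \<partial>m"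
  have "?p < \<infinity>" "?n < \<infinity>"
    using int unfolding real_integrable_def by (auto simp: less_top)
  moreover have "(\<integral>x. \<rho> x * ln (\<rho> x) \<partial>m) = enn2real ?p - enn2real ?n"
    using int by (rule real_lebesgue_integral_def)
  ultimately show ?thesis
    unfolding Ent_density_nn[OF assms(1-3)]
    by (cases ?p; cases ?n) auto
qed

text \<open>The negative part always has finite integral, so excluding the value
  \<open>\<infinity>\<close> already makes the entropy a real number and the integrand
  integrable.\<close>

lemma Ent_finiteE:
  assumes "finite_measure m" "Ent m \<mu> \<noteq> \<infinity>"
  obtains \<rho> where "\<rho> \<in> borel_measurable m" "\<forall>x\<in>space m. 0 \<le> \<rho> x"
    "\<mu> = density m (\<lambda>x. ennreal (\<rho> x))" "integrable m (\<lambda>x. \<rho> x * ln (\<rho> x))"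
    "Ent m \<mu> = ereal (\<integral>x. \<rho> x * ln (\<rho> x) \<partial>m)"
proof -
  obtain \<rho> where \<rho>[measurable]: "\<rho> \<in> borel_measurable m" and pos: "\<forall>x\<in>space m. 0 \<le> \<rho> x"
    and \<mu>: "\<mu> = density m (\<lambda>x. ennreal (\<rho> x))"
    using assms(2) unfolding Ent_def by (auto split: if_splits)
  let ?p = "\<integral>\<^sup>+ x. ennreal (\<rho> x * ln (\<rho> x)) \<partial>m" and ?n = "\<integral>\<^sup>+ x. ennreal (- (\<rho> x * ln (\<rho> x))) \<partial>m"
  have n: "?n < \<infinity>" by (rule nn_integral_neg_entropy_finite[OF assms(1) pos])
  have "?p < \<infinity>"
    using assms(2) n unfolding \<mu> Ent_density_nn[OF assms(1) \<rho> pos]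
    by (cases ?p; cases ?n) auto
  then have int: "integrable m (\<lambda>x. \<rho> x * ln (\<rho> x))"
    using n unfolding real_integrable_def by (auto simp: less_top)
  show thesis
    by (rule that[OF \<rho> pos \<mu> int]) (unfold \<mu>, rule Ent_density[OF assms(1) \<rho> pos int])
qed

section \<open>Finite sums of measures\<close>

text \<open>\<open>N\<close> supplies the common sigma-algebra, so that the sum is a measure on the
  intended space for every index set, the empty one included.\<close>

definition msum :: "'k set \<Rightarrow> 'a measure \<Rightarrow> ('k \<Rightarrow> 'a measure) \<Rightarrow> 'a measure" where
  "msum A N P = measure_of (space N) (sets N) (\<lambda>B. \<Sum>k\<in>A. emeasure (P k) B)"

lemma space_msum[simp]: "space (msum A N P) = space N"
  and sets_msum[simp, measurable_cong]: "sets (msum A N P) = sets N"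
  unfolding msum_def by (simp_all add: space_measure_of_conv sets.sets_measure_of_eq)

lemma emeasure_msum:
  fixes N :: "'a measure"
  assumes "\<And>k. k \<in> A \<Longrightarrow> sets (P k) = sets N" "B \<in> sets N"
  shows "emeasure (msum A N P) B = (\<Sum>k\<in>A. emeasure (P k) B)"
proof (rule emeasure_measure_of[OF msum_def])
  show "countably_additive (sets (msum A N P)) (\<lambda>B. \<Sum>k\<in>A. emeasure (P k) B)"
  proof (rule countably_additiveI)
    fix F :: "nat \<Rightarrow> 'a set"
    assume F: "range F \<subseteq> sets (msum A N P)" "disjoint_family F" "\<Union> (range F) \<in> sets (msum A N P)"
    have "(\<Sum>i. \<Sum>k\<in>A. emeasure (P k) (F i)) = (\<Sum>k\<in>A. \<Sum>i. emeasure (P k) (F i))"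
      by (rule suminf_sum) auto
    also have "\<dots> = (\<Sum>k\<in>A. emeasure (P k) (\<Union> (range F)))"
      using F assms by (intro sum.cong suminf_emeasure) auto
    finally show "(\<Sum>i. \<Sum>k\<in>A. emeasure (P k) (F i)) = (\<Sum>k\<in>A. emeasure (P k) (\<Union> (range F)))" .
  qed
qed (use assms in \<open>auto simp: positive_def dest: sets.sets_into_space\<close>)

lemma nn_integral_msum:
  assumes P: "\<And>k. k \<in> A \<Longrightarrow> sets (P k) = sets N" and f: "f \<in> borel_measurable N"
  shows "(\<integral>\<^sup>+x. f x \<partial>msum A N P) = (\<Sum>k\<in>A. \<integral>\<^sup>+x. f x \<partial>P k)"
  using f
proof induction
  case (cong f g)
  have "(\<integral>\<^sup>+x. f x \<partial>P k) = (\<integral>\<^sup>+x. g x \<partial>P k)" if "k \<in> A" for k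
    using cong sets_eq_imp_space_eq[OF P[OF that]] by (intro nn_integral_cong) auto
  moreover have "(\<integral>\<^sup>+x. f x \<partial>msum A N P) = (\<integral>\<^sup>+x. g x \<partial>msum A N P)"
    using cong by (intro nn_integral_cong) auto
  ultimately show ?case using cong by simp
next
  case (set B)
  then have "(\<integral>\<^sup>+x. indicator B x \<partial>P k) = emeasure (P k) B" if "k \<in> A" for k
    using P[OF that] by simp
  then show ?case using set by (simp add: emeasure_msum[OF P])
next
  case (mult u c)
  have [measurable]: "u \<in> borel_measurable (P k)" if "k \<in> A" for k
    using mult P[OF that] by (simp cong: measurable_cong_sets)
  show ?case using mult by (simp add: nn_integral_cmult sum_distrib_left)
next
  case (add u v)
  have [measurable]: "u \<in> borel_measurable (P k)" "v \<in> borel_measurable (P k)" if "k \<in> A" for k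
    using add P[OF that] by (simp_all cong: measurable_cong_sets)
  show ?case using add by (simp add: nn_integral_add sum.distrib)
next
  case (seq U)
  have [measurable]: "U i \<in> borel_measurable (P k)" if "k \<in> A" for k i
    using seq P[OF that] by (simp cong: measurable_cong_sets)
  have inc: "incseq (\<lambda>i. \<integral>\<^sup>+x. U i x \<partial>P k)" for k
    using seq by (intro incseq_SucI nn_integral_mono) (simp add: incseq_SucD le_funD)
  have "(\<integral>\<^sup>+x. (SUP i. U i x) \<partial>msum A N P) = (SUP i. \<integral>\<^sup>+x. U i x \<partial>msum A N P)"
    using seq by (intro nn_integral_monotone_convergence_SUP) auto
  also have "\<dots> = (SUP i. \<Sum>k\<in>A. \<integral>\<^sup>+x. U i x \<partial>P k)" using seq by simp
  also have "\<dots> = (\<Sum>k\<in>A. SUP i. \<integral>\<^sup>+x. U i x \<partial>P k)"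
    using inc by (intro ennreal_SUP_sum) auto
  also have "\<dots> = (\<Sum>k\<in>A. \<integral>\<^sup>+x. (SUP i. U i x) \<partial>P k)"
    using seq by (intro sum.cong refl nn_integral_monotone_convergence_SUP[symmetric]) auto
  finally show ?case by (simp add: image_comp SUP_apply)
qed

section \<open>Borel measures on compact metric spaces\<close>

locale compact_metric = Metric_space +
  assumes compact: "compact_space mtopology"
begin

abbreviation real_continuous :: "('a \<Rightarrow> real) \<Rightarrow> bool" where
  "real_continuous \<equiv> continuous_map mtopology euclideanreal"

lemma space_mborel [simp]: "space (mborel M d) = M"
  and sets_mborel: "sets (mborel M d) = sigma_sets M {U. openin mtopology U}"
proof -
  have "{U. openin mtopology U} \<subseteq> Pow M"
    using openin_subset by fastforce
  then show "space (mborel M d) = M" "sets (mborel M d) = sigma_sets M {U. openin mtopology U}"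
    unfolding mborel_def by auto
qed

lemma openin_sets: "openin mtopology U \<Longrightarrow> U \<in> sets (mborel M d)"
  by (simp add: sets_mborel)

lemma measurable_mborel:
  assumes "\<And>U. openin mtopology U \<Longrightarrow> {x \<in> space N. f x \<in> U} \<in> sets N" "f \<in> space N \<rightarrow> M"
  shows "f \<in> measurable N (mborel M d)"
  unfolding mborel_def
proof (rule measurable_measure_of)
  fix U assume "U \<in> {U. openin mtopology U}"
  then have "{x \<in> space N. f x \<in> U} \<in> sets N" using assms(1) by simp
  also have "{x \<in> space N. f x \<in> U} = f -` U \<inter> space N" by auto
  finally show "f -` U \<inter> space N \<in> sets N" .
qed (use assms(2) openin_subset[of mtopology] in auto)

lemma mball_sets [measurable]: "mball a r \<in> sets (mborel M d)"
  by (simp add: openin_sets)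

lemma continuous_borel:
  "real_continuous f \<Longrightarrow> f \<in> borel_measurable (mborel M d)"
proof (rule borel_measurableI)
  fix S :: "real set" assume "real_continuous f" "open S"
  then have "openin mtopology {x \<in> topspace mtopology. f x \<in> S}"
    by (intro openin_continuous_map_preimage) auto
  moreover have "{x \<in> topspace mtopology. f x \<in> S} = f -` S \<inter> space (mborel M d)"
    by auto
  ultimately show "f -` S \<inter> space (mborel M d) \<in> sets (mborel M d)"
    by (metis openin_sets)
qed

lemma continuous_bounded:
  assumes "real_continuous f"
  obtains b where "0 \<le> b" "\<And>x. x \<in> M \<Longrightarrow> \<bar>f x\<bar> \<le> b"
proof -
  have "compactin euclideanreal (f ` M)"
    using image_compactin[OF _ assms, of M] compact by (simp add: compact_space_def)
  then have "bounded (f ` M)" by (simp add: compact_imp_bounded)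
  then obtain b where "b > 0" "\<forall>y\<in>f ` M. norm y \<le> b" by (auto simp: bounded_pos)
  then show thesis by (intro that[of b]) auto
qed

lemma continuous_dist: "a \<in> M \<Longrightarrow> real_continuous (\<lambda>x. d x a)"
proof -
  assume a: "a \<in> M"
  have "real_continuous (\<lambda>x. mdist (metric (M,d)) x a)"
    using a by (intro continuous_map_mdist) (auto simp: mtopology_of)
  then show ?thesis by simp
qed

lemma dist_bounded:
  obtains D where "0 \<le> D" "\<And>x y. x \<in> M \<Longrightarrow> y \<in> M \<Longrightarrow> d x y \<le> D"
proof -
  have "mbounded M"
    using compact compactin_imp_mbounded by (auto simp: compact_space_def)
  then obtain B where "\<forall>x\<in>M. \<forall>y\<in>M. d x y \<le> B" by (auto simp: mbounded_alt)
  then show thesis by (intro that[of "max B 0"]) force+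
qed

lemma finite_net:
  assumes "e > 0"
  obtains A where "finite A" "A \<subseteq> M" "\<And>x. x \<in> M \<Longrightarrow> \<exists>a\<in>A. d x a < e"
proof -
  have "mtotally_bounded M"
    using compact compact_space_eq_mcomplete_mtotally_bounded by blast
  then obtain A where "finite A" "A \<subseteq> M" "M \<subseteq> (\<Union>x\<in>A. mball x e)"
    using assms unfolding mtotally_bounded_def by metis
  then show thesis
    by (intro that[of A]) (auto simp: subset_iff commute Bex_def)
qed

lemma countable_dense:
  obtains Q where "countable Q" "Q \<subseteq> M" "\<And>x e. x \<in> M \<Longrightarrow> e > 0 \<Longrightarrow> \<exists>q\<in>Q. d x q < e"
proof -
  have "\<exists>A. finite A \<and> A \<subseteq> M \<and> (\<forall>x\<in>M. \<exists>a\<in>A. d x a < 1 / real (Suc n))" for n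
    by (rule finite_net[of "1 / real (Suc n)"]) auto
  then obtain F where F: "\<And>n. finite (F n)" "\<And>n. F n \<subseteq> M"
    "\<And>n x. x \<in> M \<Longrightarrow> \<exists>a\<in>F n. d x a < 1 / real (Suc n)" by metis
  show thesis
  proof (rule that[of "\<Union>n. F n"])
    fix x and e :: real assume "x \<in> M" "e > 0"
    then obtain n where "1 / real (Suc n) < e" using nat_approx_posE by blast
    with F(3)[OF \<open>x \<in> M\<close>, of n] show "\<exists>q\<in>\<Union>n. F n. d x q < e" by force
  qed (use F in \<open>auto intro: countable_finite\<close>)
qed

text \<open>A ball of radius below \<open>e/2\<close> around a point of a dense set near
  \<open>x\<close> stays inside the ball of radius \<open>e\<close> around \<open>x\<close>, so
  countably many centres and radii suffice.\<close>

lemma openin_countable_mballs: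
  assumes "openin mtopology U"
  obtains C where "countable C" "C \<subseteq> M \<times> UNIV" "U = (\<Union>(a,r)\<in>C. mball a r)"
proof -
  obtain Q where Q: "countable Q" "Q \<subseteq> M" "\<And>x e. x \<in> M \<Longrightarrow> e > 0 \<Longrightarrow> \<exists>q\<in>Q. d x q < e"
    using countable_dense by blast
  define C where "C = {(a,r). a \<in> Q \<and> r \<in> range (\<lambda>n. 1 / real (Suc n)) \<and> mball a r \<subseteq> U}"
  have "U \<subseteq> (\<Union>(a,r)\<in>C. mball a r)"
  proof
    fix x assume x: "x \<in> U"
    then obtain e where e: "e > 0" "mball x e \<subseteq> U" and xM: "x \<in> M"
      using assms unfolding openin_mtopology by blast
    obtain n where n: "1 / real (Suc n) < e / 2" using e nat_approx_posE[of "e/2"] by auto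
    obtain q where q: "q \<in> Q" "d x q < 1 / real (Suc n)"
      using Q(3)[OF xM, of "1 / real (Suc n)"] by auto
    have qM: "q \<in> M" using q Q by auto
    have "mball q (1 / real (Suc n)) \<subseteq> mball x e"
    proof
      fix y assume "y \<in> mball q (1 / real (Suc n))"
      then have y: "y \<in> M" "d q y < 1 / real (Suc n)" by auto
      have "d x y \<le> d x q + d q y" using xM qM y by (intro triangle) auto
      then show "y \<in> mball x e" using y xM q n by auto
    qed
    then have "(q, 1 / real (Suc n)) \<in> C" using q e unfolding C_def by auto
    moreover have "x \<in> mball q (1 / real (Suc n))" using q qM xM by (simp add: commute)
    ultimately show "x \<in> (\<Union>(a,r)\<in>C. mball a r)" by blast
  qed
  then have "U = (\<Union>(a,r)\<in>C. mball a r)" unfolding C_def by auto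
  moreover have "countable C"
    by (rule countable_subset[of _ "Q \<times> range (\<lambda>n. 1 / real (Suc n))"]) (auto simp: C_def Q)
  moreover have "C \<subseteq> M \<times> UNIV" using Q unfolding C_def by auto
  ultimately show thesis using that by blast
qed

text \<open>Balls are better generators than open sets: their indicators are explicit limits of
  functions of the distance, and the balls of the product metric are visibly measurable for the
  product sigma-algebra.\<close>

lemma sets_mborel_mball: "sets (mborel M d) = sigma_sets M {mball a r |a r. a \<in> M}"
proof -
  have "sigma_sets M {U. openin mtopology U} = sigma_sets M {mball a r |a r. a \<in> M}"
  proof (rule sigma_sets_eqI)
    fix U assume "U \<in> {U. openin mtopology U}"
    then obtain C where C: "countable C" "C \<subseteq> M \<times> UNIV" "U = (\<Union>(a,r)\<in>C. mball a r)"
      using openin_countable_mballs by blast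
    interpret sigma_algebra M "sigma_sets M {mball a r |a r. a \<in> M}"
      by (rule sigma_algebra_sigma_sets) auto
    show "U \<in> sigma_sets M {mball a r |a r. a \<in> M}"
      unfolding C(3) using C(1,2) by (intro countable_UN'') (auto intro!: sigma_sets.Basic)
  qed auto
  then show ?thesis by (simp add: sets_mborel)
qed

lemma integrable_continuous:
  assumes "finite_measure \<kappa>" "sets \<kappa> = sets (mborel M d)" "real_continuous h"
  shows "integrable \<kappa> h"
proof -
  interpret finite_measure \<kappa> by fact
  have sp: "space \<kappa> = M" using sets_eq_imp_space_eq[OF assms(2)] by simp
  obtain b where "\<And>x. x \<in> M \<Longrightarrow> \<bar>h x\<bar> \<le> b" using continuous_bounded[OF assms(3)] by metis
  then show ?thesis
    using continuous_borel[OF assms(3)] assms(2) sp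
    by (intro integrable_const_bound[of _ b]) (auto cong: measurable_cong_sets)
qed

section \<open>Density of the continuous functions in L1\<close>

text \<open>Membership in the L1-closure of the continuous functions. As a predicate it can be shown
  to be stable under limits and Lipschitz operations, which carries it from balls to Borel sets and
  then to all integrable functions.\<close>

definition L1_approx :: "'a measure \<Rightarrow> ('a \<Rightarrow> real) \<Rightarrow> bool" where
  "L1_approx \<kappa> f \<longleftrightarrow> integrable \<kappa> f \<and>
    (\<forall>e>0. \<exists>h. real_continuous h \<and> (\<integral>x. \<bar>h x - f x\<bar> \<partial>\<kappa>) < e)"

lemma L1_approx_lim:
  assumes \<kappa>: "finite_measure \<kappa>" "sets \<kappa> = sets (mborel M d)"
    and f: "integrable \<kappa> f" and s: "\<And>i. L1_approx \<kappa> (s i)"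
    and lim: "\<And>x. x \<in> space \<kappa> \<Longrightarrow> (\<lambda>i::nat. s i x) \<longlonglongrightarrow> f x"
    and bd: "integrable \<kappa> w" "\<And>i x. x \<in> space \<kappa> \<Longrightarrow> \<bar>s i x\<bar> \<le> w x"
  shows "L1_approx \<kappa> f"
  unfolding L1_approx_def
proof (intro conjI allI impI f)
  fix e :: real assume e: "e > 0"
  have si[measurable]: "integrable \<kappa> (s i)" for i using s unfolding L1_approx_def by auto
  have "(\<lambda>i. \<integral>x. \<bar>s i x - f x\<bar> \<partial>\<kappa>) \<longlonglongrightarrow> (\<integral>x. 0 \<partial>\<kappa>)"
  proof (rule integral_dominated_convergence[where w="\<lambda>x. w x + \<bar>f x\<bar>"])
    show "AE x in \<kappa>. (\<lambda>i. \<bar>s i x - f x\<bar>) \<longlonglongrightarrow> 0"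
      using lim by (intro AE_I2 tendsto_rabs_zero) (simp add: LIM_zero)
    show "AE x in \<kappa>. norm \<bar>s i x - f x\<bar> \<le> w x + \<bar>f x\<bar>" for i
    proof (rule AE_I2)
      fix x assume "x \<in> space \<kappa>"
      then show "norm \<bar>s i x - f x\<bar> \<le> w x + \<bar>f x\<bar>"
        using bd(2)[of x i] abs_triangle_ineq4[of "s i x" "f x"] by simp
    qed
  qed (use f si bd in \<open>auto intro: borel_measurable_integrable\<close>)
  then have "\<forall>\<^sub>F i in sequentially. (\<integral>x. \<bar>s i x - f x\<bar> \<partial>\<kappa>) < e / 2"
    using e by (intro order_tendstoD(2)[of _ 0]) auto
  then obtain i where i: "(\<integral>x. \<bar>s i x - f x\<bar> \<partial>\<kappa>) < e / 2"
    by (meson eventually_sequentially order_refl)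
  obtain h where h: "real_continuous h" "(\<integral>x. \<bar>h x - s i x\<bar> \<partial>\<kappa>) < e / 2"
    using s[of i] e unfolding L1_approx_def by (meson half_gt_zero)
  have ih: "integrable \<kappa> h" by (rule integrable_continuous[OF \<kappa> h(1)])
  have "(\<integral>x. \<bar>h x - f x\<bar> \<partial>\<kappa>) \<le> (\<integral>x. \<bar>h x - s i x\<bar> + \<bar>s i x - f x\<bar> \<partial>\<kappa>)"
    using ih si f by (intro integral_mono) auto
  also have "\<dots> = (\<integral>x. \<bar>h x - s i x\<bar> \<partial>\<kappa>) + (\<integral>x. \<bar>s i x - f x\<bar> \<partial>\<kappa>)"
    using ih si f by (intro Bochner_Integration.integral_add) auto
  also have "\<dots> < e" using i h by simp
  finally show "\<exists>h. real_continuous h \<and> (\<integral>x. \<bar>h x - f x\<bar> \<partial>\<kappa>) < e"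
    using h by blast
qed

text \<open>A Lipschitz \<open>op\<close> distorts L1 distances by at most the factor
  \<open>L\<close>. One statement serves complements (\<open>1 - x\<close>), finite unions
  (\<open>max\<close>), multiples and sums.\<close>

lemma L1_approx_combine:
  fixes op :: "real \<Rightarrow> real \<Rightarrow> real"
  assumes \<kappa>: "finite_measure \<kappa>" "sets \<kappa> = sets (mborel M d)"
    and f: "L1_approx \<kappa> f" and g: "L1_approx \<kappa> g" and int: "integrable \<kappa> (\<lambda>x. op (f x) (g x))"
    and cont: "\<And>h k. real_continuous h \<Longrightarrow> real_continuous k
       \<Longrightarrow> real_continuous (\<lambda>x. op (h x) (k x))"
    and op: "\<And>a b a' b'. \<bar>op a b - op a' b'\<bar> \<le> L * (\<bar>a - a'\<bar> + \<bar>b - b'\<bar>)"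
  shows "L1_approx \<kappa> (\<lambda>x. op (f x) (g x))"
  unfolding L1_approx_def
proof (intro conjI allI impI int)
  fix e :: real assume e: "e > 0"
  define e' where "e' = e / (2 * (\<bar>L\<bar> + 1))"
  have e': "e' > 0" "\<bar>L\<bar> * (2 * e') < e"
    using e by (auto simp: e'_def field_simps)
  obtain h where h: "real_continuous h" "(\<integral>x. \<bar>h x - f x\<bar> \<partial>\<kappa>) < e'"
    using f e' unfolding L1_approx_def by blast
  obtain k where k: "real_continuous k" "(\<integral>x. \<bar>k x - g x\<bar> \<partial>\<kappa>) < e'"
    using g e' unfolding L1_approx_def by blast
  have i: "integrable \<kappa> h" "integrable \<kappa> k" "integrable \<kappa> f" "integrable \<kappa> g"
      "integrable \<kappa> (\<lambda>x. op (h x) (k x))"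
    using f g h k \<kappa> unfolding L1_approx_def by (auto intro!: integrable_continuous cont)
  have "(\<integral>x. \<bar>op (h x) (k x) - op (f x) (g x)\<bar> \<partial>\<kappa>) \<le> (\<integral>x. \<bar>L\<bar> * (\<bar>h x - f x\<bar> + \<bar>k x - g x\<bar>) \<partial>\<kappa>)"
  proof (intro integral_mono)
    fix x
    have "\<bar>op (h x) (k x) - op (f x) (g x)\<bar> \<le> L * (\<bar>h x - f x\<bar> + \<bar>k x - g x\<bar>)" by (rule op)
    also have "\<dots> \<le> \<bar>L\<bar> * (\<bar>h x - f x\<bar> + \<bar>k x - g x\<bar>)" by (intro mult_right_mono) auto
    finally show "\<bar>op (h x) (k x) - op (f x) (g x)\<bar> \<le> \<bar>L\<bar> * (\<bar>h x - f x\<bar> + \<bar>k x - g x\<bar>)" .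
  qed (use i int in auto)
  also have "\<dots> = \<bar>L\<bar> * ((\<integral>x. \<bar>h x - f x\<bar> \<partial>\<kappa>) + (\<integral>x. \<bar>k x - g x\<bar> \<partial>\<kappa>))"
    using i by simp
  also have "\<dots> \<le> \<bar>L\<bar> * (2 * e')" using h k by (intro mult_left_mono) auto
  also have "\<dots> < e" by (rule e')
  finally show "\<exists>h. real_continuous h \<and> (\<integral>x. \<bar>h x - op (f x) (g x)\<bar> \<partial>\<kappa>) < e"
    using cont[OF h(1) k(1)] by blast
qed

lemma L1_approx_continuous:
  assumes "finite_measure \<kappa>" "sets \<kappa> = sets (mborel M d)" "real_continuous h"
  shows "L1_approx \<kappa> h"
  unfolding L1_approx_def using integrable_continuous[OF assms] assms(3)
  by (auto intro!: exI[of _ h])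

lemma L1_approx_indicator:
  assumes \<kappa>: "finite_measure \<kappa>" "sets \<kappa> = sets (mborel M d)" and "A \<in> sets (mborel M d)"
  shows "L1_approx \<kappa> (indicator A)"
proof -
  interpret finite_measure \<kappa> by fact
  have sp: "space \<kappa> = M" using sets_eq_imp_space_eq[OF \<kappa>(2)] by simp
  have ii: "integrable \<kappa> (indicator A :: 'a \<Rightarrow> real)" if "A \<in> sigma_sets M {mball a r |a r. a \<in> M}" for A
    using that \<kappa>(2) by (intro integrable_const_bound[of _ 1] borel_measurable_indicator) (auto simp: sets_mborel_mball)
  from assms(3) show ?thesis
    unfolding sets_mborel_mball
  proof (induction rule: sigma_sets.induct)
    case (Basic B)
    then obtain a r where B: "B = mball a r" and a: "a \<in> M" by auto
    \<comment> \<open>Continuous tent functions cut off at 1: inside the ball the slope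
      \<open>n\<close> eventually lifts them to 1, outside they vanish.\<close>
    define s where "s n x = min 1 (real n * max 0 (r - d x a))" for n x
    show ?case
    proof (rule L1_approx_lim[OF \<kappa> ii, where s=s and w="\<lambda>x. 1"])
      show "B \<in> sigma_sets M {mball a r |a r. a \<in> M}" using Basic by auto
      show "L1_approx \<kappa> (s n)" for n
        unfolding s_def by (intro L1_approx_continuous \<kappa> continuous_intros continuous_dist a)
      fix x assume "x \<in> space \<kappa>"
      then have x: "x \<in> M" by (simp add: sp)
      show "(\<lambda>n. s n x) \<longlonglongrightarrow> indicator B x"
      proof (cases "x \<in> B")
        case True
        then have pos: "r - d x a > 0" by (simp add: B commute)
        then have "filterlim (\<lambda>n. (r - d x a) * real n) at_top sequentially"
          by (intro filterlim_tendsto_pos_mult_at_top[OF tendsto_const] filterlim_real_sequentially)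
        then have "\<forall>\<^sub>F n in sequentially. (r - d x a) * real n \<ge> 1"
          by (simp add: filterlim_at_top)
        then have "\<forall>\<^sub>F n in sequentially. s n x = 1"
          by eventually_elim (use pos in \<open>auto simp: s_def mult.commute\<close>)
        then show ?thesis using True by (simp add: tendsto_eventually)
      next
        case False
        then have "s n x = 0" for n using x a by (auto simp: B s_def commute)
        then show ?thesis using False by simp
      qed
    qed (auto simp: s_def)
  next
    case Empty
    have "(indicator {} :: 'a \<Rightarrow> real) = (\<lambda>x. 0)" by auto
    then show ?case using L1_approx_continuous[OF \<kappa>, of "\<lambda>x. 0"] by simp
  next
    case (Compl B)
    have "L1_approx \<kappa> (\<lambda>x. 1 - indicator B x)"
      by (rule L1_approx_combine[OF \<kappa> L1_approx_continuous[OF \<kappa>, of "\<lambda>x. 1"] Compl.IH, where L=1])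
        (auto intro!: continuous_intros Bochner_Integration.integrable_diff ii Compl)
    moreover have "\<forall>x\<in>space \<kappa>. 1 - indicator B x = (indicator (M - B) x :: real)"
      by (auto simp: sp indicator_def)
    moreover have "integrable \<kappa> (indicator (M - B) :: 'a \<Rightarrow> real)"
      using Compl by (intro ii sigma_sets.Compl)
    ultimately show ?case
      unfolding L1_approx_def by (simp cong: Bochner_Integration.integral_cong)
  next
    case (Union B)
    interpret S: sigma_algebra M "sigma_sets M {mball a r |a r. a \<in> M}"
      by (rule sigma_algebra_sigma_sets) auto
    have U: "(\<Union>i<n. B i) \<in> sigma_sets M {mball a r |a r. a \<in> M}" for n :: nat
      using Union by (intro S.countable_UN'') auto
    \<comment> \<open>Induction over the generated sigma-algebra gives no disjointness, so finite
      unions are built with \<open>max\<close> before passing to the increasing limit.\<close>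
    have fin: "L1_approx \<kappa> (indicator (\<Union>i<n. B i))" for n :: nat
    proof (induction n)
      case 0
      have "(indicator {} :: 'a \<Rightarrow> real) = (\<lambda>x. 0)" by auto
      then show ?case using L1_approx_continuous[OF \<kappa>, of "\<lambda>x. 0"] by simp
    next
      case (Suc n)
      have eq: "(\<lambda>x. max (indicator (\<Union>i<n. B i) x) (indicator (B n) x)) = (indicator (\<Union>i<Suc n. B i) :: 'a \<Rightarrow> real)"
        by (auto simp: indicator_def fun_eq_iff less_Suc_eq)
      have "L1_approx \<kappa> (\<lambda>x. max (indicator (\<Union>i<n. B i) x) (indicator (B n) x))"
        by (rule L1_approx_combine[OF \<kappa> Suc.IH Union.IH, where L=1])
          (auto simp: eq intro!: continuous_intros ii U)
      then show ?case by (simp add: eq)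
    qed
    show ?case
    proof (rule L1_approx_lim[OF \<kappa> ii fin, where w="\<lambda>x. 1"])
      fix x
      show "(\<lambda>n. indicator (\<Union>i<n. B i) x :: real) \<longlonglongrightarrow> indicator (\<Union>i. B i) x"
        by (rule LIMSEQ_indicator_UN)
    qed (use Union in \<open>auto intro!: sigma_sets.Union simp: indicator_def\<close>)
  qed
qed

lemma L1_approx_integrable:
  assumes \<kappa>: "finite_measure \<kappa>" "sets \<kappa> = sets (mborel M d)" and "integrable \<kappa> f"
  shows "L1_approx \<kappa> f"
  using assms(3)
proof (induction rule: integrable_induct)
  case (base A c)
  have A: "L1_approx \<kappa> (indicator A)" using base \<kappa> by (intro L1_approx_indicator) auto
  have "\<bar>a *\<^sub>R c - a' *\<^sub>R c\<bar> \<le> \<bar>c\<bar> * (\<bar>a - a'\<bar> + \<bar>b - b'\<bar>)" for a a' b b' :: real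
    by (simp add: abs_mult mult.commute mult_left_mono flip: left_diff_distrib)
  moreover have "integrable \<kappa> (\<lambda>x. indicator A x *\<^sub>R c)"
    using base by (intro integrable_scaleR_left) (auto simp: integrable_indicator_iff)
  ultimately show ?case
    by (intro L1_approx_combine[OF \<kappa> A A, where op="\<lambda>a b. a *\<^sub>R c" and L="\<bar>c\<bar>"])
      (auto intro!: continuous_map_real_mult_right)
next
  case (add f g)
  then show ?case
    by (intro L1_approx_combine[OF \<kappa>, where op="(+)" and L=1] continuous_map_add) auto
next
  case (lim f s)
  then show ?case
    by (intro L1_approx_lim[OF \<kappa>, of f s "\<lambda>x. 2 * \<bar>f x\<bar>"]) auto
qed

text \<open>Approximation in L1 of the sum of the two measures controls both errors at once. A
  common \<open>h\<close> is what a comparison of \<open>\<mu>\<close> with \<open>\<nu>\<close>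
  requires.\<close>

lemma continuous_approx_two:
  assumes \<mu>: "finite_measure \<mu>" "sets \<mu> = sets (mborel M d)"
    and \<nu>: "finite_measure \<nu>" "sets \<nu> = sets (mborel M d)"
    and f: "f \<in> borel_measurable (mborel M d)" "\<And>x. x \<in> M \<Longrightarrow> \<bar>f x\<bar> \<le> (b::real)" and e: "e > 0"
  obtains h where "real_continuous h"
    "(\<integral>x. \<bar>h x - f x\<bar> \<partial>\<mu>) < e" "(\<integral>x. \<bar>h x - f x\<bar> \<partial>\<nu>) < e"
proof -
  define \<kappa> where "\<kappa> = msum {0::nat,1} (mborel M d) (\<lambda>k. if k = 0 then \<mu> else \<nu>)"
  have s: "sets (if k = 0 then \<mu> else \<nu>) = sets (mborel M d)" for k :: nat using \<mu> \<nu> by auto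
  have \<kappa>: "finite_measure \<kappa>" "sets \<kappa> = sets (mborel M d)"
  proof
    have "emeasure \<kappa> (space \<kappa>) = emeasure \<mu> (space \<kappa>) + emeasure \<nu> (space \<kappa>)"
      unfolding \<kappa>_def by (subst emeasure_msum) (use s sets.top[of "mborel M d"] in auto)
    then show "emeasure \<kappa> (space \<kappa>) \<noteq> \<infinity>"
      using finite_measure.emeasure_finite[OF \<mu>(1)] finite_measure.emeasure_finite[OF \<nu>(1)]
      by (simp add: ennreal_add_eq_top)
  qed (simp add: \<kappa>_def)
  have nn: "(\<integral>\<^sup>+x. g x \<partial>\<kappa>) = (\<integral>\<^sup>+x. g x \<partial>\<mu>) + (\<integral>\<^sup>+x. g x \<partial>\<nu>)" if "g \<in> borel_measurable (mborel M d)" for g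
    unfolding \<kappa>_def by (subst nn_integral_msum) (use s that in auto)
  have fi: "integrable N f" if N: "finite_measure N" "sets N = sets (mborel M d)" for N
  proof -
    interpret finite_measure N by fact
    have "space N = M" using sets_eq_imp_space_eq[OF N(2)] by simp
    then show ?thesis
      using f unfolding measurable_cong_sets[OF N(2) refl, symmetric]
      by (intro integrable_const_bound[of _ b]) auto
  qed
  obtain h where h: "real_continuous h" "(\<integral>x. \<bar>h x - f x\<bar> \<partial>\<kappa>) < e"
    using L1_approx_integrable[OF \<kappa> fi[OF \<kappa>]] e unfolding L1_approx_def by blast
  have hi: "integrable N (\<lambda>x. \<bar>h x - f x\<bar>)" if N: "finite_measure N" "sets N = sets (mborel M d)" for N
    using integrable_continuous[OF N h(1)] fi[OF N] by auto
  have eq: "ennreal (\<integral>x. \<bar>h x - f x\<bar> \<partial>N) = (\<integral>\<^sup>+x. ennreal \<bar>h x - f x\<bar> \<partial>N)"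
    if N: "finite_measure N" "sets N = sets (mborel M d)" for N
    by (rule nn_integral_eq_integral[OF hi[OF N], symmetric]) simp
  have "ennreal (\<integral>x. \<bar>h x - f x\<bar> \<partial>\<kappa>) = ennreal (\<integral>x. \<bar>h x - f x\<bar> \<partial>\<mu>) + ennreal (\<integral>x. \<bar>h x - f x\<bar> \<partial>\<nu>)"
    unfolding eq[OF \<kappa>] eq[OF \<mu>] eq[OF \<nu>] using continuous_borel[OF h(1)] f(1) by (intro nn) measurable
  also have "\<dots> = ennreal ((\<integral>x. \<bar>h x - f x\<bar> \<partial>\<mu>) + (\<integral>x. \<bar>h x - f x\<bar> \<partial>\<nu>))"
    by (rule ennreal_plus[symmetric]) auto
  finally have "(\<integral>x. \<bar>h x - f x\<bar> \<partial>\<kappa>) = (\<integral>x. \<bar>h x - f x\<bar> \<partial>\<mu>) + (\<integral>x. \<bar>h x - f x\<bar> \<partial>\<nu>)"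
    by (subst (asm) ennreal_inj) auto
  moreover have "0 \<le> (\<integral>x. \<bar>h x - f x\<bar> \<partial>\<mu>)" "0 \<le> (\<integral>x. \<bar>h x - f x\<bar> \<partial>\<nu>)" by auto
  ultimately show thesis using h by (intro that[of h]) linarith+
qed

text \<open>The indicator of a Borel set is replaced by one continuous function that is close to it
  for both measures.\<close>

lemma measure_eqI_continuous:
  assumes \<mu>: "finite_measure \<mu>" "sets \<mu> = sets (mborel M d)"
    and \<nu>: "finite_measure \<nu>" "sets \<nu> = sets (mborel M d)"
    and eq: "\<And>h. real_continuous h \<Longrightarrow> (\<integral>x. h x \<partial>\<mu>) = (\<integral>x. h x \<partial>\<nu>)"
  shows "\<mu> = \<nu>"
proof (rule measure_eqI)
  interpret \<mu>: finite_measure \<mu> by fact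
  interpret \<nu>: finite_measure \<nu> by fact
  fix A assume "A \<in> sets \<mu>"
  then have A[measurable]: "A \<in> sets (mborel M d)" using \<mu> by simp
  have "\<bar>measure \<mu> A - measure \<nu> A\<bar> \<le> 0 + e" if e: "e > 0" for e
  proof -
    obtain h where h: "real_continuous h"
      "(\<integral>x. \<bar>h x - indicator A x\<bar> \<partial>\<mu>) < e/2" "(\<integral>x. \<bar>h x - indicator A x\<bar> \<partial>\<nu>) < e/2"
      by (rule continuous_approx_two[OF \<mu> \<nu>, of "indicator A" 1 "e/2"]) (use e in auto)
    have bd: "\<bar>(\<integral>x. h x \<partial>N) - measure N A\<bar> \<le> (\<integral>x. \<bar>h x - indicator A x\<bar> \<partial>N)"
      if N: "finite_measure N" "sets N = sets (mborel M d)" for N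
    proof -
      have iA: "integrable N (indicator A :: 'a \<Rightarrow> real)"
        using A N by (auto simp: integrable_indicator_iff finite_measure.emeasure_finite less_top[symmetric])
      then show ?thesis
        using integral_abs_bound[of N "\<lambda>x. h x - indicator A x"] integrable_continuous[OF N h(1)] A N by simp
    qed
    show ?thesis using bd[OF \<mu>] bd[OF \<nu>] h eq[OF h(1)] by linarith
  qed
  then have "\<bar>measure \<mu> A - measure \<nu> A\<bar> \<le> 0" by (rule field_le_epsilon)
  then show "emeasure \<mu> A = emeasure \<nu> A"
    by (simp add: \<mu>.emeasure_eq_measure \<nu>.emeasure_eq_measure)
qed (use \<mu> \<nu> in simp)

end

section \<open>Weak compactness\<close>

text \<open>At the first differing digit \<open>k\<close> the sums differ by \<open>(1/3)^k\<close>,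
  and all later digits can compensate at most half of that. In base 2 the tail could cancel the
  leading difference completely.\<close>

lemma ternary_separation:
  fixes b c :: "nat \<Rightarrow> real"
  assumes bc: "\<And>n. b n \<in> {0,1}" "\<And>n. c n \<in> {0,1}" and "b n \<noteq> c n" "n \<le> N"
  shows "(1/3)^N / 2 \<le> \<bar>(\<Sum>n. b n * (1/3)^n) - (\<Sum>n. c n * (1/3)^n)\<bar>"
proof -
  define k where "k = (LEAST n. b n \<noteq> c n)"
  have k: "b k \<noteq> c k" unfolding k_def by (rule LeastI[of "\<lambda>n. b n \<noteq> c n", OF assms(3)])
  have kn: "k \<le> n" unfolding k_def by (rule Least_le[of "\<lambda>n. b n \<noteq> c n", OF assms(3)])
  have ki: "b i = c i" if "i < k" for i
    using not_less_Least[of i "\<lambda>n. b n \<noteq> c n"] that unfolding k_def by blast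
  define a where "a n = (b n - c n) * (1/3)^n" for n
  have bd: "\<bar>b n - c n\<bar> \<le> 1" for n using bc[of n] by auto
  have geo: "summable (\<lambda>n. (1/3::real)^n)" by (rule summable_geometric) simp
  have na: "norm (a n) \<le> (1/3)^n" for n
    using mult_right_mono[OF bd[of n], of "(1/3)^n"] by (simp add: a_def abs_mult)
  have sa: "summable a" by (rule summable_comparison_test'[OF geo na])
  have "norm (b n * (1/3)^n) \<le> (1/3)^n" "norm (c n * (1/3)^n) \<le> (1/3)^n" for n
    using bc(1)[of n] bc(2)[of n] by auto
  then have "summable (\<lambda>n. b n * (1/3)^n)" "summable (\<lambda>n. c n * (1/3)^n)"
    by (auto intro: summable_comparison_test'[OF geo])
  then have "(\<Sum>n. b n * (1/3)^n) - (\<Sum>n. c n * (1/3)^n) = (\<Sum>n. a n)"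
    by (simp add: suminf_diff a_def left_diff_distrib)
  also have "\<dots> = (\<Sum>n. a (n + Suc k)) + (\<Sum>i<Suc k. a i)"
    by (rule suminf_split_initial_segment[OF sa])
  also have "(\<Sum>i<Suc k. a i) = a k"
    using ki by (simp add: a_def)
  finally have eq: "(\<Sum>n. b n * (1/3)^n) - (\<Sum>n. c n * (1/3)^n) = (\<Sum>n. a (n + Suc k)) + a k" .
  have "norm (\<Sum>n. a (n + Suc k)) \<le> (\<Sum>n. (1/3)^(n + Suc k))"
    by (rule norm_suminf_le[OF na summable_ignore_initial_segment[OF geo]])
  also have "\<dots> = (\<Sum>n. (1/3)^Suc k * (1/3)^n)" by (simp add: power_add mult.commute)
  also have "\<dots> = (1/3)^Suc k * (\<Sum>n. (1/3)^n)" by (rule suminf_mult[OF geo])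
  also have "(\<Sum>n. (1/3::real)^n) = 3/2" by (subst suminf_geometric) auto
  also have "(1/3)^Suc k * (3/2) = (1/3::real)^k / 2" by simp
  finally have "\<bar>\<Sum>n. a (n + Suc k)\<bar> \<le> (1/3)^k / 2" by simp
  moreover have "\<bar>a k\<bar> = (1/3)^k"
    using k bc(1)[of k] bc(2)[of k] by (auto simp: a_def)
  moreover have "(1/3::real)^N \<le> (1/3)^k"
    using kn assms(4) by (intro power_decreasing) auto
  ultimately show ?thesis unfolding eq by linarith
qed

context compact_metric
begin

text \<open>The ternary digits of \<open>r x\<close> record which balls of a countable family
  contain \<open>x\<close>. The function \<open>r\<close> is Borel but in general not continuous;
  only its inverse is uniformly continuous, because close codes agree on all digits up to a given
  index.\<close>

lemma real_encoding:
  assumes "M \<noteq> {}"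
  obtains r :: "'a \<Rightarrow> real" where "r \<in> borel_measurable (mborel M d)" "\<And>x. 0 \<le> r x" "\<And>x. r x \<le> 2"
    "\<And>e. e > 0 \<Longrightarrow> \<exists>\<delta>>0. \<forall>x\<in>M. \<forall>y\<in>M. \<bar>r x - r y\<bar> < \<delta> \<longrightarrow> d x y < e"
proof -
  have "\<exists>A. finite A \<and> A \<subseteq> M \<and> (\<forall>x\<in>M. \<exists>a\<in>A. d x a < 1 / real (Suc n))" for n
    by (rule finite_net[of "1 / real (Suc n)"]) auto
  then obtain F where F: "\<And>n. finite (F n)" "\<And>n. F n \<subseteq> M"
    "\<And>n x. x \<in> M \<Longrightarrow> \<exists>a\<in>F n. d x a < 1 / real (Suc n)" by metis
  define P where "P = Sigma (UNIV :: nat set) F"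
  have "countable P" unfolding P_def using F by (intro countable_SIGMA) (auto intro: countable_finite)
  moreover have "P \<noteq> {}" using F(3)[of _ 0] assms unfolding P_def by fastforce
  ultimately obtain c :: "nat \<Rightarrow> nat \<times> 'a" where c: "range c = P"
    by (metis range_from_nat_into)
  define B where "B n = mball (snd (c n)) (1 / real (Suc (fst (c n))))" for n
  define r :: "'a \<Rightarrow> real" where "r x = (\<Sum>n. indicator (B n) x * (1/3)^n)" for x
  have geo: "summable (\<lambda>n. (1/3::real)^n)" by (rule summable_geometric) simp
  have smm: "summable (\<lambda>n. indicator (B n) x * (1/3::real)^n)" for x
    by (rule summable_comparison_test'[OF geo, of 0]) (auto simp: indicator_def)
  show thesis
  proof (rule that[of r])
    have [measurable]: "B n \<in> sets (mborel M d)" for n unfolding B_def by simp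
    show "r \<in> borel_measurable (mborel M d)" unfolding r_def by measurable
    show "0 \<le> r x" for x unfolding r_def by (intro suminf_nonneg smm) auto
    have "r x \<le> (\<Sum>n. (1/3)^n)" for x
      unfolding r_def by (intro suminf_le smm geo) (auto simp: indicator_def)
    also have "(\<Sum>n. (1/3::real)^n) \<le> 2" by (subst suminf_geometric) auto
    finally show "r x \<le> 2" for x .
    fix e :: real assume "e > 0"
    then obtain k where k: "1 / real (Suc k) < e / 2" using nat_approx_posE[of "e/2"] by auto
    have "\<forall>a\<in>F k. \<exists>n. c n = (k, a)"
    proof
      fix a assume "a \<in> F k"
      then have "(k, a) \<in> range c" unfolding c P_def by simp
      then show "\<exists>n. c n = (k, a)" by (metis rangeE)
    qed
    then obtain idx where idx: "\<And>a. a \<in> F k \<Longrightarrow> c (idx a) = (k, a)" by metis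
    \<comment> \<open>For the finite net of scale \<open>1 / (k+1)\<close>, digits up to
      \<open>N\<close> decide membership in all its balls. Codes closer than
      \<open>(1/3)^N / 2\<close> therefore put \<open>x\<close> and \<open>y\<close> into a common
      ball of radius below \<open>e/2\<close>.\<close>
    define N where "N = Max (insert 0 (idx ` F k))"
    have N: "idx a \<le> N" if "a \<in> F k" for a
      unfolding N_def using that F(1) by (intro Max_ge) auto
    show "\<exists>\<delta>>0. \<forall>x\<in>M. \<forall>y\<in>M. \<bar>r x - r y\<bar> < \<delta> \<longrightarrow> d x y < e"
    proof (intro exI[of _ "(1/3)^N/2"] conjI ballI impI)
      fix x y assume x: "x \<in> M" and y: "y \<in> M" and lt: "\<bar>r x - r y\<bar> < (1/3)^N/2"
      obtain a where a: "a \<in> F k" "d x a < 1 / real (Suc k)" using F(3)[OF x] by blast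
      have aM: "a \<in> M" using a F(2) by auto
      have "x \<in> B (idx a)" using a x aM idx by (simp add: B_def commute)
      moreover have "(indicator (B (idx a)) x :: real) = indicator (B (idx a)) y"
      proof (rule ccontr)
        assume "(indicator (B (idx a)) x :: real) \<noteq> indicator (B (idx a)) y"
        then have "(1/3)^N/2 \<le> \<bar>r x - r y\<bar>"
          unfolding r_def by (intro ternary_separation[OF _ _ _ N[OF a(1)]]) (auto simp: indicator_def)
        then show False using lt by simp
      qed
      ultimately have "y \<in> B (idx a)" by (auto simp: indicator_def split: if_splits)
      then have "d a y < 1 / real (Suc k)" using a idx by (simp add: B_def)
      moreover have "d x y \<le> d x a + d a y" using x y aM by (intro triangle) auto
      ultimately show "d x y < e" using a k by linarith
    qed simp
  qed
qed

text \<open>The encoding is injective with uniformly continuous inverse, so the inverse extends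
  to a continuous map on the closure of the (in general not closed) image.\<close>
lemma real_decoding:
  assumes "M \<noteq> {}"
  obtains r :: "'a \<Rightarrow> real" and C :: "real set" and h :: "real \<Rightarrow> 'a"
  where "r \<in> borel_measurable (mborel M d)" "\<And>x. 0 \<le> r x" "\<And>x. r x \<le> 2"
    "closed C" "\<And>x. x \<in> M \<Longrightarrow> r x \<in> C" "C \<noteq> {}" "\<And>t. h t \<in> M" "\<And>x. x \<in> M \<Longrightarrow> h (r x) = x"
    "\<And>t e. t \<in> C \<Longrightarrow> e > 0 \<Longrightarrow> \<exists>\<delta>>0. \<forall>s\<in>C. \<bar>s - t\<bar> < \<delta> \<longrightarrow> d (h t) (h s) < e"
proof -
  obtain r :: "'a \<Rightarrow> real" where r: "r \<in> borel_measurable (mborel M d)" "\<And>x. 0 \<le> r x" "\<And>x. r x \<le> 2"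
    and uc: "\<And>e. e > 0 \<Longrightarrow> \<exists>\<delta>>0. \<forall>x\<in>M. \<forall>y\<in>M. \<bar>r x - r y\<bar> < \<delta> \<longrightarrow> d x y < e"
    using real_encoding[OF assms] by blast
  define C where "C = closure (r ` M)"
  \<comment> \<open>A point of the closure is a limit of codes of points \<open>z n\<close>.
    Compactness gives a limit point \<open>y\<close> of these, and uniform continuity shows that
    every point with code near \<open>t\<close> is near \<open>y\<close>.\<close>
  have lim: "\<exists>y\<in>M. \<forall>e>0. \<exists>\<delta>>0. \<forall>x\<in>M. \<bar>r x - t\<bar> < \<delta> \<longrightarrow> d x y < e" if t: "t \<in> C" for t
  proof -
    obtain u where u: "\<forall>n. u n \<in> r ` M" "u \<longlonglongrightarrow> t"
      using t unfolding C_def closure_sequential by blast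
    have "\<forall>n. \<exists>z. z \<in> M \<and> u n = r z" using u by blast
    then obtain z where z: "\<And>n. z n \<in> M" "\<And>n. u n = r (z n)" by metis
    have rz: "(\<lambda>n. r (z n)) \<longlonglongrightarrow> t" using u(2) unfolding z(2)[abs_def] .
    have "range z \<subseteq> M" using z by auto
    then obtain y k where y: "y \<in> M" "strict_mono k" "limitin mtopology (z \<circ> k) y sequentially"
      using compact unfolding compact_space_sequentially by blast
    have rk: "(\<lambda>n. r (z (k n))) \<longlonglongrightarrow> t"
      using LIMSEQ_subseq_LIMSEQ[OF rz y(2)] by (simp add: o_def)
    show ?thesis
    proof (intro bexI[of _ y] allI impI)
      fix e :: real assume "e > 0"
      then obtain \<delta> where \<delta>: "\<delta> > 0" "\<And>x y. x \<in> M \<Longrightarrow> y \<in> M \<Longrightarrow> \<bar>r x - r y\<bar> < \<delta> \<Longrightarrow> d x y < e / 2"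
        using uc[of "e/2"] by (meson half_gt_zero)
      show "\<exists>\<delta>>0. \<forall>x\<in>M. \<bar>r x - t\<bar> < \<delta> \<longrightarrow> d x y < e"
      proof (intro exI[of _ "\<delta>/2"] conjI ballI impI)
        fix x assume x: "x \<in> M" "\<bar>r x - t\<bar> < \<delta> / 2"
        have "\<forall>\<^sub>F n in sequentially. \<bar>r (z (k n)) - t\<bar> < \<delta> / 2"
          using tendstoD[OF rk, of "\<delta>/2"] \<delta>(1) by (simp add: dist_real_def)
        moreover have "\<forall>\<^sub>F n in sequentially. d (z (k n)) y < e / 2"
        proof -
          have "\<forall>\<^sub>F n in sequentially. (z \<circ> k) n \<in> M \<and> d ((z \<circ> k) n) y < e / 2"
            using limitin_metric[THEN iffD1, OF y(3)] half_gt_zero[OF \<open>e > 0\<close>] by blast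
          then show ?thesis by eventually_elim simp
        qed
        ultimately have "\<forall>\<^sub>F n in sequentially. \<bar>r (z (k n)) - t\<bar> < \<delta> / 2 \<and> d (z (k n)) y < e / 2"
          by (rule eventually_conj)
        then obtain n where n: "\<bar>r (z (k n)) - t\<bar> < \<delta> / 2" "d (z (k n)) y < e / 2"
          using eventually_happens'[OF sequentially_bot] by blast
        have "\<bar>r x - r (z (k n))\<bar> < \<delta>" using x(2) n(1) by linarith
        then have "d x (z (k n)) < e / 2" using x(1) z(1) by (intro \<delta>(2))
        moreover have "d x y \<le> d x (z (k n)) + d (z (k n)) y" using x y z(1) by (intro triangle) auto
        ultimately show "d x y < e" using n by linarith
      qed (use \<delta>(1) in auto)
    qed (rule y)
  qed
  obtain x0 where x0: "x0 \<in> M" using assms by auto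
  define h where "h t = (if t \<in> C then SOME y. y \<in> M \<and> (\<forall>e>0. \<exists>\<delta>>0. \<forall>x\<in>M. \<bar>r x - t\<bar> < \<delta> \<longrightarrow> d x y < e) else x0)" for t
  have h: "h t \<in> M \<and> (\<forall>e>0. \<exists>\<delta>>0. \<forall>x\<in>M. \<bar>r x - t\<bar> < \<delta> \<longrightarrow> d x (h t) < e)" if "t \<in> C" for t
    unfolding h_def if_P[OF that] by (rule someI_ex) (use lim[OF that] in blast)
  have rC: "r x \<in> C" if "x \<in> M" for x unfolding C_def using that by (intro subsetD[OF closure_subset] imageI)
  have hM: "h t \<in> M" for t
  proof (cases "t \<in> C")
    case True
    then show ?thesis by (rule conjunct1[OF h])
  qed (simp add: h_def x0)
  have hr: "h (r x) = x" if x: "x \<in> M" for x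
  proof -
    have "d x (h (r x)) \<le> 0 + e" if "e > 0" for e
      proof -
      obtain \<delta> where "\<delta> > 0" "\<forall>y\<in>M. \<bar>r y - r x\<bar> < \<delta> \<longrightarrow> d y (h (r x)) < e"
        using conjunct2[OF h[OF rC[OF x]]] \<open>e > 0\<close> by blast
      then have "d x (h (r x)) < e" using x by (metis abs_zero diff_self)
      then show ?thesis by simp
    qed
    then have "d x (h (r x)) \<le> 0" by (rule field_le_epsilon)
    then have "d x (h (r x)) = 0" by (intro order_antisym) auto
    then show ?thesis using zero[OF x hM] by simp
  qed
  \<comment> \<open>The values \<open>h t\<close> and \<open>h s\<close> are compared through
    genuine points whose codes are close to \<open>t\<close> and \<open>s\<close>; each of the three
    distances is below \<open>e/3\<close>.\<close>
  have unif: "\<exists>\<delta>>0. \<forall>s\<in>C. \<bar>s - t\<bar> < \<delta> \<longrightarrow> d (h t) (h s) < e" if t: "t \<in> C" and "e > 0" for t e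
  proof -
    obtain \<delta> where \<delta>: "\<delta> > 0" "\<And>x y. x \<in> M \<Longrightarrow> y \<in> M \<Longrightarrow> \<bar>r x - r y\<bar> < \<delta> \<Longrightarrow> d x y < e / 3"
      using uc[of "e/3"] \<open>e > 0\<close> by (meson divide_pos_pos zero_less_numeral)
    have near: "\<exists>x\<in>M. \<bar>r x - s\<bar> < \<delta> / 3 \<and> d x (h s) < e / 3" if s: "s \<in> C" for s
    proof -
      obtain \<delta>' where \<delta>': "\<delta>' > 0" "\<forall>x\<in>M. \<bar>r x - s\<bar> < \<delta>' \<longrightarrow> d x (h s) < e / 3"
        using conjunct2[OF h[OF s], rule_format, of "e/3"] \<open>e > 0\<close> by auto
      have "min \<delta>' (\<delta>/3) > 0" using \<delta>(1) \<delta>'(1) by simp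
      then have "\<exists>y\<in>r ` M. dist y s < min \<delta>' (\<delta>/3)"
        using s[unfolded C_def closure_approachable] by blast
      then obtain x where "x \<in> M" "dist (r x) s < min \<delta>' (\<delta>/3)" by blast
      then show ?thesis using \<delta>'(2) by (intro bexI[of _ x] conjI) (simp_all add: dist_real_def)
    qed
    show ?thesis
    proof (intro exI[of _ "\<delta>/3"] conjI ballI impI)
      fix s assume s: "s \<in> C" "\<bar>s - t\<bar> < \<delta> / 3"
      obtain x where x: "x \<in> M" "\<bar>r x - s\<bar> < \<delta> / 3" "d x (h s) < e / 3" using near[OF s(1)] by blast
      obtain y where y: "y \<in> M" "\<bar>r y - t\<bar> < \<delta> / 3" "d y (h t) < e / 3" using near[OF t] by blast
      have "\<bar>r y - r x\<bar> < \<delta>" using x(2) y(2) s(2) by linarith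
      then have "d y x < e / 3" using x y by (intro \<delta>(2))
      moreover have "d (h t) (h s) \<le> d (h t) y + d y (h s)" using x y hM by (intro triangle) auto
      moreover have "d y (h s) \<le> d y x + d x (h s)" using x y hM by (intro triangle) auto
      ultimately show "d (h t) (h s) < e" using x y by (simp add: commute)
    qed (use \<delta>(1) in auto)
  qed
  have "C \<noteq> {}" using rC[OF x0] by auto
  then show thesis
    by (intro that[OF r _ rC _ hM hr unif]) (auto simp: C_def)
qed

definition weakly_converges :: "(nat \<Rightarrow> 'a measure) \<Rightarrow> 'a measure \<Rightarrow> bool" where
  "weakly_converges P Q \<longleftrightarrow> (\<forall>g. real_continuous g \<longrightarrow>
      (\<lambda>n. integral\<^sup>L (P n) g) \<longlonglongrightarrow> integral\<^sup>L Q g)"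

lemma decoding_continuous:
  assumes g: "real_continuous g" and hM: "\<And>t. h t \<in> M"
    and hc: "\<And>t e. t \<in> C \<Longrightarrow> e > 0 \<Longrightarrow> \<exists>\<delta>>0. \<forall>s\<in>C. \<bar>s - t\<bar> < \<delta> \<longrightarrow> d (h t) (h s) < e"
  shows "continuous_on (C :: real set) (\<lambda>t. g (h t))"
  unfolding continuous_on_iff
proof (intro ballI allI impI)
  fix t :: real and e :: real assume t: "t \<in> C" and e: "e > 0"
  let ?U = "{x \<in> topspace mtopology. g x \<in> ball (g (h t)) e}"
  have "openin mtopology ?U" by (intro openin_continuous_map_preimage[OF g]) auto
  moreover have "h t \<in> ?U" using hM e by auto
  ultimately obtain \<epsilon> where \<epsilon>: "\<epsilon> > 0" "mball (h t) \<epsilon> \<subseteq> ?U" unfolding openin_mtopology by blast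
  obtain \<delta> where \<delta>: "\<delta> > 0" "\<forall>s\<in>C. \<bar>s - t\<bar> < \<delta> \<longrightarrow> d (h t) (h s) < \<epsilon>" using hc[OF t \<epsilon>(1)] by blast
  show "\<exists>\<delta>>0. \<forall>s\<in>C. dist s t < \<delta> \<longrightarrow> dist (g (h s)) (g (h t)) < e"
  proof (intro exI[of _ \<delta>] conjI ballI impI \<delta>(1))
    fix s assume "s \<in> C" "dist s t < \<delta>"
    then have "h s \<in> mball (h t) \<epsilon>" using \<delta> hM by (auto simp: dist_real_def)
    then show "dist (g (h s)) (g (h t)) < e" using \<epsilon> by (auto simp: dist_commute)
  qed
qed

lemma Prob_iff: "P \<in> Prob M d \<longleftrightarrow> prob_space P \<and> sets P = sets (mborel M d)"
  unfolding Prob_def using sets_eq_imp_space_eq[of P "mborel M d"] by auto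

text \<open>The measures are pushed to the line by \<open>r\<close>, where Helly's theorem applies,
  and the limit is pulled back by the decoding. A test function \<open>g\<close> on \<open>M\<close>
  becomes \<open>g\<close> composed with \<open>h\<close>, continuous on \<open>C\<close> only, and
  must be extended to the line to be a legitimate test function there.\<close>

theorem Prob_weakly_compact:
  assumes P: "\<And>n. P n \<in> Prob M d"
  obtains k Q where "strict_mono (k :: nat \<Rightarrow> nat)" "Q \<in> Prob M d" "weakly_converges (P \<circ> k) Q"
proof -
  have Pp: "prob_space (P n)" and Ps[measurable_cong]: "sets (P n) = sets (mborel M d)" for n
    using P[of n] unfolding Prob_iff by auto
  have Psp: "space (P n) = M" for n using sets_eq_imp_space_eq[OF Ps] by simp
  have ne: "M \<noteq> {}" using prob_space.not_empty[OF Pp[of 0]] Psp by simp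
  show thesis
  proof (rule real_decoding[OF ne])
    fix r :: "'a \<Rightarrow> real" and C h
    assume r[measurable]: "r \<in> borel_measurable (mborel M d)" and rb: "\<And>x. 0 \<le> r x" "\<And>x. r x \<le> 2"
      and C: "closed C" "\<And>x. x \<in> M \<Longrightarrow> r x \<in> C" "C \<noteq> {}" and hM: "\<And>t. h t \<in> M" and hr: "\<And>x. x \<in> M \<Longrightarrow> h (r x) = x"
      and hc: "\<And>t e. t \<in> C \<Longrightarrow> e > 0 \<Longrightarrow> \<exists>\<delta>>0. \<forall>s\<in>C. \<bar>s - t\<bar> < \<delta> \<longrightarrow> d (h t) (h s) < e"
    obtain x0 where x0: "x0 \<in> M" using ne by auto
    \<comment> \<open>A constant value off the closed set \<open>C\<close> makes the decoding Borel
      on the whole line.\<close>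
    define h' where "h' t = (if t \<in> C then h t else x0)" for t
    have h'M: "h' t \<in> M" for t using hM x0 by (simp add: h'_def)
    have h'[measurable]: "h' \<in> measurable borel (mborel M d)"
    proof (rule measurable_mborel)
      fix U assume U: "openin mtopology U"
      have "openin (top_of_set C) {t \<in> C. h t \<in> U}"
        unfolding openin_euclidean_subtopology_iff
      proof (intro conjI ballI)
        fix t assume "t \<in> {t \<in> C. h t \<in> U}"
        then have t: "t \<in> C" "h t \<in> U" by auto
        then obtain \<epsilon> where \<epsilon>: "\<epsilon> > 0" "mball (h t) \<epsilon> \<subseteq> U" using U unfolding openin_mtopology by blast
        obtain \<delta> where \<delta>: "\<delta> > 0" "\<forall>s\<in>C. \<bar>s - t\<bar> < \<delta> \<longrightarrow> d (h t) (h s) < \<epsilon>" using hc[OF t(1) \<epsilon>(1)] by blast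
        show "\<exists>e>0. \<forall>x'\<in>C. dist x' t < e \<longrightarrow> x' \<in> {t \<in> C. h t \<in> U}"
          using \<delta> \<epsilon> hM by (intro exI[of _ \<delta>]) (auto simp: dist_real_def)
      qed auto
      then obtain T where T: "open T" "{t \<in> C. h t \<in> U} = C \<inter> T" unfolding openin_open by blast
      have "{t \<in> space borel. h' t \<in> U} = (C \<inter> T) \<union> (if x0 \<in> U then - C else {})"
        unfolding T(2)[symmetric] by (auto simp: h'_def split: if_splits)
      also have "\<dots> \<in> sets borel" using C T by auto
      finally show "{t \<in> space borel. h' t \<in> U} \<in> sets borel" .
    qed (use h'M in auto)
    define R where "R n = distr (P n) borel r" for n
    have rP[measurable]: "r \<in> borel_measurable (P n)" for n by simp
    have R: "real_distribution (R n)" for n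
      unfolding R_def by (rule prob_space.real_distribution_distr[OF Pp rP])
    have "tight R"
      unfolding tight_def
    proof (intro conjI allI impI R)
      fix e :: real assume "0 < e"
      \<comment> \<open>Tightness is phrased with half-open intervals; the left end -1 keeps the
        possible value 0 of \<open>r\<close> inside.\<close>
      have "measure (R n) {-1<..2} = measure (P n) (space (P n))" for n
        unfolding R_def using rb by (subst measure_distr)
          (auto intro!: arg_cong2[where f=measure] simp: less_le_trans[of "-1" 0])
      then have "measure (R n) {-1<..2} > 1 - e" for n
        using prob_space.prob_space[OF Pp] \<open>e > 0\<close> by simp
      then show "\<exists>a b. a < b \<and> (\<forall>n. 1 - e < measure (R n) {a<..b})"
        by (intro exI[of _ "-1"] exI[of _ 2]) auto
    qed
    then obtain k N where k: "strict_mono (k :: nat \<Rightarrow> nat)" and N: "real_distribution N"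
      and conv: "weak_conv_m (R \<circ> id \<circ> k) N"
      using tight_imp_convergent_subsubsequence[of R id] strict_mono_id by blast
    interpret N: real_distribution N by fact
    have conv': "(\<lambda>n. integral\<^sup>L (P (k n)) (\<lambda>x. G (r x))) \<longlonglongrightarrow> integral\<^sup>L N G"
      if "\<And>x. isCont G x" "\<And>x. norm (G x) \<le> b" for G :: "real \<Rightarrow> real" and b
    proof -
      have "continuous_on UNIV G" using that(1) by (simp add: continuous_at_imp_continuous_on)
      then have [measurable]: "G \<in> borel_measurable borel" by (rule borel_measurable_continuous_onI)
      have "(\<lambda>n. integral\<^sup>L ((R \<circ> id \<circ> k) n) G) \<longlonglongrightarrow> integral\<^sup>L N G"
        using conv R N that by (intro weak_conv_imp_integral_bdd_continuous_conv) (auto simp: o_def)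
      moreover have "integral\<^sup>L ((R \<circ> id \<circ> k) n) G = integral\<^sup>L (P (k n)) (\<lambda>x. G (r x))" for n
        unfolding R_def by (simp add: integral_distr)
      ultimately show ?thesis by simp
    qed
    \<comment> \<open>This bounded continuous function vanishes exactly on \<open>C\<close>, hence
      on all codes; its integral against the limit is therefore 0, and the limit has no mass off
      \<open>C\<close>.\<close>
    have "(\<lambda>n. integral\<^sup>L (P (k n)) (\<lambda>x. min 1 (infdist (r x) C))) \<longlonglongrightarrow> (\<integral>t. min 1 (infdist t C) \<partial>N)"
      by (rule conv'[of _ 1]) (auto intro!: continuous_intros simp: infdist_nonneg abs_of_nonneg)
    moreover have "integral\<^sup>L (P (k n)) (\<lambda>x. min 1 (infdist (r x) C)) = 0" for n
      using C by (subst Bochner_Integration.integral_cong[where N="P (k n)" and g="\<lambda>x. 0"]) (auto simp: Psp)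
    ultimately have "(\<lambda>n. 0) \<longlonglongrightarrow> (\<integral>t. min 1 (infdist t C) \<partial>N)" by simp
    then have z: "(\<integral>t. min 1 (infdist t C) \<partial>N) = 0"
      using LIMSEQ_unique[OF _ tendsto_const] by metis
    have bm: "(\<lambda>t. min 1 (infdist t C)) \<in> borel_measurable borel"
      by (intro borel_measurable_continuous_onI continuous_intros)
    have "AE t in N. min 1 (infdist t C) = 0"
      using z bm by (subst (asm) integral_nonneg_eq_0_iff_AE)
        (auto intro!: N.integrable_const_bound[of _ 1] simp: infdist_nonneg abs_of_nonneg)
    then have aeC: "AE t in N. t \<in> C"
    proof eventually_elim
      case (elim t)
      then have "infdist t C = 0" by (simp add: min_def split: if_splits)
      then show ?case using in_closed_iff_infdist_zero[OF C(1,3)] by simp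
    qed
    define Q where "Q = distr N (mborel M d) h'"
    have h'N: "h' \<in> measurable N (mborel M d)" using h' by simp
    have Q: "Q \<in> Prob M d" unfolding Prob_iff Q_def using N.prob_space_distr[OF h'N] by simp
    have "weakly_converges (P \<circ> k) Q"
      unfolding weakly_converges_def
    proof (intro allI impI)
      fix g assume g: "real_continuous g"
      obtain b where b: "0 \<le> b" "\<And>x. x \<in> M \<Longrightarrow> \<bar>g x\<bar> \<le> b" using continuous_bounded[OF g] by blast
      have [measurable]: "g \<in> borel_measurable (mborel M d)" by (rule continuous_borel[OF g])
      have "continuous_on C (\<lambda>t. g (h t))" by (rule decoding_continuous[OF g hM hc])
      \<comment> \<open>Tietze's theorem keeps the bound \<open>b\<close>; the values of
        \<open>G\<close> off \<open>C\<close> are harmless as all measures involved sit on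
        \<open>C\<close>.\<close>
      then obtain G where G: "continuous_on UNIV G" "\<And>t. t \<in> C \<Longrightarrow> G t = g (h t)" "\<And>t. norm (G t) \<le> b"
        using Tietze[of C "\<lambda>t. g (h t)" UNIV b] b hM C(1) by auto
      have [measurable]: "G \<in> borel_measurable borel" using G(1) by (rule borel_measurable_continuous_onI)
      have "(\<lambda>n. integral\<^sup>L (P (k n)) (\<lambda>x. G (r x))) \<longlonglongrightarrow> integral\<^sup>L N G"
        by (rule conv'[of _ b]) (use G in \<open>auto simp: continuous_on_eq_continuous_at\<close>)
      moreover have "integral\<^sup>L (P (k n)) (\<lambda>x. G (r x)) = integral\<^sup>L (P (k n)) g" for n
        using C hr G by (intro Bochner_Integration.integral_cong) (auto simp: Psp)
      moreover have "integral\<^sup>L N G = integral\<^sup>L Q g"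
      proof -
        have "AE t in N. G t = g (h' t)" using aeC by eventually_elim (simp add: G h'_def)
        then have "integral\<^sup>L N G = (\<integral>t. g (h' t) \<partial>N)"
          by (intro integral_cong_AE) auto
        then show ?thesis unfolding Q_def by (simp add: integral_distr[OF h'N])
      qed
      ultimately show "(\<lambda>n. integral\<^sup>L ((P \<circ> k) n) g) \<longlonglongrightarrow> integral\<^sup>L Q g" by simp
    qed
    then show thesis using k Q that by blast
  qed
qed

end

section \<open>Lower semicontinuity of the Wasserstein distance\<close>

lemma ennreal_less_add_pos: "a < \<top> \<Longrightarrow> 0 < c \<Longrightarrow> a < a + ennreal c"
  by (cases a) (auto simp: ennreal_less_iff simp flip: ennreal_plus)

context compact_metric
begin

abbreviation "pdist \<equiv> prod_dist d d"

text \<open>Couplings thereby become probability measures on a compact metric space, to which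
  \<open>Prob_weakly_compact\<close> applies.\<close>

lemma compact_metric_prod: "compact_metric (M \<times> M) pdist"
  and mtopology_prod: "Metric_space.mtopology (M \<times> M) pdist = prod_topology mtopology mtopology"
proof -
  interpret P: Metric_space12 M d M d by unfold_locales
  show eq: "Metric_space.mtopology (M \<times> M) pdist = prod_topology mtopology mtopology"
    by (rule P.mtopology_prod_metric)
  have "compact_space (prod_topology mtopology mtopology)"
    using compact by (simp add: compact_space_prod_topology)
  then show "compact_metric (M \<times> M) pdist"
    by (intro compact_metric.intro compact_metric_axioms.intro P.Prod_metric.Metric_space_axioms)
      (simp add: eq)
qed

text \<open>Reconciles the product sigma-algebra in \<open>couplings\<close> with the Borel sets
  needed for weak compactness. One inclusion holds because countably many balls make up an open set
  and each ball is measurable, the other because the projections are continuous.\<close>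

lemma sets_mborel_prod: "sets (mborel (M \<times> M) pdist) = sets (mborel M d \<Otimes>\<^sub>M mborel M d)"
proof -
  interpret P: compact_metric "M \<times> M" pdist by (rule compact_metric_prod)
  show ?thesis
  proof (rule antisym)
    have pd: "pdist a q = sqrt ((d (fst a) (fst q))\<^sup>2 + (d (snd a) (snd q))\<^sup>2)" for a q
      by (simp add: prod_dist_def case_prod_unfold)
    have "P.mball a r \<in> sets (mborel M d \<Otimes>\<^sub>M mborel M d)" if "a \<in> M \<times> M" for a r
    proof -
      have m[measurable]: "(\<lambda>x. d (fst a) x) \<in> borel_measurable (mborel M d)"
        "(\<lambda>x. d (snd a) x) \<in> borel_measurable (mborel M d)"
        using that continuous_borel[OF continuous_dist] by (auto simp: commute)
      have "P.mball a r = {q \<in> space (mborel M d \<Otimes>\<^sub>M mborel M d).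
          sqrt ((d (fst a) (fst q))\<^sup>2 + (d (snd a) (snd q))\<^sup>2) < r}"
        unfolding set_eq_iff P.in_mball mem_Collect_eq pd space_pair_measure space_mborel using that by blast
      also have "\<dots> \<in> sets (mborel M d \<Otimes>\<^sub>M mborel M d)" by measurable
      finally show ?thesis .
    qed
    then have "sigma_sets (M \<times> M) {P.mball a r |a r. a \<in> M \<times> M} \<subseteq> sets (mborel M d \<Otimes>\<^sub>M mborel M d)"
      using sets.sigma_sets_subset[of "{P.mball a r |a r. a \<in> M \<times> M}" "mborel M d \<Otimes>\<^sub>M mborel M d"]
      by (auto simp: space_pair_measure)
    then show "sets (mborel (M \<times> M) pdist) \<subseteq> sets (mborel M d \<Otimes>\<^sub>M mborel M d)"
      unfolding P.sets_mborel_mball .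
  next
    have fs: "fst \<in> measurable (mborel (M \<times> M) pdist) (mborel M d)"
    proof (rule measurable_mborel)
      fix U assume U: "openin mtopology U"
      have "openin P.mtopology {x \<in> M \<times> M. fst x \<in> U}"
        using openin_continuous_map_preimage[OF continuous_map_fst U, of mtopology]
        by (simp add: mtopology_prod)
      then show "{x \<in> space (mborel (M \<times> M) pdist). fst x \<in> U} \<in> sets (mborel (M \<times> M) pdist)"
        using P.openin_sets by simp
    qed auto
    have sn: "snd \<in> measurable (mborel (M \<times> M) pdist) (mborel M d)"
    proof (rule measurable_mborel)
      fix U assume U: "openin mtopology U"
      have "openin P.mtopology {x \<in> M \<times> M. snd x \<in> U}"
        using openin_continuous_map_preimage[OF continuous_map_snd U, of mtopology]
        by (simp add: mtopology_prod)
      then show "{x \<in> space (mborel (M \<times> M) pdist). snd x \<in> U} \<in> sets (mborel (M \<times> M) pdist)"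
        using P.openin_sets by simp
    qed auto
    have id: "(\<lambda>x. x) \<in> measurable (mborel (M \<times> M) pdist) (mborel M d \<Otimes>\<^sub>M mborel M d)"
      using measurable_Pair[OF fs sn] by simp
    show "sets (mborel M d \<Otimes>\<^sub>M mborel M d) \<subseteq> sets (mborel (M \<times> M) pdist)"
    proof
      fix A assume A: "A \<in> sets (mborel M d \<Otimes>\<^sub>M mborel M d)"
      then have "(\<lambda>x. x) -` A \<inter> space (mborel (M \<times> M) pdist) \<in> sets (mborel (M \<times> M) pdist)"
        by (rule measurable_sets[OF id])
      moreover have "A \<subseteq> M \<times> M" using sets.sets_into_space[OF A] by (simp add: space_pair_measure)
      ultimately show "A \<in> sets (mborel (M \<times> M) pdist)" by (simp add: Int_absorb2)
    qed
  qed
qed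

lemma continuous_pair_dist:
  "continuous_map (prod_topology mtopology mtopology) euclideanreal (\<lambda>p. d (fst p) (snd p))"
proof -
  have "continuous_map (prod_topology mtopology mtopology) euclideanreal
      (\<lambda>p. mdist (metric (M,d)) (fst p) (snd p))"
    by (intro continuous_map_mdist) (auto simp: mtopology_of continuous_map_fst continuous_map_snd)
  then show ?thesis by simp
qed

lemma dist_borel[measurable]: "(\<lambda>p. d (fst p) (snd p)) \<in> borel_measurable (mborel M d \<Otimes>\<^sub>M mborel M d)"
proof -
  interpret P: compact_metric "M \<times> M" pdist by (rule compact_metric_prod)
  have "(\<lambda>p. d (fst p) (snd p)) \<in> borel_measurable (mborel (M \<times> M) pdist)"
    by (rule P.continuous_borel) (simp add: mtopology_prod continuous_pair_dist)
  then show ?thesis by (simp cong: measurable_cong_sets add: sets_mborel_prod)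
qed

lemma weakly_converges_subseq:
  "weakly_converges P Q \<Longrightarrow> strict_mono k \<Longrightarrow> weakly_converges (P \<circ> k) Q"
  unfolding weakly_converges_def
proof (intro allI impI)
  fix g assume "\<forall>g. real_continuous g \<longrightarrow> (\<lambda>n. integral\<^sup>L (P n) g) \<longlonglongrightarrow> integral\<^sup>L Q g"
    and k: "strict_mono k" and "real_continuous g"
  then have "(\<lambda>n. integral\<^sup>L (P n) g) \<longlonglongrightarrow> integral\<^sup>L Q g" by blast
  from LIMSEQ_subseq_LIMSEQ[OF this k] show "(\<lambda>n. integral\<^sup>L ((P \<circ> k) n) g) \<longlonglongrightarrow> integral\<^sup>L Q g"
    by (simp add: o_def)
qed

lemma integral_distr_fst_snd:
  assumes "sets \<pi> = sets (mborel M d \<Otimes>\<^sub>M mborel M d)" "real_continuous h"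
  shows "integral\<^sup>L (distr \<pi> (mborel M d) fst) h = (\<integral>p. h (fst p) \<partial>\<pi>)"
    and "integral\<^sup>L (distr \<pi> (mborel M d) snd) h = (\<integral>p. h (snd p) \<partial>\<pi>)"
  using continuous_borel[OF assms(2)] measurable_cong_sets[OF assms(1) refl]
  by (auto intro!: integral_distr)

text \<open>Almost optimal couplings have a weak limit point. Its marginals are the limits of the
  marginals, and its cost is the limit of the costs because the squared distance is continuous and
  bounded on the compact product.\<close>

lemma W2sq_lsc:
  assumes \<mu>: "\<mu> \<in> Prob M d" and \<nu>: "\<nu> \<in> Prob M d" and \<nu>s: "\<And>n. \<nu>s n \<in> Prob M d"
    and conv: "weakly_converges \<nu>s \<nu>"
  shows "W2sq M d \<mu> \<nu> \<le> liminf (\<lambda>n. W2sq M d \<mu> (\<nu>s n))"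
proof (cases "liminf (\<lambda>n. W2sq M d \<mu> (\<nu>s n)) = \<top>")
  case False
  interpret P: compact_metric "M \<times> M" pdist by (rule compact_metric_prod)
  define L where "L = liminf (\<lambda>n. W2sq M d \<mu> (\<nu>s n))"
  obtain r0 where r0: "strict_mono r0" "((\<lambda>n. W2sq M d \<mu> (\<nu>s n)) \<circ> r0) \<longlonglongrightarrow> L"
    using liminf_subseq_lim unfolding L_def by blast
  have "L < \<top>" using False by (simp add: L_def less_top)
  then have "\<forall>\<^sub>F n in sequentially. W2sq M d \<mu> (\<nu>s (r0 n)) < \<top>"
    using order_tendstoD(2)[OF r0(2)] by simp
  then obtain N where N: "\<And>n. n \<ge> N \<Longrightarrow> W2sq M d \<mu> (\<nu>s (r0 n)) < \<top>"
    by (auto simp: eventually_sequentially)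
  \<comment> \<open>The first \<open>N\<close> terms are dropped so that all distances are finite;
    otherwise no coupling could be strictly below distance plus a positive excess.\<close>
  define r where "r n = r0 (n + N)" for n
  have r: "strict_mono r" using r0(1) by (auto simp: r_def strict_mono_def)
  have rL: "(\<lambda>n. W2sq M d \<mu> (\<nu>s (r n))) \<longlonglongrightarrow> L"
    using LIMSEQ_ignore_initial_segment[OF r0(2), of N] by (simp add: r_def o_def)
  let ?cost = "\<lambda>\<pi>. \<integral>\<^sup>+ p. ennreal ((d (fst p) (snd p))\<^sup>2) \<partial>\<pi>"
  have "\<exists>\<pi>. \<pi> \<in> couplings M d \<mu> (\<nu>s (r n)) \<and> ?cost \<pi> < W2sq M d \<mu> (\<nu>s (r n)) + ennreal (1 / real (Suc n))" for n
  proof -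
    have "W2sq M d \<mu> (\<nu>s (r n)) < W2sq M d \<mu> (\<nu>s (r n)) + ennreal (1 / real (Suc n))"
      using N[of "n + N"] by (intro ennreal_less_add_pos) (auto simp: r_def)
    then have "(INF \<pi> \<in> couplings M d \<mu> (\<nu>s (r n)). ?cost \<pi>) < W2sq M d \<mu> (\<nu>s (r n)) + ennreal (1 / real (Suc n))"
      by (subst (asm) (1) W2sq_def)
    then show ?thesis unfolding INF_less_iff by blast
  qed
  then have "\<forall>n. \<exists>\<pi>. \<pi> \<in> couplings M d \<mu> (\<nu>s (r n)) \<and> ?cost \<pi> < W2sq M d \<mu> (\<nu>s (r n)) + ennreal (1 / real (Suc n))"
    by (rule allI)
  from choice[OF this] obtain \<pi> where "\<forall>n. \<pi> n \<in> couplings M d \<mu> (\<nu>s (r n)) \<and>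
      ?cost (\<pi> n) < W2sq M d \<mu> (\<nu>s (r n)) + ennreal (1 / real (Suc n))" ..
  then have \<pi>: "\<And>n. \<pi> n \<in> couplings M d \<mu> (\<nu>s (r n))"
    and cost: "\<And>n. ?cost (\<pi> n) < W2sq M d \<mu> (\<nu>s (r n)) + ennreal (1 / real (Suc n))" by simp_all
  have s\<pi>: "sets (\<pi> n) = sets (mborel M d \<Otimes>\<^sub>M mborel M d)" and p\<pi>: "prob_space (\<pi> n)" for n
    using \<pi>[of n] unfolding couplings_def by blast+
  have \<pi>P: "\<pi> n \<in> Prob (M \<times> M) pdist" for n
    unfolding P.Prob_iff sets_mborel_prod using s\<pi> p\<pi> by blast
  obtain k Q where k: "strict_mono (k :: nat \<Rightarrow> nat)" and Q: "Q \<in> Prob (M \<times> M) pdist"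
    and wc: "P.weakly_converges (\<pi> \<circ> k) Q"
    by (rule P.Prob_weakly_compact[OF \<pi>P])
  have sQ: "sets Q = sets (mborel M d \<Otimes>\<^sub>M mborel M d)" and pQ: "prob_space Q"
    using Q unfolding P.Prob_iff sets_mborel_prod by blast+
  interpret Q: prob_space Q by fact
  have mf: "fst \<in> measurable Q (mborel M d)" "snd \<in> measurable Q (mborel M d)"
    unfolding measurable_cong_sets[OF sQ refl] by (rule measurable_fst measurable_snd)+
  have dp: "finite_measure (distr Q (mborel M d) fst)" "finite_measure (distr Q (mborel M d) snd)"
    using Q.prob_space_distr[OF mf(1)] Q.prob_space_distr[OF mf(2)] by (auto simp: prob_space_def)
  have \<nu>k: "weakly_converges (\<nu>s \<circ> (r \<circ> k)) \<nu>"
    by (rule weakly_converges_subseq[OF conv strict_mono_o[OF r k]])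
  have wc': "(\<lambda>n. \<integral>p. h p \<partial>\<pi> (k n)) \<longlonglongrightarrow> (\<integral>p. h p \<partial>Q)"
    if "continuous_map (prod_topology mtopology mtopology) euclideanreal h" for h
    using wc that unfolding P.weakly_converges_def mtopology_prod by (simp add: o_def)
  \<comment> \<open>All couplings share the first marginal \<open>\<mu>\<close>, so integrals of
    functions of the first coordinate are constant along the sequence.\<close>
  have "distr Q (mborel M d) fst = \<mu>"
  proof (rule measure_eqI_continuous[OF dp(1)])
    fix h assume h: "real_continuous h"
    have "(\<lambda>n. \<integral>p. h (fst p) \<partial>\<pi> (k n)) \<longlonglongrightarrow> (\<integral>p. h (fst p) \<partial>Q)"
      by (rule wc') (use continuous_map_compose[OF continuous_map_fst h] in \<open>simp add: o_def\<close>)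
    moreover have "(\<integral>p. h (fst p) \<partial>\<pi> (k n)) = integral\<^sup>L \<mu> h" for n
      using \<pi>[of "k n"] integral_distr_fst_snd(1)[OF s\<pi> h, of "k n"] unfolding couplings_def by auto
    ultimately have "(\<integral>p. h (fst p) \<partial>Q) = integral\<^sup>L \<mu> h" by (simp add: LIMSEQ_const_iff)
    then show "integral\<^sup>L (distr Q (mborel M d) fst) h = integral\<^sup>L \<mu> h"
      by (simp add: integral_distr_fst_snd(1)[OF sQ h])
  qed (use \<mu> in \<open>auto simp: Prob_iff prob_space_def\<close>)
  moreover have "distr Q (mborel M d) snd = \<nu>"
  proof (rule measure_eqI_continuous[OF dp(2)])
    fix h assume h: "real_continuous h"
    have "(\<lambda>n. \<integral>p. h (snd p) \<partial>\<pi> (k n)) \<longlonglongrightarrow> (\<integral>p. h (snd p) \<partial>Q)"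
      by (rule wc') (use continuous_map_compose[OF continuous_map_snd h] in \<open>simp add: o_def\<close>)
    moreover have "(\<integral>p. h (snd p) \<partial>\<pi> (k n)) = integral\<^sup>L (\<nu>s (r (k n))) h" for n
      using \<pi>[of "k n"] integral_distr_fst_snd(2)[OF s\<pi> h, of "k n"] unfolding couplings_def by auto
    moreover have "(\<lambda>n. integral\<^sup>L (\<nu>s (r (k n))) h) \<longlonglongrightarrow> integral\<^sup>L \<nu> h"
      using \<nu>k h unfolding weakly_converges_def by (simp add: o_def)
    ultimately have "(\<integral>p. h (snd p) \<partial>Q) = integral\<^sup>L \<nu> h" by (simp add: LIMSEQ_unique)
    then show "integral\<^sup>L (distr Q (mborel M d) snd) h = integral\<^sup>L \<nu> h"
      by (simp add: integral_distr_fst_snd(2)[OF sQ h])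
  qed (use \<nu> in \<open>auto simp: Prob_iff prob_space_def\<close>)
  ultimately have "Q \<in> couplings M d \<mu> \<nu>"
    using sQ pQ sets_eq_imp_space_eq[OF sQ] unfolding couplings_def by (simp add: space_pair_measure)
  then have "W2sq M d \<mu> \<nu> \<le> ?cost Q"
    unfolding W2sq_def by (rule INF_lower)
  also have "?cost Q \<le> L"
  proof (rule LIMSEQ_le)
    have cc: "continuous_map (prod_topology mtopology mtopology) euclideanreal (\<lambda>p. (d (fst p) (snd p))\<^sup>2)"
      unfolding power2_eq_square by (intro continuous_map_real_mult continuous_pair_dist)
    have nn: "?cost R = ennreal (\<integral>p. (d (fst p) (snd p))\<^sup>2 \<partial>R)" if "prob_space R" "sets R = sets (mborel M d \<Otimes>\<^sub>M mborel M d)" for R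
    proof (rule nn_integral_eq_integral)
      show "integrable R (\<lambda>p. (d (fst p) (snd p))\<^sup>2)"
        using that cc by (intro P.integrable_continuous) (auto simp: prob_space_def sets_mborel_prod mtopology_prod)
    qed simp
    show "(\<lambda>n. ?cost (\<pi> (k n))) \<longlonglongrightarrow> ?cost Q"
      using wc'[OF cc] by (simp add: nn pQ sQ p\<pi> s\<pi>)
    have "(\<lambda>n. ennreal (1 / real (Suc n))) \<longlonglongrightarrow> ennreal 0"
      using LIMSEQ_Suc[OF lim_1_over_n] by (intro tendsto_ennrealI) simp
    then have "(\<lambda>n. W2sq M d \<mu> (\<nu>s (r n)) + ennreal (1 / real (Suc n))) \<longlonglongrightarrow> L + ennreal 0"
      by (intro tendsto_add rL)
    from LIMSEQ_subseq_LIMSEQ[OF this k]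
    show "(\<lambda>n. W2sq M d \<mu> (\<nu>s (r (k n))) + ennreal (1 / real (Suc (k n)))) \<longlonglongrightarrow> L" by (simp add: o_def)
    show "\<exists>N. \<forall>n\<ge>N. ?cost (\<pi> (k n)) \<le> W2sq M d \<mu> (\<nu>s (r (k n))) + ennreal (1 / real (Suc (k n)))"
      using cost by (auto intro: less_imp_le)
  qed
  finally show ?thesis unfolding L_def .
qed simp

lemma barycenter_limit:
  assumes fin: "finite I" and mus: "\<And>j. j \<in> I \<Longrightarrow> mus j \<in> Prob M d"
    and \<nu>: "\<nu> \<in> Prob M d" and \<nu>s: "\<And>n. \<nu>s n \<in> Prob M d" and conv: "weakly_converges \<nu>s \<nu>"
    and opt: "\<And>n. (\<Sum>j\<in>I. ennreal (lam j) * W2sq M d (mus j) (\<nu>s n)) \<le> Var M d I lam mus + e n"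
    and e: "e \<longlonglongrightarrow> (0 :: ennreal)"
  shows "is_barycenter M d I lam mus \<nu>"
proof -
  \<comment> \<open>Writing the weighted sum as an integral makes superadditivity of
    \<open>liminf\<close> an instance of Fatou's lemma.\<close>
  let ?P = "point_measure I (\<lambda>j. ennreal (lam j))"
  have pm: "(\<Sum>j\<in>I. ennreal (lam j) * f j) = (\<integral>\<^sup>+j. f j \<partial>?P)" for f
    using fin by (subst nn_integral_point_measure_finite) auto
  have "(\<Sum>j\<in>I. ennreal (lam j) * W2sq M d (mus j) \<nu>)
      \<le> (\<Sum>j\<in>I. ennreal (lam j) * liminf (\<lambda>n. W2sq M d (mus j) (\<nu>s n)))"
    by (intro sum_mono mult_left_mono W2sq_lsc[OF mus \<nu> \<nu>s conv]) auto
  also have "\<dots> = (\<integral>\<^sup>+j. liminf (\<lambda>n. W2sq M d (mus j) (\<nu>s n)) \<partial>?P)" by (rule pm)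
  also have "\<dots> \<le> liminf (\<lambda>n. \<integral>\<^sup>+j. W2sq M d (mus j) (\<nu>s n) \<partial>?P)"
    by (rule nn_integral_liminf) auto
  also have "\<dots> \<le> liminf (\<lambda>n. Var M d I lam mus + e n)"
    using opt by (intro Liminf_mono always_eventually) (simp add: pm)
  also have "\<dots> = Var M d I lam mus"
    using tendsto_add[OF tendsto_const e, of "Var M d I lam mus"] by (intro lim_imp_Liminf) auto
  finally have "(\<Sum>j\<in>I. ennreal (lam j) * W2sq M d (mus j) \<nu>) \<le> Var M d I lam mus" .
  moreover have "Var M d I lam mus \<le> (\<Sum>j\<in>I. ennreal (lam j) * W2sq M d (mus j) \<nu>)"
    unfolding Var_def using \<nu> by (rule INF_lower)
  ultimately show ?thesis unfolding is_barycenter_def using \<nu> by auto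
qed

text \<open>The direct method: a minimizing sequence has a weak limit point. This serves the case in
  which the entropy bound is vacuous and the approximating spaces are not consulted.\<close>

lemma barycenter_exists:
  assumes fin: "finite I" and mus: "\<And>j. j \<in> I \<Longrightarrow> mus j \<in> Prob M d" and fV: "Var M d I lam mus < \<top>"
  obtains \<nu> where "is_barycenter M d I lam mus \<nu>"
proof -
  let ?c = "\<lambda>\<nu>. \<Sum>j\<in>I. ennreal (lam j) * W2sq M d (mus j) \<nu>"
  have "\<exists>\<nu>\<in>Prob M d. ?c \<nu> < Var M d I lam mus + ennreal (1 / real (Suc n))" for n
  proof -
    have "Var M d I lam mus < Var M d I lam mus + ennreal (1 / real (Suc n))"
      using fV by (intro ennreal_less_add_pos) auto
    then have "(INF \<nu> \<in> Prob M d. ?c \<nu>) < Var M d I lam mus + ennreal (1 / real (Suc n))"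
      by (subst (asm) (1) Var_def)
    then show ?thesis unfolding INF_less_iff .
  qed
  then have "\<forall>n. \<exists>\<nu>. \<nu> \<in> Prob M d \<and> ?c \<nu> < Var M d I lam mus + ennreal (1 / real (Suc n))"
    unfolding Bex_def by (rule allI)
  from choice[OF this] obtain \<nu>s
    where "\<forall>n. \<nu>s n \<in> Prob M d \<and> ?c (\<nu>s n) < Var M d I lam mus + ennreal (1 / real (Suc n))" ..
  then have \<nu>s: "\<And>n. \<nu>s n \<in> Prob M d"
    "\<And>n. ?c (\<nu>s n) < Var M d I lam mus + ennreal (1 / real (Suc n))" by simp_all
  obtain k \<nu> where k: "strict_mono (k :: nat \<Rightarrow> nat)" "\<nu> \<in> Prob M d" "weakly_converges (\<nu>s \<circ> k) \<nu>"
    by (rule Prob_weakly_compact[OF \<nu>s(1)])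
  have "(\<lambda>n. ennreal (1 / real (Suc n))) \<longlonglongrightarrow> ennreal 0"
    using LIMSEQ_Suc[OF lim_1_over_n] by (intro tendsto_ennrealI) simp
  from LIMSEQ_subseq_LIMSEQ[OF this k(1)]
  have "(\<lambda>n. ennreal (1 / real (Suc (k n)))) \<longlonglongrightarrow> 0" by (simp add: o_def)
  then have "is_barycenter M d I lam mus \<nu>"
    using \<nu>s by (intro barycenter_limit[OF fin mus k(2) _ k(3)]) (auto intro: less_imp_le)
  then show thesis by (rule that)
qed

end

section \<open>Transporting couplings between spaces\<close>

context
  fixes Y :: "'a set" and dY :: "'a \<Rightarrow> 'a \<Rightarrow> real" and Z :: "'b set" and dZ :: "'b \<Rightarrow> 'b \<Rightarrow> real"
    and A :: "'k set" and u :: "'k \<Rightarrow> 'a \<Rightarrow> real" and \<tau> :: "'k \<Rightarrow> 'b measure" and T :: "'a \<Rightarrow> 'b"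
    and \<mu> :: "'a measure" and \<mu>' :: "'b measure" and e :: real
  assumes cY: "compact_metric Y dY" and cZ: "compact_metric Z dZ"
    and A: "finite A"
    and u[measurable]: "\<And>k. u k \<in> borel_measurable (mborel Y dY)"
    and u0: "\<And>k y. k \<in> A \<Longrightarrow> y \<in> Y \<Longrightarrow> 0 \<le> u k y" and u1: "\<And>y. y \<in> Y \<Longrightarrow> (\<Sum>k\<in>A. u k y) = 1"
    and \<tau>: "\<And>k. k \<in> A \<Longrightarrow> \<tau> k \<in> Prob Z dZ"
    and T[measurable]: "T \<in> measurable (mborel Y dY) (mborel Z dZ)"
    and \<mu>': "\<mu>' \<in> Prob Z dZ"
    and mix: "\<And>B. B \<in> sets (mborel Z dZ) \<Longrightarrow> emeasure \<mu>' B = (\<Sum>k\<in>A. (\<integral>\<^sup>+y. u k y \<partial>\<mu>) * emeasure (\<tau> k) B)"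
    and near: "\<And>k y w. k \<in> A \<Longrightarrow> y \<in> Y \<Longrightarrow> w \<in> Y \<Longrightarrow> 0 < u k y \<Longrightarrow> AE z in \<tau> k. dZ z (T w) \<le> dY y w + e"
begin

text \<open>Randomized transport: given a pair \<open>(y, w)\<close> with law \<open>\<pi>\<close>,
  choose a label \<open>k\<close> with probability \<open>u k y\<close>, draw \<open>z\<close> from
  \<open>\<tau> k\<close> and output \<open>(z, T w)\<close>. By \<open>mix\<close> the first
  coordinate has law \<open>\<mu>'\<close>, and by \<open>near\<close> the distance grows by at most
  \<open>e\<close>. The hypotheses are symmetric enough to serve both directions between X and X_i,
  with different labels.\<close>

lemma W2sq_transport_coupling:
  assumes \<pi>: "\<pi> \<in> couplings Y dY \<mu> \<nu>"
  shows "W2sq Z dZ \<mu>' (distr \<nu> (mborel Z dZ) T) \<le> (\<integral>\<^sup>+p. ennreal ((dY (fst p) (snd p) + e)\<^sup>2) \<partial>\<pi>)"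
proof -
  interpret Y: compact_metric Y dY by fact
  interpret Z: compact_metric Z dZ by fact
  let ?BY = "mborel Y dY" and ?BZ = "mborel Z dZ"
  define N where "N = ?BZ \<Otimes>\<^sub>M ?BZ"
  have \<pi>s[measurable_cong]: "sets \<pi> = sets (?BY \<Otimes>\<^sub>M ?BY)" and \<pi>p: "prob_space \<pi>"
    and \<pi>f: "distr \<pi> ?BY fst = \<mu>" and \<pi>n: "distr \<pi> ?BY snd = \<nu>" and \<pi>sp: "space \<pi> = Y \<times> Y"
    using \<pi> unfolding couplings_def by blast+
  interpret \<pi>: prob_space \<pi> by fact
  have \<tau>s[measurable_cong]: "sets (\<tau> k) = sets ?BZ" and \<tau>p: "prob_space (\<tau> k)" if "k \<in> A" for k
    using \<tau>[OF that] unfolding Z.Prob_iff by blast+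
  have ule: "u k y \<le> 1" if "k \<in> A" "y \<in> Y" for k y
    using member_le_sum[of k A "\<lambda>k. u k y"] that u0 u1 A by simp
  have u1': "(\<Sum>k\<in>A. ennreal (u k (fst p))) = 1" if "p \<in> space \<pi>" for p
    using that u0 u1[of "fst p"] by (subst sum_ennreal) (auto simp: \<pi>sp)
  \<comment> \<open>The part of \<open>\<pi>\<close> that carries the label \<open>k\<close>. Below,
    a fresh \<open>z\<close> is drawn independently of it, and \<open>G\<close> forgets
    \<open>y\<close>.\<close>
  define D where "D k = density \<pi> (\<lambda>p. ennreal (u k (fst p)))" for k
  have Ds[measurable_cong]: "sets (D k) = sets (?BY \<Otimes>\<^sub>M ?BY)" for k
    unfolding D_def by (simp add: \<pi>s)
  have finD: "finite_measure (D k)" if "k \<in> A" for k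
  proof
    have "emeasure (D k) (space (D k)) = (\<integral>\<^sup>+p. ennreal (u k (fst p)) \<partial>\<pi>)"
      unfolding D_def by (subst emeasure_density) (auto intro!: nn_integral_cong)
    also have "\<dots> \<le> (\<integral>\<^sup>+p. 1 \<partial>\<pi>)"
      using ule[OF that] by (intro nn_integral_mono) (auto simp: \<pi>sp)
    also have "\<dots> = 1" by (simp add: \<pi>.emeasure_space_1)
    finally show "emeasure (D k) (space (D k)) \<noteq> \<infinity>" by (auto simp: top_unique)
  qed
  define G where "G = (\<lambda>q :: 'b \<times> 'a \<times> 'a. (fst q, T (snd (snd q))))"
  have Gm[measurable]: "G \<in> measurable (\<tau> k \<Otimes>\<^sub>M D k) N" if "k \<in> A" for k
  proof -
    note [measurable_cong] = \<tau>s[OF that]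
    show ?thesis unfolding G_def N_def by measurable
  qed
  define P where "P k = distr (\<tau> k \<Otimes>\<^sub>M D k) N G" for k
  define \<pi>' where "\<pi>' = msum A N P"
  have Ps: "sets (P k) = sets N" for k unfolding P_def by simp
  have nnP: "(\<integral>\<^sup>+q. f q \<partial>P k) = (\<integral>\<^sup>+p. ennreal (u k (fst p)) * (\<integral>\<^sup>+z. f (z, T (snd p)) \<partial>\<tau> k) \<partial>\<pi>)"
    if f[measurable]: "f \<in> borel_measurable N" and k: "k \<in> A" for f k
  proof -
    interpret \<tau>: prob_space "\<tau> k" by (rule \<tau>p[OF k])
    interpret D: finite_measure "D k" by (rule finD[OF k])
    interpret pair_sigma_finite "\<tau> k" "D k" ..
    note [measurable] = Gm[OF k] and [measurable_cong] = \<tau>s[OF k]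
    have fG: "(\<lambda>q. f (G q)) \<in> borel_measurable (\<tau> k \<Otimes>\<^sub>M D k)" by measurable
    have "(\<integral>\<^sup>+q. f q \<partial>P k) = (\<integral>\<^sup>+q. f (G q) \<partial>(\<tau> k \<Otimes>\<^sub>M D k))"
      unfolding P_def by (rule nn_integral_distr) auto
    also have "\<dots> = (\<integral>\<^sup>+p. (\<integral>\<^sup>+z. f (G (z, p)) \<partial>\<tau> k) \<partial>D k)"
      using nn_integral_snd[OF fG] by simp
    also have "\<dots> = (\<integral>\<^sup>+p. (\<integral>\<^sup>+z. f (z, T (snd p)) \<partial>\<tau> k) \<partial>D k)"
      by (simp add: G_def)
    also have "\<dots> = (\<integral>\<^sup>+p. ennreal (u k (fst p)) * (\<integral>\<^sup>+z. f (z, T (snd p)) \<partial>\<tau> k) \<partial>\<pi>)"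
      unfolding D_def
    proof (rule nn_integral_density)
      have [measurable]: "f \<in> borel_measurable (?BZ \<Otimes>\<^sub>M ?BZ)" using f unfolding N_def .
      show "(\<lambda>p. \<integral>\<^sup>+z. f (z, T (snd p)) \<partial>\<tau> k) \<in> borel_measurable \<pi>" by measurable
    qed measurable
    finally show ?thesis .
  qed
  have nn\<pi>: "(\<integral>\<^sup>+q. f q \<partial>\<pi>') = (\<Sum>k\<in>A. \<integral>\<^sup>+p. ennreal (u k (fst p)) * (\<integral>\<^sup>+z. f (z, T (snd p)) \<partial>\<tau> k) \<partial>\<pi>)"
    if "f \<in> borel_measurable N" for f
    unfolding \<pi>'_def using nnP[OF that] by (simp add: nn_integral_msum[OF Ps that])
  have \<pi>'s: "sets \<pi>' = sets N" unfolding \<pi>'_def by simp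
  have collapse: "(\<Sum>k\<in>A. \<integral>\<^sup>+p. ennreal (u k (fst p)) * F p \<partial>\<pi>) = (\<integral>\<^sup>+p. F p \<partial>\<pi>)"
    if [measurable]: "F \<in> borel_measurable \<pi>" for F
  proof -
    have "(\<Sum>k\<in>A. \<integral>\<^sup>+p. ennreal (u k (fst p)) * F p \<partial>\<pi>) = (\<integral>\<^sup>+p. (\<Sum>k\<in>A. ennreal (u k (fst p)) * F p) \<partial>\<pi>)"
      by (rule nn_integral_sum[symmetric]) measurable
    also have "\<dots> = (\<integral>\<^sup>+p. F p \<partial>\<pi>)"
      by (intro nn_integral_cong) (simp add: u1' flip: sum_distrib_right)
    finally show ?thesis .
  qed
  have fstN: "fst \<in> measurable N ?BZ" and sndN: "snd \<in> measurable N ?BZ" unfolding N_def by auto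
  have fst': "fst \<in> measurable \<pi>' ?BZ" and snd': "snd \<in> measurable \<pi>' ?BZ"
    unfolding measurable_cong_sets[OF \<pi>'s refl] by (rule fstN sndN)+
  have marg1: "distr \<pi>' ?BZ fst = \<mu>'"
  proof (rule measure_eqI)
    show "sets (distr \<pi>' ?BZ fst) = sets \<mu>'" using \<mu>' unfolding Z.Prob_iff by simp
    fix B assume "B \<in> sets (distr \<pi>' ?BZ fst)"
    then have B[measurable]: "B \<in> sets ?BZ" by simp
    have "emeasure (distr \<pi>' ?BZ fst) B = (\<integral>\<^sup>+x. indicator B x \<partial>distr \<pi>' ?BZ fst)" by simp
    also have "\<dots> = (\<integral>\<^sup>+q. indicator B (fst q) \<partial>\<pi>')"
      by (rule nn_integral_distr[OF fst']) simp
    also have "\<dots> = (\<Sum>k\<in>A. \<integral>\<^sup>+p. ennreal (u k (fst p)) * (\<integral>\<^sup>+z. indicator B z \<partial>\<tau> k) \<partial>\<pi>)"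
      by (subst nn\<pi>) (use fstN in auto)
    also have "\<dots> = (\<Sum>k\<in>A. (\<integral>\<^sup>+y. u k y \<partial>\<mu>) * emeasure (\<tau> k) B)"
    proof (rule sum.cong[OF refl])
      fix k assume k: "k \<in> A"
      have "(\<integral>\<^sup>+p. ennreal (u k (fst p)) * (\<integral>\<^sup>+z. indicator B z \<partial>\<tau> k) \<partial>\<pi>) = (\<integral>\<^sup>+p. ennreal (u k (fst p)) * emeasure (\<tau> k) B \<partial>\<pi>)"
        using B \<tau>s[OF k] by simp
      also have "\<dots> = (\<integral>\<^sup>+p. ennreal (u k (fst p)) \<partial>\<pi>) * emeasure (\<tau> k) B"
        by (rule nn_integral_multc) measurable
      also have "(\<integral>\<^sup>+p. ennreal (u k (fst p)) \<partial>\<pi>) = (\<integral>\<^sup>+y. u k y \<partial>\<mu>)"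
        unfolding \<pi>f[symmetric] by (rule nn_integral_distr[symmetric]) measurable
      finally show "(\<integral>\<^sup>+p. ennreal (u k (fst p)) * (\<integral>\<^sup>+z. indicator B z \<partial>\<tau> k) \<partial>\<pi>) = (\<integral>\<^sup>+y. u k y \<partial>\<mu>) * emeasure (\<tau> k) B" .
    qed
    also have "\<dots> = emeasure \<mu>' B" by (rule mix[OF B, symmetric])
    finally show "emeasure (distr \<pi>' ?BZ fst) B = emeasure \<mu>' B" .
  qed
  have marg2: "distr \<pi>' ?BZ snd = distr \<nu> ?BZ T"
  proof (rule measure_eqI)
    fix B assume "B \<in> sets (distr \<pi>' ?BZ snd)"
    then have B[measurable]: "B \<in> sets ?BZ" by simp
    have "emeasure (distr \<pi>' ?BZ snd) B = (\<integral>\<^sup>+x. indicator B x \<partial>distr \<pi>' ?BZ snd)" by simp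
    also have "\<dots> = (\<integral>\<^sup>+q. indicator B (snd q) \<partial>\<pi>')"
      by (rule nn_integral_distr[OF snd']) simp
    also have "\<dots> = (\<Sum>k\<in>A. \<integral>\<^sup>+p. ennreal (u k (fst p)) * (\<integral>\<^sup>+z. indicator B (T (snd p)) \<partial>\<tau> k) \<partial>\<pi>)"
      by (subst nn\<pi>) (use sndN in auto)
    also have "\<dots> = (\<Sum>k\<in>A. \<integral>\<^sup>+p. ennreal (u k (fst p)) * indicator B (T (snd p)) \<partial>\<pi>)"
      by (intro sum.cong refl) (simp add: prob_space.emeasure_space_1[OF \<tau>p])
    also have "\<dots> = (\<integral>\<^sup>+p. indicator B (T (snd p)) \<partial>\<pi>)"
      by (rule collapse) measurable
    also have "\<dots> = (\<integral>\<^sup>+w. indicator B (T w) \<partial>\<nu>)"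
      unfolding \<pi>n[symmetric] by (rule nn_integral_distr[symmetric]) measurable
    also have "\<dots> = (\<integral>\<^sup>+w. indicator B w \<partial>distr \<nu> ?BZ T)"
    proof (rule nn_integral_distr[symmetric])
      show "T \<in> measurable \<nu> ?BZ" unfolding \<pi>n[symmetric] by simp
    qed simp
    also have "\<dots> = emeasure (distr \<nu> ?BZ T) B" by simp
    finally show "emeasure (distr \<pi>' ?BZ snd) B = emeasure (distr \<nu> ?BZ T) B" .
  qed simp
  have prob: "prob_space \<pi>'"
    using \<mu>' unfolding Z.Prob_iff by (intro prob_space_distrD[OF fst']) (simp add: marg1)
  have "\<pi>' \<in> couplings Z dZ \<mu>' (distr \<nu> ?BZ T)"
    unfolding couplings_def using marg1 marg2 prob \<pi>'s sets_eq_imp_space_eq[OF \<pi>'s]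
    by (simp add: N_def space_pair_measure)
  then have "W2sq Z dZ \<mu>' (distr \<nu> ?BZ T) \<le> (\<integral>\<^sup>+q. ennreal ((dZ (fst q) (snd q))\<^sup>2) \<partial>\<pi>')"
    unfolding W2sq_def by (rule INF_lower)
  also have "\<dots> = (\<Sum>k\<in>A. \<integral>\<^sup>+p. ennreal (u k (fst p)) * (\<integral>\<^sup>+z. ennreal ((dZ z (T (snd p)))\<^sup>2) \<partial>\<tau> k) \<partial>\<pi>)"
    using Z.dist_borel by (subst nn\<pi>) (auto simp: N_def)
  also have "\<dots> \<le> (\<Sum>k\<in>A. \<integral>\<^sup>+p. ennreal (u k (fst p)) * ennreal ((dY (fst p) (snd p) + e)\<^sup>2) \<partial>\<pi>)"
  proof (intro sum_mono nn_integral_mono)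
    fix k p assume k: "k \<in> A" and p: "p \<in> space \<pi>"
    then have pY: "fst p \<in> Y" "snd p \<in> Y" by (auto simp: \<pi>sp)
    show "ennreal (u k (fst p)) * (\<integral>\<^sup>+z. ennreal ((dZ z (T (snd p)))\<^sup>2) \<partial>\<tau> k)
        \<le> ennreal (u k (fst p)) * ennreal ((dY (fst p) (snd p) + e)\<^sup>2)"
    proof (cases "0 < u k (fst p)")
      case True
      have "(\<integral>\<^sup>+z. ennreal ((dZ z (T (snd p)))\<^sup>2) \<partial>\<tau> k) \<le> (\<integral>\<^sup>+z. ennreal ((dY (fst p) (snd p) + e)\<^sup>2) \<partial>\<tau> k)"
      proof (rule nn_integral_mono_AE)
        show "AE z in \<tau> k. ennreal ((dZ z (T (snd p)))\<^sup>2) \<le> ennreal ((dY (fst p) (snd p) + e)\<^sup>2)"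
          using near[OF k pY True] by eventually_elim (intro ennreal_leI power_mono, auto)
      qed
      also have "\<dots> = ennreal ((dY (fst p) (snd p) + e)\<^sup>2)"
        by (simp add: prob_space.emeasure_space_1[OF \<tau>p[OF k]])
      finally show ?thesis by (intro mult_left_mono) auto
    qed (simp add: ennreal_neg)
  qed
  also have "\<dots> = (\<integral>\<^sup>+p. ennreal ((dY (fst p) (snd p) + e)\<^sup>2) \<partial>\<pi>)"
  proof (rule collapse)
    have [measurable]: "(\<lambda>p. dY (fst p) (snd p)) \<in> borel_measurable \<pi>"
      unfolding measurable_cong_sets[OF \<pi>s refl] by (rule Y.dist_borel)
    show "(\<lambda>p. ennreal ((dY (fst p) (snd p) + e)\<^sup>2)) \<in> borel_measurable \<pi>" by measurable
  qed
  finally show ?thesis .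
qed

text \<open>For distances \<open>t\<close> at most \<open>D\<close>, the square of
  \<open>t + e\<close> exceeds the square of \<open>t\<close> by at most
  \<open>e * (2 * D + e)\<close>.\<close>

lemma W2sq_transport:
  assumes e: "0 \<le> e" and D: "\<And>y w. y \<in> Y \<Longrightarrow> w \<in> Y \<Longrightarrow> dY y w \<le> D"
  shows "W2sq Z dZ \<mu>' (distr \<nu> (mborel Z dZ) T) \<le> W2sq Y dY \<mu> \<nu> + ennreal (e * (2 * D + e))"
proof -
  interpret Y: compact_metric Y dY by fact
  let ?W = "W2sq Z dZ \<mu>' (distr \<nu> (mborel Z dZ) T)" and ?c = "ennreal (e * (2 * D + e))"
  \<comment> \<open>The error is moved to the left so that the right side is a bare infimum over
    couplings.\<close>
  have "?W - ?c \<le> W2sq Y dY \<mu> \<nu>"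
    unfolding W2sq_def[of Y dY \<mu> \<nu>]
  proof (rule INF_greatest)
    fix \<pi> assume \<pi>: "\<pi> \<in> couplings Y dY \<mu> \<nu>"
    have \<pi>s: "sets \<pi> = sets (mborel Y dY \<Otimes>\<^sub>M mborel Y dY)" and \<pi>p: "prob_space \<pi>"
      and \<pi>sp: "space \<pi> = Y \<times> Y"
      using \<pi> unfolding couplings_def by blast+
    have [measurable]: "(\<lambda>p. dY (fst p) (snd p)) \<in> borel_measurable \<pi>"
      unfolding measurable_cong_sets[OF \<pi>s refl] by (rule Y.dist_borel)
    have "?W \<le> (\<integral>\<^sup>+p. ennreal ((dY (fst p) (snd p) + e)\<^sup>2) \<partial>\<pi>)"
      by (rule W2sq_transport_coupling[OF \<pi>])
    also have "\<dots> \<le> (\<integral>\<^sup>+p. ennreal ((dY (fst p) (snd p))\<^sup>2) + ?c \<partial>\<pi>)"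
    proof (rule nn_integral_mono)
      fix p assume "p \<in> space \<pi>"
      then have "dY (fst p) (snd p) \<le> D" by (auto simp: \<pi>sp D)
      then have "e * (2 * dY (fst p) (snd p) + e) \<le> e * (2 * D + e)"
        using e by (intro mult_left_mono) auto
      then have le: "(dY (fst p) (snd p) + e)\<^sup>2 \<le> (dY (fst p) (snd p))\<^sup>2 + e * (2 * D + e)"
        by (simp add: power2_eq_square algebra_simps)
      have "0 \<le> dY (fst p) (snd p)" by simp
      then have "0 \<le> e * (2 * D + e)" using e \<open>dY (fst p) (snd p) \<le> D\<close> by (intro mult_nonneg_nonneg) linarith+
      then show "ennreal ((dY (fst p) (snd p) + e)\<^sup>2) \<le> ennreal ((dY (fst p) (snd p))\<^sup>2) + ?c"
        using le by (simp add: ennreal_leI flip: ennreal_plus)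
    qed
    also have "\<dots> = (\<integral>\<^sup>+p. ennreal ((dY (fst p) (snd p))\<^sup>2) \<partial>\<pi>) + ?c"
      by (subst nn_integral_add) (auto simp: prob_space.emeasure_space_1[OF \<pi>p])
    finally show "?W - ?c \<le> (\<integral>\<^sup>+p. ennreal ((dY (fst p) (snd p))\<^sup>2) \<partial>\<pi>)"
      by (simp add: ennreal_minus_le_iff add.commute)
  qed
  then show ?thesis by (simp add: ennreal_minus_le_iff add.commute)
qed

end

section \<open>Partitions of unity\<close>

text \<open>Jensen's inequality for \<open>t * ln t\<close>, obtained from the tangent at the
  average \<open>f\<close>, that is, from \<open>entropy_young\<close> with
  \<open>s = ln f + 1\<close>. A vanishing average is separate, since there is no tangent at
  0.\<close>

lemma entropy_jensen_sum:
  fixes w b :: "'k \<Rightarrow> real"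
  assumes A: "finite A" and w: "\<And>a. a \<in> A \<Longrightarrow> 0 \<le> w a" "(\<Sum>a\<in>A. w a) = 1" and b: "\<And>a. a \<in> A \<Longrightarrow> 0 \<le> b a"
  defines "f \<equiv> (\<Sum>a\<in>A. b a * w a)"
  shows "f * ln f \<le> (\<Sum>a\<in>A. w a * (b a * ln (b a)))"
proof (cases "f = 0")
  case True
  have "b a * w a = 0" if "a \<in> A" for a
    using True that w b A sum_nonneg_eq_0_iff[of A "\<lambda>a. b a * w a"] unfolding f_def by simp
  then have "(\<Sum>a\<in>A. w a * (b a * ln (b a))) = 0"
    by (intro sum.neutral) auto
  then show ?thesis using True by simp
next
  case False
  have "f \<ge> 0" unfolding f_def using w b by (intro sum_nonneg) auto
  then have f: "f > 0" using False by simp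
  have "(\<Sum>a\<in>A. w a * ((ln f + 1) * b a)) \<le> (\<Sum>a\<in>A. w a * (b a * ln (b a) + f))"
    using entropy_young[of "b a" "ln f + 1" for a] b w f by (intro sum_mono mult_left_mono) auto
  also have "\<dots> = (\<Sum>a\<in>A. w a * (b a * ln (b a))) + f"
    using w(2) by (simp add: distrib_left sum.distrib flip: sum_distrib_right)
  also have "(\<Sum>a\<in>A. w a * (s * b a)) = s * f" for s
    unfolding f_def sum_distrib_left by (intro sum.cong) auto
  finally show ?thesis by (simp add: algebra_simps)
qed

text \<open>A crude bound that makes \<open>f * ln f\<close> integrable for bounded densities on
  finite measures.\<close>

lemma abs_entropy_le:
  fixes t :: real
  assumes "0 \<le> t"
  shows "\<bar>t * ln t\<bar> \<le> 1 + t\<^sup>2"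
proof -
  have "t * ln t \<le> t * t"
    using assms by (cases "t = 0") (auto intro!: mult_left_mono order_trans[OF ln_le_minus_one])
  moreover have "exp (0 - 1 :: real) \<le> 1" by simp
  moreover have "0 \<le> t * t" by simp
  ultimately show ?thesis
    using entropy_young[OF assms, of 0] unfolding abs_le_iff power2_eq_square by linarith
qed

text \<open>If the weight has mass zero, the Dirac measure at \<open>a\<close> serves as a default value.\<close>
definition localize :: "'a measure \<Rightarrow> ('a \<Rightarrow> real) \<Rightarrow> 'a \<Rightarrow> 'a measure" where
  "localize m f a = (if (\<integral>x. f x \<partial>m) = 0 then return m a
     else density m (\<lambda>x. ennreal (f x / (\<integral>x. f x \<partial>m))))"

context
  fixes m :: "'a measure" and f :: "'a \<Rightarrow> real" and a :: 'a
  assumes f[measurable]: "integrable m f" and f0: "\<And>x. x \<in> space m \<Longrightarrow> 0 \<le> f x" and a: "a \<in> space m"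
begin

lemma sets_localize: "sets (localize m f a) = sets m"
  unfolding localize_def by simp

text \<open>Mass times normalized measure gives back the weighted measure. With mass zero both sides
  vanish, so the Dirac default never shows up in a mixture.\<close>

lemma integral_mult_emeasure_localize:
  assumes B[measurable]: "B \<in> sets m"
  shows "ennreal (\<integral>x. f x \<partial>m) * emeasure (localize m f a) B = (\<integral>\<^sup>+x. ennreal (f x) * indicator B x \<partial>m)"
proof (cases "(\<integral>x. f x \<partial>m) = 0")
  case True
  have "AE x in m. f x = 0"
    using True integral_nonneg_eq_0_iff_AE[OF f AE_I2[OF f0]] by simp
  then have "(\<integral>\<^sup>+x. ennreal (f x) * indicator B x \<partial>m) = (\<integral>\<^sup>+x. 0 \<partial>m)"
    by (intro nn_integral_cong_AE) auto
  then show ?thesis using True by simp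
next
  case False
  define c where "c = (\<integral>x. f x \<partial>m)"
  have c: "c > 0" using False integral_nonneg_AE[OF AE_I2[OF f0]] unfolding c_def by (simp add: less_le)
  have [measurable]: "f \<in> borel_measurable m" using f by simp
  have "emeasure (localize m f a) B = (\<integral>\<^sup>+x. ennreal (f x / c) * indicator B x \<partial>m)"
    using False unfolding localize_def c_def by (simp add: emeasure_density)
  then have "ennreal c * emeasure (localize m f a) B = (\<integral>\<^sup>+x. ennreal c * (ennreal (f x / c) * indicator B x) \<partial>m)"
    by (subst nn_integral_cmult) auto
  also have "\<dots> = (\<integral>\<^sup>+x. ennreal (f x) * indicator B x \<partial>m)"
    using c by (intro nn_integral_cong) (simp add: f0 flip: mult.assoc ennreal_mult)
  finally show ?thesis unfolding c_def .
qed

lemma prob_space_localize: "prob_space (localize m f a)"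
proof (cases "(\<integral>x. f x \<partial>m) = 0")
  case True
  then show ?thesis unfolding localize_def using a by (simp add: prob_space_return)
next
  case False
  have c: "(\<integral>x. f x \<partial>m) > 0" using False integral_nonneg_AE[OF AE_I2[OF f0]] by (simp add: less_le)
  have "ennreal (\<integral>x. f x \<partial>m) * emeasure (localize m f a) (space m) = (\<integral>\<^sup>+x. ennreal (f x) \<partial>m)"
    by (simp add: integral_mult_emeasure_localize cong: nn_integral_cong)
  also have "\<dots> = ennreal (\<integral>x. f x \<partial>m)"
    using f f0 by (intro nn_integral_eq_integral AE_I2)
  finally have "ennreal (\<integral>x. f x \<partial>m) * emeasure (localize m f a) (space m) = ennreal (\<integral>x. f x \<partial>m) * 1" by simp
  then have "emeasure (localize m f a) (space m) = 1"
    using c by (subst (asm) ennreal_mult_cancel_left) auto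
  then show ?thesis using sets_eq_imp_space_eq[OF sets_localize] by (intro prob_spaceI) simp
qed

text \<open>The condition at \<open>a\<close> covers the Dirac default; otherwise the measure sits
  where \<open>f\<close> is positive.\<close>

lemma AE_localize:
  assumes P[measurable]: "Measurable.pred m P" and "\<And>x. x \<in> space m \<Longrightarrow> 0 < f x \<Longrightarrow> P x" "P a"
  shows "AE x in localize m f a. P x"
proof (cases "(\<integral>x. f x \<partial>m) = 0")
  case True
  then show ?thesis unfolding localize_def using a assms by (simp add: AE_return)
next
  case False
  have c: "(\<integral>x. f x \<partial>m) > 0" using False integral_nonneg_AE[OF AE_I2[OF f0]] by (simp add: less_le)
  have [measurable]: "f \<in> borel_measurable m" using f by simp
  show ?thesis
    unfolding localize_def using False c assms(2) by (simp add: AE_density zero_less_divide_iff)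
qed

end

lemma (in compact_metric) localize_Prob:
  assumes "finite_measure m" "sets m = sets (mborel M d)" "integrable m f" "\<And>x. x \<in> M \<Longrightarrow> 0 \<le> f x" "a \<in> M"
  shows "localize m f a \<in> Prob M d"
proof -
  have sp: "space m = M" using sets_eq_imp_space_eq[OF assms(2)] by simp
  show ?thesis unfolding Prob_iff
    using prob_space_localize[of m f a] sets_localize[of m f a] assms sp by simp
qed

text \<open>Each function is indexed by the centre of its ball, so \<open>A\<close> is at once the
  index set and, by the sum condition, a \<open>\<delta>\<close>-net.\<close>

definition partition_of_unity :: "'a set \<Rightarrow> ('a \<Rightarrow> 'a \<Rightarrow> real) \<Rightarrow> real \<Rightarrow> 'a set \<Rightarrow> ('a \<Rightarrow> 'a \<Rightarrow> real) \<Rightarrow> bool" where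
  "partition_of_unity X d \<delta> A \<psi> \<longleftrightarrow> finite A \<and> A \<subseteq> X
     \<and> (\<forall>a. continuous_map (Metric_space.mtopology X d) euclideanreal (\<psi> a))
     \<and> (\<forall>a. \<forall>x\<in>X. 0 \<le> \<psi> a x) \<and> (\<forall>x\<in>X. (\<Sum>a\<in>A. \<psi> a x) = 1) \<and> (\<forall>a. \<forall>x\<in>X. 0 < \<psi> a x \<longrightarrow> d x a < \<delta>)"

context compact_metric
begin

text \<open>Tent functions of height \<open>\<delta>\<close> around a finite net, divided by their
  sum, which is positive because every point is within \<open>\<delta>\<close> of the net.\<close>

lemma partition_of_unity_exists:
  assumes "\<delta> > 0"
  obtains A \<psi> where "partition_of_unity M d \<delta> A \<psi>"
proof -
  obtain A where A: "finite A" "A \<subseteq> M" and net: "\<And>x. x \<in> M \<Longrightarrow> \<exists>a\<in>A. d x a < \<delta>"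
    using finite_net[OF assms] by blast
  define s where "s x = (\<Sum>b\<in>A. max 0 (\<delta> - d x b))" for x
  have s: "s x > 0" if x: "x \<in> M" for x
  proof -
    obtain a where a: "a \<in> A" "d x a < \<delta>" using net[OF x] by blast
    have "max 0 (\<delta> - d x a) \<le> s x"
      unfolding s_def using a A by (intro member_le_sum) auto
    then show ?thesis using a by linarith
  qed
  define \<psi> where "\<psi> a x = (if a \<in> A then max 0 (\<delta> - d x a) / s x else 0)" for a x
  have "real_continuous (\<psi> a)" for a
  proof (cases "a \<in> A")
    case True
    have "real_continuous (\<lambda>x. max 0 (\<delta> - d x a) / s x)"
      unfolding s_def[abs_def]
    proof (intro continuous_map_real_divide continuous_map_sum continuous_intros A(1) continuous_dist)
      fix x assume "x \<in> topspace mtopology"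
      then show "(\<Sum>b\<in>A. max 0 (\<delta> - d x b)) \<noteq> 0" using s[of x] unfolding s_def by simp
    qed (use True A in auto)
    then show ?thesis using True by (simp add: \<psi>_def[abs_def])
  qed (simp add: \<psi>_def[abs_def])
  moreover have "0 \<le> \<psi> a x" if "x \<in> M" for a x using s[OF that] by (simp add: \<psi>_def)
  moreover have "(\<Sum>a\<in>A. \<psi> a x) = 1" if "x \<in> M" for x
  proof -
    have "(\<Sum>a\<in>A. \<psi> a x) = (\<Sum>a\<in>A. max 0 (\<delta> - d x a) / s x)" by (simp add: \<psi>_def)
    also have "\<dots> = (\<Sum>a\<in>A. max 0 (\<delta> - d x a)) / s x" by (rule sum_divide_distrib[symmetric])
    also have "(\<Sum>a\<in>A. max 0 (\<delta> - d x a)) = s x" by (simp add: s_def)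
    finally show ?thesis using s[OF that] by simp
  qed
  moreover have "d x a < \<delta>" if "x \<in> M" "0 < \<psi> a x" for a x
    using that s[OF that(1)] by (auto simp: \<psi>_def zero_less_divide_iff split: if_splits)
  ultimately have "partition_of_unity M d \<delta> A \<psi>" unfolding partition_of_unity_def using A by simp
  then show thesis by (rule that)
qed

lemma partition_of_unity_net:
  assumes "partition_of_unity M d \<delta> A \<psi>" "x \<in> M"
  shows "\<exists>a\<in>A. d x a < \<delta>"
proof (rule ccontr)
  assume "\<not> ?thesis"
  then have "\<psi> a x = 0" if "a \<in> A" for a
  proof -
    have "0 \<le> \<psi> a x" "0 < \<psi> a x \<longrightarrow> d x a < \<delta>" using assms unfolding partition_of_unity_def by blast+
    then show ?thesis using \<open>\<not> (\<exists>a\<in>A. d x a < \<delta>)\<close> that by (cases "\<psi> a x = 0") auto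
  qed
  then have "(\<Sum>a\<in>A. \<psi> a x) = 0" by simp
  then show False using assms unfolding partition_of_unity_def by simp
qed

text \<open>First use of Jensen, a log-sum inequality: averaging \<open>\<rho>\<close> against the
  weight \<open>\<psi> a\<close> cannot increase entropy, and the weights add up to 1. The second
  claim is absolute continuity of \<open>\<mu>\<close> seen through \<open>\<psi> a\<close>; it
  keeps the quotients meaningful.\<close>

lemma entropy_partition_le:
  assumes pu: "partition_of_unity M d \<delta> A \<psi>" and m: "finite_measure m" "sets m = sets (mborel M d)"
    and \<rho>[measurable]: "\<rho> \<in> borel_measurable m" "\<forall>x\<in>space m. 0 \<le> \<rho> x"
    and \<mu>: "\<mu> = density m (\<lambda>x. ennreal (\<rho> x))" "prob_space \<mu>" and int: "integrable m (\<lambda>x. \<rho> x * ln (\<rho> x))"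
  shows "(\<Sum>a\<in>A. (\<integral>x. \<psi> a x \<partial>\<mu>) * ln ((\<integral>x. \<psi> a x \<partial>\<mu>) / (\<integral>x. \<psi> a x \<partial>m))) \<le> (\<integral>x. \<rho> x * ln (\<rho> x) \<partial>m)"
    and "\<And>a. a \<in> A \<Longrightarrow> 0 < (\<integral>x. \<psi> a x \<partial>\<mu>) \<Longrightarrow> 0 < (\<integral>x. \<psi> a x \<partial>m)"
proof -
  have sp: "space m = M" using sets_eq_imp_space_eq[OF m(2)] by simp
  have A: "finite A" and cont: "\<And>a. real_continuous (\<psi> a)"
    and \<psi>0: "\<And>a x. x \<in> M \<Longrightarrow> 0 \<le> \<psi> a x" and \<psi>1: "\<And>x. x \<in> M \<Longrightarrow> (\<Sum>a\<in>A. \<psi> a x) = 1"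
    using pu unfolding partition_of_unity_def by auto
  have \<psi>m[measurable]: "\<psi> a \<in> borel_measurable m" for a
    using continuous_borel[OF cont[of a]] unfolding measurable_cong_sets[OF m(2) refl] .
  have \<psi>i: "integrable m (\<psi> a)" for a by (rule integrable_continuous[OF m cont])
  have \<psi>le: "\<psi> a x \<le> 1" if "a \<in> A" "x \<in> M" for a x
    using member_le_sum[of a A "\<lambda>a. \<psi> a x"] that \<psi>0 \<psi>1 A by simp
  interpret \<mu>: prob_space \<mu> by fact
  have \<mu>s: "sets \<mu> = sets (mborel M d)" using \<mu>(1) m(2) by simp
  have \<rho>i: "integrable m \<rho>"
  proof -
    have "(\<integral>\<^sup>+x. ennreal (\<rho> x) \<partial>m) = emeasure \<mu> (space \<mu>)"
      unfolding \<mu>(1) by (subst emeasure_density) (auto intro!: nn_integral_cong)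
    then have "(\<integral>\<^sup>+x. ennreal (norm (\<rho> x)) \<partial>m) < \<infinity>"
      using \<rho>(2) by (simp add: \<mu>.emeasure_space_1 cong: nn_integral_cong)
    then show ?thesis by (intro integrableI_bounded) auto
  qed
  have bnd: "integrable m (\<lambda>x. \<psi> a x * g x)" if "a \<in> A" "integrable m g" for a and g :: "'a \<Rightarrow> real"
  proof (rule Bochner_Integration.integrable_bound[OF that(2)])
    show "AE x in m. norm (\<psi> a x * g x) \<le> norm (g x)"
      using \<psi>0 \<psi>le[OF that(1)] by (intro AE_I2) (auto simp: sp abs_mult intro!: mult_left_le_one_le)
  qed (use that in auto)
  have c: "(\<integral>x. \<psi> a x \<partial>\<mu>) = (\<integral>x. \<psi> a x * \<rho> x \<partial>m)" for a
    unfolding \<mu>(1) using \<rho>(2) by (subst integral_density) (auto simp: mult.commute intro!: AE_I2)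
  have M0: "(\<integral>x. \<psi> a x * \<rho> x \<partial>m) = 0" if "(\<integral>x. \<psi> a x \<partial>m) = 0" for a
  proof -
    have "AE x in m. \<psi> a x = 0"
    proof -
      have "AE x in m. 0 \<le> \<psi> a x" using \<psi>0 sp by (intro AE_I2) simp
      from integral_nonneg_eq_0_iff_AE[OF \<psi>i this] that show ?thesis by simp
    qed
    then have "(\<integral>x. \<psi> a x * \<rho> x \<partial>m) = (\<integral>x. 0 \<partial>m)" by (intro integral_cong_AE) auto
    then show ?thesis by simp
  qed
  have Mn: "0 \<le> (\<integral>x. \<psi> a x \<partial>m)" for a using \<psi>0 sp by (intro integral_nonneg_AE AE_I2) auto
  have cn: "0 \<le> (\<integral>x. \<psi> a x * \<rho> x \<partial>m)" for a using \<psi>0 \<rho>(2) sp by (intro integral_nonneg_AE AE_I2) auto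
  show pos: "0 < (\<integral>x. \<psi> a x \<partial>m)" if "a \<in> A" "0 < (\<integral>x. \<psi> a x \<partial>\<mu>)" for a
    using that M0[of a] Mn[of a] unfolding c by (cases "(\<integral>x. \<psi> a x \<partial>m) = 0") auto
  have each: "(\<integral>x. \<psi> a x \<partial>\<mu>) * ln ((\<integral>x. \<psi> a x \<partial>\<mu>) / (\<integral>x. \<psi> a x \<partial>m)) \<le> (\<integral>x. \<psi> a x * (\<rho> x * ln (\<rho> x)) \<partial>m)"
    if a: "a \<in> A" for a
  proof (cases "(\<integral>x. \<psi> a x \<partial>\<mu>) = 0")
    case True
    have "AE x in m. \<psi> a x * \<rho> x = 0"
    proof -
      have "AE x in m. 0 \<le> \<psi> a x * \<rho> x" using \<psi>0 \<rho>(2) sp by (intro AE_I2) simp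
      from integral_nonneg_eq_0_iff_AE[OF bnd[OF a \<rho>i] this] True show ?thesis unfolding c by simp
    qed
    then have "(\<integral>x. \<psi> a x * (\<rho> x * ln (\<rho> x)) \<partial>m) = (\<integral>x. 0 \<partial>m)"
      by (intro integral_cong_AE) auto
    then show ?thesis using True by simp
  next
    case False
    define t where "t = (\<integral>x. \<psi> a x \<partial>\<mu>)"
    define r where "r = (\<integral>x. \<psi> a x \<partial>m)"
    have t: "t > 0" using False cn[of a] unfolding t_def c by simp
    have r: "r > 0" using pos[OF a] t unfolding r_def t_def by simp
    \<comment> \<open>The average of \<open>\<rho>\<close> with respect to \<open>\<psi> a\<close>
      is \<open>t/r\<close>; the tangent of \<open>t * ln t\<close> there is integrated against that
      weight.\<close>
    have "(\<integral>x. (ln (t/r) + 1) * (\<psi> a x * \<rho> x) \<partial>m) \<le> (\<integral>x. \<psi> a x * (\<rho> x * ln (\<rho> x)) + (t/r) * \<psi> a x \<partial>m)"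
    proof (rule integral_mono)
      fix x assume x: "x \<in> space m"
      have "(ln (t/r) + 1) * \<rho> x \<le> \<rho> x * ln (\<rho> x) + t/r"
        using entropy_young[of "\<rho> x" "ln (t/r) + 1"] \<rho>(2) x t r by simp
      then have "\<psi> a x * ((ln (t/r) + 1) * \<rho> x) \<le> \<psi> a x * (\<rho> x * ln (\<rho> x) + t/r)"
        using \<psi>0 x sp by (intro mult_left_mono) auto
      then show "(ln (t/r) + 1) * (\<psi> a x * \<rho> x) \<le> \<psi> a x * (\<rho> x * ln (\<rho> x)) + (t/r) * \<psi> a x"
        by (simp add: algebra_simps)
    qed (use bnd[OF a \<rho>i] bnd[OF a int] \<psi>i in auto)
    also have "\<dots> = (\<integral>x. \<psi> a x * (\<rho> x * ln (\<rho> x)) \<partial>m) + (\<integral>x. (t/r) * \<psi> a x \<partial>m)"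
      by (rule Bochner_Integration.integral_add[OF bnd[OF a int] integrable_mult_right[OF \<psi>i]])
    also have "(\<integral>x. (t/r) * \<psi> a x \<partial>m) = t" using r by (simp add: r_def)
    also have "(\<integral>x. (ln (t/r) + 1) * (\<psi> a x * \<rho> x) \<partial>m) = (ln (t/r) + 1) * t"
      using c[of a] unfolding t_def by simp
    finally show ?thesis unfolding t_def[symmetric] r_def[symmetric] by (simp add: algebra_simps)
  qed
  have "(\<Sum>a\<in>A. (\<integral>x. \<psi> a x \<partial>\<mu>) * ln ((\<integral>x. \<psi> a x \<partial>\<mu>) / (\<integral>x. \<psi> a x \<partial>m)))
      \<le> (\<Sum>a\<in>A. (\<integral>x. \<psi> a x * (\<rho> x * ln (\<rho> x)) \<partial>m))"
    by (rule sum_mono[OF each])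
  also have "\<dots> = (\<integral>x. (\<Sum>a\<in>A. \<psi> a x * (\<rho> x * ln (\<rho> x))) \<partial>m)"
    by (rule Bochner_Integration.integral_sum[symmetric]) (use bnd int in auto)
  also have "\<dots> = (\<integral>x. \<rho> x * ln (\<rho> x) \<partial>m)"
    using \<psi>1 sp by (intro Bochner_Integration.integral_cong) (auto simp flip: sum_distrib_right)
  finally show "(\<Sum>a\<in>A. (\<integral>x. \<psi> a x \<partial>\<mu>) * ln ((\<integral>x. \<psi> a x \<partial>\<mu>) / (\<integral>x. \<psi> a x \<partial>m))) \<le> (\<integral>x. \<rho> x * ln (\<rho> x) \<partial>m)" .
qed

end

text \<open>A pointwise choice of approximate preimages need not be Borel. Here \<open>T\<close>
  takes only finitely many values, one for each net point, on Borel pieces cut out by balls. A point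
  is within \<open>\<delta>\<close> of its net point, which is within \<open>\<epsilon>\<close>, at
  most \<open>\<delta>\<close>, of the image of the chosen preimage; hence
  \<open>2 * \<delta>\<close>.\<close>

lemma approx_inverse_exists:
  assumes cX: "compact_metric X d" and c1: "compact_metric X1 d1" and ap: "eps_approx \<epsilon> X1 d1 X d \<phi>"
    and \<delta>: "\<epsilon> \<le> \<delta>" and pu: "partition_of_unity X d \<delta> A \<psi>" and ne: "X \<noteq> {}"
  obtains T where "T \<in> measurable (mborel X d) (mborel X1 d1)" "\<And>w. w \<in> X \<Longrightarrow> d w (\<phi> (T w)) \<le> 2 * \<delta>"
proof -
  interpret X: compact_metric X d by fact
  interpret X1: compact_metric X1 d1 by fact
  have "\<forall>a\<in>X. \<exists>y. y \<in> X1 \<and> d a (\<phi> y) \<le> \<epsilon>" using ap unfolding eps_approx_def by blast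
  from bchoice[OF this] obtain y where "\<forall>a\<in>X. y a \<in> X1 \<and> d a (\<phi> (y a)) \<le> \<epsilon>" ..
  then have y: "\<And>a. a \<in> X \<Longrightarrow> y a \<in> X1 \<and> d a (\<phi> (y a)) \<le> \<epsilon>" by simp
  have \<phi>: "\<phi> z \<in> X" if "z \<in> X1" for z using ap that unfolding eps_approx_def by blast
  obtain x0 where x0: "x0 \<in> X" using ne by auto
  have A: "finite A" "A \<subseteq> X" using pu unfolding partition_of_unity_def by auto
  from A have "\<exists>T\<in>measurable (mborel X d) (mborel X1 d1). \<forall>w. (\<exists>a\<in>A. d w a < \<delta>) \<longrightarrow> (\<exists>a\<in>A. d w a < \<delta> \<and> T w = y a)"
  proof (induction A)
    case empty
    have "(\<lambda>w. y x0) \<in> measurable (mborel X d) (mborel X1 d1)" using y[OF x0] by simp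
    then show ?case by blast
  next
    case (insert b B)
    have BX: "B \<subseteq> X" and b: "b \<in> X" using insert.prems by auto
    from insert.IH[OF BX] obtain T where T[measurable]: "T \<in> measurable (mborel X d) (mborel X1 d1)"
      and T': "\<forall>w. (\<exists>a\<in>B. d w a < \<delta>) \<longrightarrow> (\<exists>a\<in>B. d w a < \<delta> \<and> T w = y a)" by (rule bexE)
    have [measurable]: "(\<lambda>w. d w b) \<in> borel_measurable (mborel X d)"
      by (rule X.continuous_borel[OF X.continuous_dist[OF b]])
    have yb: "y b \<in> X1" using y[OF b] by simp
    have "{w \<in> space (mborel X d). d w b < \<delta>} \<in> sets (mborel X d)" by measurable
    then have "(\<lambda>w. if d w b < \<delta> then y b else T w) \<in> measurable (mborel X d) (mborel X1 d1)"
      by (intro measurable_If T measurable_const) (simp_all add: yb)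
    moreover have "\<forall>w. (\<exists>a\<in>insert b B. d w a < \<delta>) \<longrightarrow> (\<exists>a\<in>insert b B. d w a < \<delta> \<and> (if d w b < \<delta> then y b else T w) = y a)"
    proof (intro allI impI)
      fix w assume w: "\<exists>a\<in>insert b B. d w a < \<delta>"
      show "\<exists>a\<in>insert b B. d w a < \<delta> \<and> (if d w b < \<delta> then y b else T w) = y a"
      proof (cases "d w b < \<delta>")
        case False
        then have "\<exists>a\<in>B. d w a < \<delta>" using w by blast
        then have "\<exists>a\<in>B. d w a < \<delta> \<and> T w = y a" using T' by blast
        then show ?thesis using False by auto
      qed auto
    qed
    ultimately show ?case by (intro bexI[of _ "\<lambda>w. if d w b < \<delta> then y b else T w"])
  qed
  then obtain T where T: "T \<in> measurable (mborel X d) (mborel X1 d1)"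
    and T': "\<forall>w. (\<exists>a\<in>A. d w a < \<delta>) \<longrightarrow> (\<exists>a\<in>A. d w a < \<delta> \<and> T w = y a)" by (rule bexE)
  show thesis
  proof (rule that[OF T])
    fix w assume w: "w \<in> X"
    obtain a where a: "a \<in> A" "d w a < \<delta>" "T w = y a"
      using T' X.partition_of_unity_net[OF pu w] by blast
    have aX: "a \<in> X" using a A by auto
    have "d w (\<phi> (y a)) \<le> d w a + d a (\<phi> (y a))"
      using w aX y[OF aX] \<phi> by (intro X.triangle) auto
    then show "d w (\<phi> (T w)) \<le> 2 * \<delta>" using a y[OF aX] \<delta> by auto
  qed
qed

section \<open>Recovery sequences\<close>

text \<open>One measure \<open>\<mu>\<close> and one approximating space. The condition
  \<open>pos\<close> holds for all sufficiently far spaces: the integrals over them converge, and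
  their limits are positive wherever \<open>\<mu>\<close> charges \<open>\<psi> a\<close>.\<close>

locale recovery = X: compact_metric X d + X1: compact_metric X1 d1
  for X :: "'b set" and d and X1 :: "'a set" and d1 +
  fixes m1 :: "'a measure" and \<phi> :: "'a \<Rightarrow> 'b" and \<epsilon> \<delta> :: real and A :: "'b set"
    and \<psi> :: "'b \<Rightarrow> 'b \<Rightarrow> real" and T :: "'b \<Rightarrow> 'a" and \<mu> :: "'b measure"
  assumes m1: "finite_measure m1" "sets m1 = sets (mborel X1 d1)"
    and \<phi>: "\<phi> \<in> measurable (mborel X1 d1) (mborel X d)"
    and ap: "eps_approx \<epsilon> X1 d1 X d \<phi>" and \<epsilon>\<delta>: "\<epsilon> \<le> \<delta>" and \<delta>: "0 < \<delta>"
    and pu: "partition_of_unity X d \<delta> A \<psi>"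
    and T: "T \<in> measurable (mborel X d) (mborel X1 d1)"
    and T': "\<And>w. w \<in> X \<Longrightarrow> d w (\<phi> (T w)) \<le> 2 * \<delta>"
    and \<mu>: "\<mu> \<in> Prob X d"
    and pos: "\<And>a. a \<in> A \<Longrightarrow> 0 < (\<integral>x. \<psi> a x \<partial>\<mu>) \<Longrightarrow> 0 < (\<integral>y. \<psi> a (\<phi> y) \<partial>m1)"
begin

definition "c a = (\<integral>x. \<psi> a x \<partial>\<mu>)"
definition "r a = (\<integral>y. \<psi> a (\<phi> y) \<partial>m1)"
definition "f y = (\<Sum>a\<in>A. c a / r a * \<psi> a (\<phi> y))"
definition "recovered = density m1 (\<lambda>y. ennreal (f y))"

lemma A: "finite A" "A \<subseteq> X" and \<psi>cont: "X.real_continuous (\<psi> a)"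
  and \<psi>0: "x \<in> X \<Longrightarrow> 0 \<le> \<psi> a x" and \<psi>1: "x \<in> X \<Longrightarrow> (\<Sum>a\<in>A. \<psi> a x) = 1"
  and \<psi>pos: "x \<in> X \<Longrightarrow> 0 < \<psi> a x \<Longrightarrow> d x a < \<delta>"
  using pu unfolding partition_of_unity_def by blast+

lemma \<mu>s: "sets \<mu> = sets (mborel X d)" and \<mu>p: "prob_space \<mu>"
  using \<mu> unfolding X.Prob_iff by blast+

lemma sp\<mu>: "space \<mu> = X" and spm1: "space m1 = X1"
  using sets_eq_imp_space_eq[OF \<mu>s] sets_eq_imp_space_eq[OF m1(2)] by simp_all

lemma \<phi>X: "y \<in> X1 \<Longrightarrow> \<phi> y \<in> X"
  and \<phi>d: "y \<in> X1 \<Longrightarrow> z \<in> X1 \<Longrightarrow> \<bar>d (\<phi> y) (\<phi> z) - d1 y z\<bar> \<le> \<epsilon>"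
  and \<phi>net: "x \<in> X \<Longrightarrow> \<exists>y\<in>X1. d x (\<phi> y) \<le> \<epsilon>"
  using ap unfolding eps_approx_def by blast+

lemma \<psi>b[measurable]: "\<psi> a \<in> borel_measurable (mborel X d)"
  by (rule X.continuous_borel[OF \<psi>cont])

lemma \<psi>\<phi>b[measurable]: "(\<lambda>y. \<psi> a (\<phi> y)) \<in> borel_measurable (mborel X1 d1)"
  by (rule measurable_compose[OF \<phi> \<psi>b])

lemma \<psi>\<phi>m: "(\<lambda>y. \<psi> a (\<phi> y)) \<in> borel_measurable m1"
  unfolding measurable_cong_sets[OF m1(2) refl] by (rule \<psi>\<phi>b)

lemma fb[measurable]: "f \<in> borel_measurable (mborel X1 d1)"
  unfolding f_def by measurable

lemma fm: "f \<in> borel_measurable m1"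
  unfolding measurable_cong_sets[OF m1(2) refl] by (rule fb)

lemma \<psi>le: "a \<in> A \<Longrightarrow> x \<in> X \<Longrightarrow> \<psi> a x \<le> 1"
  using member_le_sum[of a A "\<lambda>a. \<psi> a x"] \<psi>0 \<psi>1 A by simp

lemma \<psi>i: "integrable \<mu> (\<psi> a)"
  using X.integrable_continuous[OF _ \<mu>s \<psi>cont] \<mu>p by (simp add: prob_space_def)

lemma \<psi>\<phi>i: "integrable m1 (\<lambda>y. \<psi> a (\<phi> y))"
proof -
  interpret finite_measure m1 by (rule m1)
  obtain b where "\<And>x. x \<in> X \<Longrightarrow> \<bar>\<psi> a x\<bar> \<le> b" using X.continuous_bounded[OF \<psi>cont] by metis
  then show ?thesis
    using \<psi>\<phi>m \<phi>X spm1 by (intro integrable_const_bound[of _ b]) auto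
qed

lemma c0: "0 \<le> c a" unfolding c_def using \<psi>0 sp\<mu> by (intro integral_nonneg_AE AE_I2) simp

lemma r0: "0 \<le> r a" unfolding r_def using \<psi>0 \<phi>X spm1 by (intro integral_nonneg_AE AE_I2) simp

text \<open>A cell that is empty for \<open>m1\<close> carries no mass of \<open>\<mu>\<close>, so
  the convention that division by 0 gives 0 loses no mass in \<open>f\<close>.\<close>

lemma rc: "a \<in> A \<Longrightarrow> r a = 0 \<Longrightarrow> c a = 0"
  using pos[of a] c0[of a] unfolding c_def r_def by (cases "(\<integral>x. \<psi> a x \<partial>\<mu>) = 0") auto

lemma f0: "y \<in> X1 \<Longrightarrow> 0 \<le> f y"
  unfolding f_def using \<psi>0 \<phi>X c0 r0 by (intro sum_nonneg mult_nonneg_nonneg divide_nonneg_nonneg) auto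

lemma nn_c: "(\<integral>\<^sup>+x. ennreal (\<psi> a x) \<partial>\<mu>) = ennreal (c a)"
  unfolding c_def using \<psi>i \<psi>0 sp\<mu> by (intro nn_integral_eq_integral AE_I2) auto

lemma nn_r: "(\<integral>\<^sup>+y. ennreal (\<psi> a (\<phi> y)) \<partial>m1) = ennreal (r a)"
  unfolding r_def using \<psi>\<phi>i \<psi>0 \<phi>X spm1 by (intro nn_integral_eq_integral AE_I2) auto

lemma cr: "a \<in> A \<Longrightarrow> ennreal (c a / r a) * ennreal (r a) = ennreal (c a)"
  using rc[of a] r0[of a] c0[of a] by (cases "r a = 0") (auto simp flip: ennreal_mult)

definition "y a = (SOME y. y \<in> X1 \<and> d a (\<phi> y) \<le> \<epsilon>)"

lemma y: "a \<in> A \<Longrightarrow> y a \<in> X1" "a \<in> A \<Longrightarrow> d a (\<phi> (y a)) \<le> \<epsilon>"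
proof -
  assume "a \<in> A"
  then have "\<exists>y. y \<in> X1 \<and> d a (\<phi> y) \<le> \<epsilon>" using \<phi>net[of a] A(2) by blast
  from someI_ex[OF this] show "y a \<in> X1" "d a (\<phi> (y a)) \<le> \<epsilon>" unfolding y_def by simp_all
qed

abbreviation "\<tau> a \<equiv> localize m1 (\<lambda>y. \<psi> a (\<phi> y)) (y a)"

text \<open>The mixture form demanded by the transport lemma: a label \<open>a\<close> of
  probability \<open>c a\<close>, then a point drawn from \<open>m1\<close> localized in the cell of
  \<open>a\<close>.\<close>

lemma emeasure_recovered:
  assumes B[measurable]: "B \<in> sets (mborel X1 d1)"
  shows "emeasure recovered B = (\<Sum>a\<in>A. ennreal (c a) * emeasure (\<tau> a) B)"
proof -
  have Bm[measurable]: "B \<in> sets m1" using B m1 by simp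
  note [measurable] = fm \<psi>\<phi>m
  have "emeasure recovered B = (\<integral>\<^sup>+z. ennreal (f z) * indicator B z \<partial>m1)"
    unfolding recovered_def by (rule emeasure_density) auto
  also have "\<dots> = (\<integral>\<^sup>+z. (\<Sum>a\<in>A. ennreal (c a / r a) * (ennreal (\<psi> a (\<phi> z)) * indicator B z)) \<partial>m1)"
  proof (rule nn_integral_cong)
    fix z assume "z \<in> space m1"
    then have z: "\<phi> z \<in> X" using \<phi>X spm1 by simp
    have "ennreal (f z) = (\<Sum>a\<in>A. ennreal (c a / r a * \<psi> a (\<phi> z)))"
      unfolding f_def using z \<psi>0 c0 r0 by (subst sum_ennreal) auto
    also have "\<dots> = (\<Sum>a\<in>A. ennreal (c a / r a) * ennreal (\<psi> a (\<phi> z)))"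
      using z \<psi>0 c0 r0 by (intro sum.cong ennreal_mult) auto
    finally show "ennreal (f z) * indicator B z = (\<Sum>a\<in>A. ennreal (c a / r a) * (ennreal (\<psi> a (\<phi> z)) * indicator B z))"
      by (simp add: sum_distrib_right mult.assoc)
  qed
  also have "\<dots> = (\<Sum>a\<in>A. ennreal (c a / r a) * (\<integral>\<^sup>+z. ennreal (\<psi> a (\<phi> z)) * indicator B z \<partial>m1))"
    by (subst nn_integral_sum) (auto simp: nn_integral_cmult)
  also have "\<dots> = (\<Sum>a\<in>A. ennreal (c a) * emeasure (\<tau> a) B)"
  proof (rule sum.cong[OF refl])
    fix a assume a: "a \<in> A"
    have "(\<integral>\<^sup>+z. ennreal (\<psi> a (\<phi> z)) * indicator B z \<partial>m1) = ennreal (r a) * emeasure (\<tau> a) B"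
      unfolding r_def using \<psi>\<phi>i \<psi>0 \<phi>X spm1 y[OF a] Bm
      by (intro integral_mult_emeasure_localize[symmetric]) auto
    then show "ennreal (c a / r a) * (\<integral>\<^sup>+z. ennreal (\<psi> a (\<phi> z)) * indicator B z \<partial>m1)
        = ennreal (c a) * emeasure (\<tau> a) B"
      by (simp add: cr[OF a] flip: mult.assoc)
  qed
  finally show ?thesis .
qed

lemma sets_recovered: "sets recovered = sets (mborel X1 d1)"
  unfolding recovered_def using m1 by simp

lemma sum_c: "(\<Sum>a\<in>A. ennreal (c a)) = 1"
proof -
  have "(\<Sum>a\<in>A. ennreal (c a)) = (\<integral>\<^sup>+x. (\<Sum>a\<in>A. ennreal (\<psi> a x)) \<partial>\<mu>)"
    unfolding nn_c[symmetric] by (rule nn_integral_sum[symmetric])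
      (use \<psi>i in \<open>auto intro: borel_measurable_integrable\<close>)
  also have "\<dots> = (\<integral>\<^sup>+x. 1 \<partial>\<mu>)"
    using \<psi>0 \<psi>1 sp\<mu> by (intro nn_integral_cong) (simp add: sum_ennreal)
  finally show ?thesis using prob_space.emeasure_space_1[OF \<mu>p] by simp
qed

lemma localize_m1_Prob: "a \<in> A \<Longrightarrow> \<tau> a \<in> Prob X1 d1"
  using \<psi>0 \<phi>X y by (intro X1.localize_Prob m1 \<psi>\<phi>i) auto

lemma recovered_Prob: "recovered \<in> Prob X1 d1"
  unfolding X1.Prob_iff
proof (intro conjI sets_recovered prob_spaceI)
  have sp: "space recovered = X1" using sets_eq_imp_space_eq[OF sets_recovered] by simp
  have "emeasure (\<tau> a) X1 = 1" if "a \<in> A" for a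
    using localize_m1_Prob[OF that] prob_space.emeasure_space_1 unfolding Prob_def by force
  then have "emeasure recovered X1 = (\<Sum>a\<in>A. ennreal (c a))"
    using sets.top[of "mborel X1 d1"] by (subst emeasure_recovered) auto
  then show "emeasure recovered (space recovered) = 1" by (simp add: sp sum_c)
qed

text \<open>Second use of Jensen, now pointwise: \<open>f z\<close> is a convex combination of the
  numbers \<open>c a / r a\<close> with weights \<open>\<psi> a (\<phi> z)\<close>, and integrating
  these weights against \<open>m1\<close> returns \<open>r a\<close>.\<close>

lemma Ent_recovered: "Ent m1 recovered \<le> ereal (\<Sum>a\<in>A. c a * ln (c a / r a))"
proof -
  interpret finite_measure m1 by (rule m1)
  note [measurable] = fm \<psi>\<phi>m
  have f1: "\<forall>z\<in>space m1. 0 \<le> f z" using f0 spm1 by simp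
  define F where "F = (\<Sum>a\<in>A. c a / r a)"
  have fF: "f z \<le> F" if "z \<in> X1" for z
    unfolding f_def F_def
  proof (rule sum_mono)
    fix a assume "a \<in> A"
    then show "c a / r a * \<psi> a (\<phi> z) \<le> c a / r a"
      using \<psi>le[OF _ \<phi>X[OF that], of a] \<psi>0[OF \<phi>X[OF that], of a] c0[of a] r0[of a]
      by (intro mult_right_le_one_le) simp_all
  qed
  \<comment> \<open>The density is bounded by the finite sum \<open>F\<close>, so the crude entropy
    bound is integrable.\<close>
  have int: "integrable m1 (\<lambda>z. f z * ln (f z))"
  proof (rule integrable_const_bound[of _ "1 + F\<^sup>2"])
    show "AE z in m1. norm (f z * ln (f z)) \<le> 1 + F\<^sup>2"
    proof (rule AE_I2)
      fix z assume "z \<in> space m1"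
      then have z: "z \<in> X1" using spm1 by simp
      have "(f z)\<^sup>2 \<le> F\<^sup>2" using fF[OF z] f0[OF z] by (rule power_mono)
      then show "norm (f z * ln (f z)) \<le> 1 + F\<^sup>2" using abs_entropy_le[OF f0[OF z]] by simp
    qed
  qed measurable
  have ent: "Ent m1 recovered = ereal (\<integral>z. f z * ln (f z) \<partial>m1)"
    unfolding recovered_def by (rule Ent_density[OF m1(1) fm f1 int])
  have "(\<integral>z. f z * ln (f z) \<partial>m1) \<le> (\<integral>z. (\<Sum>a\<in>A. \<psi> a (\<phi> z) * (c a / r a * ln (c a / r a))) \<partial>m1)"
  proof (rule integral_mono[OF int])
    show "integrable m1 (\<lambda>z. \<Sum>a\<in>A. \<psi> a (\<phi> z) * (c a / r a * ln (c a / r a)))"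
      by (rule Bochner_Integration.integrable_sum, rule integrable_mult_left, rule \<psi>\<phi>i)
    fix z assume "z \<in> space m1"
    then have z: "\<phi> z \<in> X" using \<phi>X spm1 by simp
    show "f z * ln (f z) \<le> (\<Sum>a\<in>A. \<psi> a (\<phi> z) * (c a / r a * ln (c a / r a)))"
      unfolding f_def
      by (rule entropy_jensen_sum[where w="\<lambda>a. \<psi> a (\<phi> z)" and b="\<lambda>a. c a / r a",
            OF A(1) \<psi>0[OF z] \<psi>1[OF z] divide_nonneg_nonneg[OF c0 r0]])
  qed
  also have "\<dots> = (\<Sum>a\<in>A. r a * (c a / r a * ln (c a / r a)))"
    unfolding r_def by (subst Bochner_Integration.integral_sum) (auto intro!: integrable_mult_left \<psi>\<phi>i)
  also have "\<dots> = (\<Sum>a\<in>A. c a * ln (c a / r a))"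
  proof (rule sum.cong[OF refl])
    fix a assume "a \<in> A"
    then show "r a * (c a / r a * ln (c a / r a)) = c a * ln (c a / r a)"
      using rc[of a] by (cases "r a = 0") simp_all
  qed
  finally show ?thesis unfolding ent by simp
qed

lemma dist_pred: "a \<in> X \<Longrightarrow> Measurable.pred (mborel X d) (\<lambda>x. d x a \<le> \<delta>)"
proof -
  assume "a \<in> X"
  then have [measurable]: "(\<lambda>x. d x a) \<in> borel_measurable (mborel X d)"
    by (rule X.continuous_borel[OF X.continuous_dist])
  show ?thesis by measurable
qed

text \<open>The transport lemma with labels \<open>\<psi>\<close> and the map \<open>T\<close>. The
  budget \<open>5 * \<delta>\<close> consists of \<open>\<delta>\<close> from
  \<open>\<phi> z\<close> to \<open>a\<close>, \<open>\<delta>\<close> from \<open>a\<close> to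
  \<open>x\<close>, \<open>2 * \<delta>\<close> for the approximate inverse at \<open>w\<close>, and
  \<open>\<epsilon>\<close>, at most \<open>\<delta>\<close>, for the distortion of
  \<open>\<phi>\<close>.\<close>

lemma W2sq_forward:
  assumes D: "\<And>x w. x \<in> X \<Longrightarrow> w \<in> X \<Longrightarrow> d x w \<le> D"
  shows "W2sq X1 d1 recovered (distr \<nu> (mborel X1 d1) T) \<le> W2sq X d \<mu> \<nu> + ennreal (5 * \<delta> * (2 * D + 5 * \<delta>))"
proof (rule W2sq_transport[OF X.compact_metric_axioms X1.compact_metric_axioms A(1) \<psi>b \<psi>0 \<psi>1 localize_m1_Prob T recovered_Prob])
  show "emeasure recovered B = (\<Sum>k\<in>A. (\<integral>\<^sup>+x. ennreal (\<psi> k x) \<partial>\<mu>) * emeasure (\<tau> k) B)"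
    if "B \<in> sets (mborel X1 d1)" for B
    unfolding nn_c by (rule emeasure_recovered[OF that])
  fix a x w assume a: "a \<in> A" and x: "x \<in> X" and w: "w \<in> X" and p: "0 < \<psi> a x"
  have aX: "a \<in> X" using a A by auto
  have TX: "T w \<in> X1" using measurable_space[OF T, of w] w by simp
  have "AE z in \<tau> a. d (\<phi> z) a \<le> \<delta>"
  proof (rule AE_localize[OF \<psi>\<phi>i])
    show "Measurable.pred m1 (\<lambda>z. d (\<phi> z) a \<le> \<delta>)"
      unfolding measurable_cong_sets[OF m1(2) refl]
      by (rule measurable_compose[OF \<phi> dist_pred[OF aX]])
    show "d (\<phi> z) a \<le> \<delta>" if "z \<in> space m1" "0 < \<psi> a (\<phi> z)" for z
      using \<psi>pos[OF \<phi>X that(2)] that(1) spm1 by simp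
    show "d (\<phi> (y a)) a \<le> \<delta>" using y[OF a] \<epsilon>\<delta> by (simp add: X.commute)
  qed (use \<psi>0 \<phi>X spm1 y[OF a] in auto)
  moreover have "AE z in \<tau> a. z \<in> X1"
    using localize_m1_Prob[OF a] unfolding Prob_def by (intro AE_I2) simp
  ultimately show "AE z in \<tau> a. d1 z (T w) \<le> d x w + 5 * \<delta>"
  proof eventually_elim
    case (elim z)
    have "d (\<phi> z) (\<phi> (T w)) \<le> d (\<phi> z) a + d a (\<phi> (T w))" using \<phi>X elim TX aX by (intro X.triangle) auto
    moreover have "d a (\<phi> (T w)) \<le> d a x + d x (\<phi> (T w))" using \<phi>X TX aX x by (intro X.triangle) auto
    moreover have "d x (\<phi> (T w)) \<le> d x w + d w (\<phi> (T w))" using \<phi>X TX w x by (intro X.triangle) auto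
    moreover have "d a x < \<delta>" using \<psi>pos[OF x p] by (simp add: X.commute)
    ultimately show ?case using \<phi>d[OF elim(2) TX] T'[OF w] elim(1) \<epsilon>\<delta> by linarith
  qed
qed (use \<delta> D in auto)

text \<open>The conditional probability of the label \<open>a\<close> given the point
  \<open>z\<close> of the recovered measure. Where the density vanishes the label is undetermined,
  and \<open>\<psi>\<close> keeps the weights a partition of unity.\<close>

definition "v a z = (if f z = 0 then \<psi> a (\<phi> z) else c a / r a * \<psi> a (\<phi> z) / f z)"

text \<open>The transport lemma in the reverse direction: the label is read off by \<open>v\<close>,
  and a point of X is drawn from \<open>\<mu>\<close> localized in its cell. The distances add up to
  \<open>3 * \<delta>\<close>, rounded up to the constant of the forward estimate. The diameter
  bound of X1 is \<open>D + \<delta>\<close> because \<open>\<phi>\<close> distorts by at most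
  \<open>\<delta>\<close>.\<close>

lemma W2sq_backward:
  assumes D: "\<And>x w. x \<in> X \<Longrightarrow> w \<in> X \<Longrightarrow> d x w \<le> D"
  shows "W2sq X d \<mu> (distr \<nu> (mborel X d) \<phi>) \<le> W2sq X1 d1 recovered \<nu> + ennreal (5 * \<delta> * (2 * (D + \<delta>) + 5 * \<delta>))"
proof (rule W2sq_transport[OF X1.compact_metric_axioms X.compact_metric_axioms A(1), where u=v and \<tau>="\<lambda>a. localize \<mu> (\<psi> a) a"])
  show vb: "v a \<in> borel_measurable (mborel X1 d1)" for a unfolding v_def by measurable
  show "0 \<le> v a z" if "z \<in> X1" for a z
    unfolding v_def using \<psi>0[OF \<phi>X[OF that]] f0[OF that] c0 r0 by simp
  show "(\<Sum>a\<in>A. v a z) = 1" if "z \<in> X1" for z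
  proof (cases "f z = 0")
    case True
    then show ?thesis unfolding v_def using \<psi>1[OF \<phi>X[OF that]] by simp
  next
    case False
    then have "(\<Sum>a\<in>A. v a z) = (\<Sum>a\<in>A. c a / r a * \<psi> a (\<phi> z) / f z)" unfolding v_def by simp
    also have "\<dots> = f z / f z" unfolding f_def by (rule sum_divide_distrib[symmetric])
    finally show ?thesis using False by simp
  qed
  show locP: "localize \<mu> (\<psi> a) a \<in> Prob X d" if "a \<in> A" for a
    using that A \<psi>0 \<mu>p by (intro X.localize_Prob \<mu>s \<psi>i) (auto simp: prob_space_def)
  \<comment> \<open>Averaging the conditional label probabilities gives back the probability
    \<open>c a\<close> of each label. Where \<open>f z = 0\<close>, every nonnegative summand of
    \<open>f z\<close> vanishes, so the identity between the integrands persists.\<close>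
  have cv: "(\<integral>\<^sup>+z. ennreal (v a z) \<partial>recovered) = ennreal (c a)" if a: "a \<in> A" for a
  proof -
    note [measurable] = fm \<psi>\<phi>m
    have [measurable]: "v a \<in> borel_measurable m1" unfolding measurable_cong_sets[OF m1(2) refl] by (rule vb)
    have "(\<integral>\<^sup>+z. ennreal (v a z) \<partial>recovered) = (\<integral>\<^sup>+z. ennreal (f z) * ennreal (v a z) \<partial>m1)"
      unfolding recovered_def by (rule nn_integral_density) measurable
    also have "\<dots> = (\<integral>\<^sup>+z. ennreal (c a / r a) * ennreal (\<psi> a (\<phi> z)) \<partial>m1)"
    proof (rule nn_integral_cong)
      fix z assume "z \<in> space m1"
      then have z: "z \<in> X1" using spm1 by simp
      have "f z * v a z = c a / r a * \<psi> a (\<phi> z)"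
      proof (cases "f z = 0")
        case True
        have "\<forall>a\<in>A. c a / r a * \<psi> a (\<phi> z) = 0"
          using True \<psi>0[OF \<phi>X[OF z]] c0 r0 A(1) unfolding f_def by (subst (asm) sum_nonneg_eq_0_iff) auto
        then show ?thesis using a True by simp
      qed (simp add: v_def)
      moreover have "0 \<le> v a z" unfolding v_def using \<psi>0[OF \<phi>X[OF z]] f0[OF z] c0 r0 by simp
      ultimately show "ennreal (f z) * ennreal (v a z) = ennreal (c a / r a) * ennreal (\<psi> a (\<phi> z))"
        using f0[OF z] \<psi>0[OF \<phi>X[OF z]] c0 r0 by (simp flip: ennreal_mult)
    qed
    also have "\<dots> = ennreal (c a / r a) * ennreal (r a)"
      unfolding nn_r[symmetric] by (rule nn_integral_cmult) measurable
    finally show ?thesis using cr[OF a] by simp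
  qed
  show "emeasure \<mu> B = (\<Sum>a\<in>A. (\<integral>\<^sup>+z. ennreal (v a z) \<partial>recovered) * emeasure (localize \<mu> (\<psi> a) a) B)"
    if B: "B \<in> sets (mborel X d)" for B
  proof -
    have [measurable]: "B \<in> sets \<mu>" using B \<mu>s by simp
    have [measurable]: "\<psi> a \<in> borel_measurable \<mu>" for a using \<psi>i by simp
    have "(\<Sum>a\<in>A. (\<integral>\<^sup>+z. ennreal (v a z) \<partial>recovered) * emeasure (localize \<mu> (\<psi> a) a) B)
        = (\<Sum>a\<in>A. \<integral>\<^sup>+x. ennreal (\<psi> a x) * indicator B x \<partial>\<mu>)"
    proof (rule sum.cong[OF refl])
      fix a assume a: "a \<in> A"
      show "(\<integral>\<^sup>+z. ennreal (v a z) \<partial>recovered) * emeasure (localize \<mu> (\<psi> a) a) B = (\<integral>\<^sup>+x. ennreal (\<psi> a x) * indicator B x \<partial>\<mu>)"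
        unfolding cv[OF a] c_def using \<psi>0 sp\<mu> A a by (intro integral_mult_emeasure_localize \<psi>i) auto
    qed
    also have "\<dots> = (\<integral>\<^sup>+x. (\<Sum>a\<in>A. ennreal (\<psi> a x) * indicator B x) \<partial>\<mu>)"
      by (rule nn_integral_sum[symmetric]) measurable
    also have "\<dots> = (\<integral>\<^sup>+x. indicator B x \<partial>\<mu>)"
      using \<psi>0 \<psi>1 sp\<mu> by (intro nn_integral_cong) (simp add: sum_ennreal flip: sum_distrib_right)
    finally show ?thesis by simp
  qed
  show "\<mu> \<in> Prob X d" "\<phi> \<in> measurable (mborel X1 d1) (mborel X d)" by (rule \<mu> \<phi>)+
  show "d1 z w \<le> D + \<delta>" if "z \<in> X1" "w \<in> X1" for z w
    using D[OF \<phi>X \<phi>X, OF that] \<phi>d[OF that] \<epsilon>\<delta> by linarith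
  fix a z w assume a: "a \<in> A" and z: "z \<in> X1" and w: "w \<in> X1" and p: "0 < v a z"
  have aX: "a \<in> X" using a A by auto
  have "\<psi> a (\<phi> z) \<noteq> 0" using p unfolding v_def by (auto split: if_splits)
  then have "0 < \<psi> a (\<phi> z)" using \<psi>0[OF \<phi>X[OF z], of a] by simp
  then have za: "d (\<phi> z) a < \<delta>" by (rule \<psi>pos[OF \<phi>X[OF z]])
  have "AE x in localize \<mu> (\<psi> a) a. d x a \<le> \<delta>"
  proof (rule AE_localize[OF \<psi>i])
    show "Measurable.pred \<mu> (\<lambda>x. d x a \<le> \<delta>)"
      unfolding measurable_cong_sets[OF \<mu>s refl] by (rule dist_pred[OF aX])
    show "d x a \<le> \<delta>" if "x \<in> space \<mu>" "0 < \<psi> a x" for x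
      using \<psi>pos[OF _ that(2)] that(1) sp\<mu> by simp
    show "d a a \<le> \<delta>" using \<delta> aX by simp
  qed (use \<psi>0 sp\<mu> aX in auto)
  moreover have "AE x in localize \<mu> (\<psi> a) a. x \<in> X"
    using locP[OF a] unfolding Prob_def by (intro AE_I2) simp
  ultimately show "AE x in localize \<mu> (\<psi> a) a. d x (\<phi> w) \<le> d1 z w + 5 * \<delta>"
  proof eventually_elim
    case (elim x)
    have "d x (\<phi> w) \<le> d x a + d a (\<phi> w)" using \<phi>X elim w aX by (intro X.triangle) auto
    moreover have "d a (\<phi> w) \<le> d a (\<phi> z) + d (\<phi> z) (\<phi> w)" using \<phi>X w z aX by (intro X.triangle) auto
    moreover have "d a (\<phi> z) < \<delta>" using za by (simp add: X.commute)
    ultimately show ?case using \<phi>d[OF z w] elim(1) \<epsilon>\<delta> \<delta> by linarith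
  qed
qed (use \<delta> in auto)

end

section \<open>Duality for the entropy\<close>

lemma abs_exp_diff_le:
  fixes x y b :: real
  assumes "x \<le> b" "y \<le> b"
  shows "\<bar>exp x - exp y\<bar> \<le> exp b * \<bar>x - y\<bar>"
proof -
  have le: "exp x - exp y \<le> exp b * (x - y)" if "y \<le> x" "x \<le> b" for x y :: real
  proof -
    have "exp x * (1 + (y - x)) \<le> exp x * exp (y - x)" by (intro mult_left_mono exp_ge_add_one_self) auto
    also have "\<dots> = exp y" by (simp flip: exp_add)
    finally have "exp x - exp y \<le> exp x * (x - y)" by (simp add: algebra_simps)
    also have "\<dots> \<le> exp b * (x - y)" using that by (intro mult_right_mono) auto
    finally show ?thesis .
  qed
  show ?thesis
  proof (cases "y \<le> x")
    case True
    then show ?thesis using le[OF True assms(1)] by simp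
  next
    case False
    then have "x \<le> y" by simp
    then show ?thesis using le[OF \<open>x \<le> y\<close> assms(2)] by simp
  qed
qed

text \<open>The easy half of the duality: \<open>entropy_young\<close> with
  \<open>t = \<rho> x\<close> and \<open>s = g x\<close>, integrated.\<close>

lemma entropy_dual_le:
  assumes m: "finite_measure m" and \<nu>: "prob_space \<nu>" "sets \<nu> = sets m" and E: "Ent m \<nu> \<le> ereal E"
    and g[measurable]: "g \<in> borel_measurable m" and gb: "\<And>x. x \<in> space m \<Longrightarrow> \<bar>g x\<bar> \<le> b"
  shows "(\<integral>x. g x \<partial>\<nu>) \<le> E + (\<integral>x. exp (g x - 1) \<partial>m)"
proof -
  interpret finite_measure m by fact
  have "Ent m \<nu> \<noteq> \<infinity>" using E by auto
  then obtain \<rho> where \<rho>[measurable]: "\<rho> \<in> borel_measurable m" and \<rho>0: "\<forall>x\<in>space m. 0 \<le> \<rho> x"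
    and \<nu>\<rho>: "\<nu> = density m (\<lambda>x. ennreal (\<rho> x))" and int: "integrable m (\<lambda>x. \<rho> x * ln (\<rho> x))"
    and ent: "Ent m \<nu> = ereal (\<integral>x. \<rho> x * ln (\<rho> x) \<partial>m)"
    by (rule Ent_finiteE[OF m])
  have gi: "integrable \<nu> g"
  proof -
    interpret \<nu>: prob_space \<nu> by fact
    show ?thesis using gb g sets_eq_imp_space_eq[OF \<nu>(2)] unfolding measurable_cong_sets[OF \<nu>(2) refl, symmetric]
      by (intro \<nu>.integrable_const_bound[of _ b]) auto
  qed
  have ig: "integrable m (\<lambda>x. \<rho> x * g x)"
    using gi \<rho>0 unfolding \<nu>\<rho> by (subst (asm) integrable_density) auto
  have ie: "integrable m (\<lambda>x. exp (g x - 1))"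
  proof (rule integrable_const_bound[of _ "exp b"])
    show "AE x in m. norm (exp (g x - 1)) \<le> exp b" using gb by (intro AE_I2) (fastforce simp: abs_le_iff)
  qed measurable
  have "(\<integral>x. g x \<partial>\<nu>) = (\<integral>x. \<rho> x * g x \<partial>m)"
    unfolding \<nu>\<rho> using \<rho>0 by (subst integral_density) auto
  also have "\<dots> \<le> (\<integral>x. \<rho> x * ln (\<rho> x) + exp (g x - 1) \<partial>m)"
  proof (rule integral_mono)
    fix x assume "x \<in> space m"
    then show "\<rho> x * g x \<le> \<rho> x * ln (\<rho> x) + exp (g x - 1)"
      using entropy_young[of "\<rho> x" "g x"] \<rho>0 by (simp add: mult.commute)
  qed (use ig ie int in auto)
  also have "\<dots> = (\<integral>x. \<rho> x * ln (\<rho> x) \<partial>m) + (\<integral>x. exp (g x - 1) \<partial>m)"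
    by (rule Bochner_Integration.integral_add[OF int ie])
  also have "(\<integral>x. \<rho> x * ln (\<rho> x) \<partial>m) \<le> E" using E unfolding ent by simp
  finally show ?thesis by simp
qed

context compact_metric
begin

text \<open>The optimal test functions are logarithms of truncated densities, which are only Borel.
  Approximation in L1 of both measures extends the inequality to them.\<close>

lemma entropy_dual_bounded:
  assumes m: "finite_measure m" "sets m = sets (mborel M d)" and \<nu>: "\<nu> \<in> Prob M d"
    and dual: "\<And>g. real_continuous g \<Longrightarrow> (\<integral>x. g x \<partial>\<nu>) \<le> E + (\<integral>x. exp (g x - 1) \<partial>m)"
    and g: "g \<in> borel_measurable (mborel M d)" and gb: "\<And>x. x \<in> M \<Longrightarrow> \<bar>g x\<bar> \<le> b"
  shows "(\<integral>x. g x \<partial>\<nu>) \<le> E + (\<integral>x. exp (g x - 1) \<partial>m)"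
proof -
  have \<nu>s: "sets \<nu> = sets (mborel M d)" and \<nu>f: "finite_measure \<nu>"
    using \<nu> unfolding Prob_iff prob_space_def by auto
  have sp: "space m = M" "space \<nu> = M" using sets_eq_imp_space_eq[OF m(2)] sets_eq_imp_space_eq[OF \<nu>s] by simp_all
  have gm[measurable]: "g \<in> borel_measurable m" "g \<in> borel_measurable \<nu>"
    using g unfolding measurable_cong_sets[OF m(2) refl] measurable_cong_sets[OF \<nu>s refl] by simp_all
  interpret m: finite_measure m by fact
  interpret \<nu>: finite_measure \<nu> by fact
  have gi: "integrable m g" "integrable \<nu> g"
    using gb sp by (auto intro!: m.integrable_const_bound[of _ b] \<nu>.integrable_const_bound[of _ b])
  have ei: "integrable m (\<lambda>x. exp (g x - 1))"
  proof (rule m.integrable_const_bound[of _ "exp b"])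
    show "AE x in m. norm (exp (g x - 1)) \<le> exp b"
    proof (rule AE_I2)
      fix x assume "x \<in> space m"
      then show "norm (exp (g x - 1)) \<le> exp b" using gb[of x] sp by (simp add: abs_le_iff)
    qed
  qed measurable
  \<comment> \<open>Replacing \<open>g\<close> costs \<open>e / L\<close> in the integral against
    \<open>\<nu>\<close> and at most \<open>exp b\<close> times that in the exponential term; with
    this \<open>L\<close> the total is \<open>e\<close>.\<close>
  define L where "L = 1 + exp b"
  have L: "L > 0" unfolding L_def by (simp add: add_pos_pos)
  show ?thesis
  proof (rule field_le_epsilon)
    fix e :: real assume e: "e > 0"
    obtain h where h: "real_continuous h"
      "(\<integral>x. \<bar>h x - g x\<bar> \<partial>m) < e / L" "(\<integral>x. \<bar>h x - g x\<bar> \<partial>\<nu>) < e / L"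
      by (rule continuous_approx_two[OF m \<nu>f \<nu>s g gb, of "e / L"]) (use e L in auto)
    \<comment> \<open>Truncation to the range of \<open>g\<close> keeps the error and makes
      \<open>exp\<close> Lipschitz with constant \<open>exp b\<close> on all values
      involved.\<close>
    define k where "k x = max (- b) (min b (h x))" for x
    have k: "real_continuous k"
      unfolding k_def[abs_def] by (intro continuous_intros h(1))
    have ki: "integrable m k" "integrable \<nu> k"
      by (rule integrable_continuous[OF m k] integrable_continuous[OF \<nu>f \<nu>s k])+
    have hi: "integrable m h" "integrable \<nu> h"
      by (rule integrable_continuous[OF m h(1)] integrable_continuous[OF \<nu>f \<nu>s h(1)])+
    have km[measurable]: "k \<in> borel_measurable m" using ki(1) by simp
    have kb: "\<bar>k x\<bar> \<le> b" and kg: "\<bar>k x - g x\<bar> \<le> \<bar>h x - g x\<bar>" if "x \<in> M" for x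
    proof -
      have "0 \<le> b" "- b \<le> g x" "g x \<le> b" using gb[OF that] by linarith+
      moreover have "k x = (if b \<le> h x then b else if h x \<le> - b then - b else h x)"
        using \<open>0 \<le> b\<close> unfolding k_def max_def min_def by simp
      ultimately show "\<bar>k x\<bar> \<le> b" "\<bar>k x - g x\<bar> \<le> \<bar>h x - g x\<bar>" by (auto simp: abs_le_iff)
    qed
    have eki: "integrable m (\<lambda>x. exp (k x - 1))"
    proof (rule m.integrable_const_bound[of _ "exp b"])
      show "AE x in m. norm (exp (k x - 1)) \<le> exp b"
      proof (rule AE_I2)
        fix x assume "x \<in> space m"
        then show "norm (exp (k x - 1)) \<le> exp b" using kb[of x] sp by (simp add: abs_le_iff)
      qed
    qed measurable
    have "(\<integral>x. g x \<partial>\<nu>) - (\<integral>x. k x \<partial>\<nu>) = (\<integral>x. g x - k x \<partial>\<nu>)"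
      using gi ki by simp
    also have "\<dots> \<le> (\<integral>x. \<bar>h x - g x\<bar> \<partial>\<nu>)"
    proof (rule integral_mono)
      fix x assume "x \<in> space \<nu>"
      then show "g x - k x \<le> \<bar>h x - g x\<bar>" using kg[of x] sp by (simp add: abs_le_iff)
    qed (use gi ki hi in auto)
    finally have 1: "(\<integral>x. g x \<partial>\<nu>) \<le> (\<integral>x. k x \<partial>\<nu>) + e / L" using h(3) by simp
    have "(\<integral>x. exp (k x - 1) \<partial>m) - (\<integral>x. exp (g x - 1) \<partial>m) = (\<integral>x. exp (k x - 1) - exp (g x - 1) \<partial>m)"
      using eki ei by simp
    also have "\<dots> \<le> (\<integral>x. exp b * \<bar>h x - g x\<bar> \<partial>m)"
    proof (rule integral_mono)
      fix x assume "x \<in> space m"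
      then have x: "x \<in> M" using sp by simp
      have "exp (k x - 1) - exp (g x - 1) \<le> exp b * \<bar>(k x - 1) - (g x - 1)\<bar>"
        using kb[OF x] gb[OF x] abs_exp_diff_le[of "k x - 1" b "g x - 1"] by (simp add: abs_le_iff)
      also have "\<dots> \<le> exp b * \<bar>h x - g x\<bar>" using kg[OF x] by (intro mult_left_mono) auto
      finally show "exp (k x - 1) - exp (g x - 1) \<le> exp b * \<bar>h x - g x\<bar>" .
    qed (use eki ei gi hi in auto)
    also have "\<dots> = exp b * (\<integral>x. \<bar>h x - g x\<bar> \<partial>m)" by simp
    also have "\<dots> \<le> exp b * (e / L)" using h(2) by (intro mult_left_mono) auto
    finally have 2: "(\<integral>x. exp (k x - 1) \<partial>m) \<le> (\<integral>x. exp (g x - 1) \<partial>m) + exp b * (e / L)" by simp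
    have "e / L + exp b * (e / L) = L * (e / L)" unfolding L_def by (simp only: distrib_right mult_1_left)
    then have "e / L + exp b * (e / L) = e" using L by simp
    then show "(\<integral>x. g x \<partial>\<nu>) \<le> E + (\<integral>x. exp (g x - 1) \<partial>m) + e"
      using 1 2 dual[OF k] by linarith
  qed
qed

text \<open>The hard half of the duality. Large multiples of indicators force absolute continuity;
  then \<open>1 + ln\<close> of the truncated density, nearly the maximizer, gives the bound, and
  Fatou's lemma removes the truncation.\<close>

theorem Ent_le_of_dual:
  assumes m: "finite_measure m" "sets m = sets (mborel M d)" and \<nu>: "\<nu> \<in> Prob M d"
    and dual: "\<And>g. real_continuous g \<Longrightarrow> (\<integral>x. g x \<partial>\<nu>) \<le> E + (\<integral>x. exp (g x - 1) \<partial>m)"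
  shows "Ent m \<nu> \<le> ereal E"
proof -
  have \<nu>s: "sets \<nu> = sets (mborel M d)" and \<nu>p: "prob_space \<nu>"
    using \<nu> unfolding Prob_iff by auto
  have \<nu>m: "sets \<nu> = sets m" using \<nu>s m by simp
  have sp: "space m = M" "space \<nu> = M" using sets_eq_imp_space_eq[OF m(2)] sets_eq_imp_space_eq[OF \<nu>s] by simp_all
  interpret m: finite_measure m by fact
  interpret \<nu>: prob_space \<nu> by fact
  note bdual = entropy_dual_bounded[OF m \<nu> dual]
  define V where "V = measure m (space m)"
  have ac: "absolutely_continuous m \<nu>"
    unfolding absolutely_continuous_def
  proof
    fix A assume "A \<in> null_sets m"
    then have A: "A \<in> sets m" "emeasure m A = 0" by auto
    have Ab: "A \<in> sets (mborel M d)" using A m by simp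
    \<comment> \<open>With the test function \<open>n\<close> times the indicator of
      \<open>A\<close>, the right side does not see the \<open>m\<close>-null set \<open>A\<close>,
      while the left side grows with \<open>n\<close> unless \<open>\<nu>\<close> ignores it
      too.\<close>
    have le: "real n * measure \<nu> A \<le> E + exp (-1) * V" for n :: nat
    proof -
      have "(\<integral>x. real n * indicator A x \<partial>\<nu>) \<le> E + (\<integral>x. exp (real n * indicator A x - 1) \<partial>m)"
        using Ab by (intro bdual[where b="real n"]) (auto simp: indicator_def)
      moreover have "(\<integral>x. exp (real n * indicator A x - 1) \<partial>m) = (\<integral>x. exp (-1) \<partial>m)"
      proof (rule integral_cong_AE)
        have "AE x in m. x \<notin> A" using A by (intro AE_not_in) auto
        then show "AE x in m. exp (real n * indicator A x - 1) = exp (-1)" by eventually_elim simp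
      qed (use A in auto)
      ultimately show ?thesis using A \<nu>m by (simp add: V_def mult.commute)
    qed
    have "measure \<nu> A = 0"
    proof (rule ccontr)
      assume "measure \<nu> A \<noteq> 0"
      then have p: "measure \<nu> A > 0" by (simp add: zero_less_measure_iff)
      then obtain n :: nat where "E + exp (-1) * V < real n * measure \<nu> A"
        using reals_Archimedean3 by blast
      then show False using le[of n] by simp
    qed
    then show "A \<in> null_sets \<nu>" using A \<nu>m by (auto simp: \<nu>.emeasure_eq_measure)
  qed
  obtain \<rho> where \<rho>[measurable]: "\<rho> \<in> borel_measurable m" and rn: "AE x in m. RN_deriv m \<nu> x = ennreal (\<rho> x)"
    and "AE x in \<nu>. 0 < \<rho> x" and \<rho>0: "\<And>x. 0 \<le> \<rho> x"
    by (rule m.real_RN_deriv[OF \<nu>.finite_measure_axioms ac \<nu>m]) (rule that)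
  have \<nu>\<rho>: "\<nu> = density m (\<lambda>x. ennreal (\<rho> x))"
  proof -
    have "\<nu> = density m (RN_deriv m \<nu>)" by (rule m.density_RN_deriv[OF ac \<nu>m, symmetric])
    also have "\<dots> = density m (\<lambda>x. ennreal (\<rho> x))" using rn by (intro density_cong) auto
    finally show ?thesis .
  qed
  have nn1: "(\<integral>\<^sup>+x. ennreal (\<rho> x) \<partial>m) = 1"
  proof -
    have "(\<integral>\<^sup>+x. ennreal (\<rho> x) \<partial>m) = emeasure \<nu> (space \<nu>)"
      unfolding \<nu>\<rho> by (subst emeasure_density) (auto intro!: nn_integral_cong)
    then show ?thesis by (simp add: \<nu>.emeasure_space_1)
  qed
  have \<rho>i: "integrable m \<rho>" using nn1 \<rho>0 by (intro integrableI_bounded) auto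
  have \<rho>1: "(\<integral>x. \<rho> x \<partial>m) = 1"
    using nn_integral_eq_integral[OF \<rho>i] nn1 \<rho>0 by (simp add: ennreal_eq_1)
  \<comment> \<open>Truncation away from 0 and from infinity makes \<open>ln (k n x)\<close>
    bounded, hence admissible; for positive \<open>\<rho> x\<close> it is inactive from some
    \<open>n\<close> on.\<close>
  define k where "k n x = max (1 / real (Suc n)) (min (real (Suc n)) (\<rho> x))" for n x
  have km[measurable]: "k n \<in> borel_measurable m" for n unfolding k_def[abs_def] by measurable
  have kp: "k n x > 0" for n x unfolding k_def by (simp add: less_max_iff_disj)
  have kle: "k n x \<le> real (Suc n)" "1 / real (Suc n) \<le> k n x" for n x
    unfolding k_def by (auto simp: field_simps)
  have lnk: "\<bar>ln (k n x)\<bar> \<le> ln (real (Suc n))" for n x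
  proof -
    have "ln (k n x) \<le> ln (real (Suc n))" using kle kp by (intro ln_mono) auto
    moreover have "ln (1 / real (Suc n)) \<le> ln (k n x)" using kle kp by (intro ln_mono) auto
    moreover have "ln (1 / real (Suc n)) = - ln (real (Suc n))" by (simp add: ln_div)
    ultimately show ?thesis by linarith
  qed
  have ik: "integrable m (\<lambda>x. \<rho> x * ln (k n x))" for n
  proof (rule Bochner_Integration.integrable_bound[OF integrable_mult_right[OF \<rho>i, of "ln (real (Suc n))"]])
    show "AE x in m. norm (\<rho> x * ln (k n x)) \<le> norm (ln (real (Suc n)) * \<rho> x)"
    proof (rule AE_I2)
      fix x
      have "\<rho> x * \<bar>ln (k n x)\<bar> \<le> \<rho> x * ln (real (Suc n))" by (intro mult_left_mono lnk \<rho>0)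
      then show "norm (\<rho> x * ln (k n x)) \<le> norm (ln (real (Suc n)) * \<rho> x)"
        using \<rho>0[of x] by (simp add: abs_mult mult.commute)
    qed
  qed measurable
  \<comment> \<open>For \<open>g = 1 + ln (k n x)\<close> the exponential term is
    \<open>k n x\<close>, at most \<open>\<rho> x + 1 / (n+1)\<close>. Both sides then contain the
    total mass 1, which cancels.\<close>
  have ub: "(\<integral>x. \<rho> x * ln (k n x) \<partial>m) \<le> E + V / real (Suc n)" for n
  proof -
    have kb: "(\<lambda>x. 1 + ln (k n x)) \<in> borel_measurable (mborel M d)"
      unfolding measurable_cong_sets[OF m(2) refl, symmetric] by measurable
    have "(\<integral>x. 1 + ln (k n x) \<partial>\<nu>) \<le> E + (\<integral>x. exp (1 + ln (k n x) - 1) \<partial>m)"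
    proof (rule bdual[OF _ kb])
      show "\<bar>1 + ln (k n x)\<bar> \<le> 1 + ln (real (Suc n))" for x using lnk[of n x] by linarith
    qed
    moreover have "(\<integral>x. 1 + ln (k n x) \<partial>\<nu>) = (\<integral>x. \<rho> x + \<rho> x * ln (k n x) \<partial>m)"
      unfolding \<nu>\<rho> using \<rho>0 by (subst integral_density) (auto simp: distrib_left)
    moreover have "(\<integral>x. \<rho> x + \<rho> x * ln (k n x) \<partial>m) = 1 + (\<integral>x. \<rho> x * ln (k n x) \<partial>m)"
      using Bochner_Integration.integral_add[OF \<rho>i ik[of n]] \<rho>1 by simp
    moreover have "(\<integral>x. exp (1 + ln (k n x) - 1) \<partial>m) \<le> (\<integral>x. \<rho> x + 1 / real (Suc n) \<partial>m)"
    proof (rule integral_mono)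
      show "integrable m (\<lambda>x. exp (1 + ln (k n x) - 1))"
        using kp[of n] kle[of n] by (intro m.integrable_const_bound[of _ "real (Suc n)"]) (auto simp: less_imp_le)
      show "exp (1 + ln (k n x) - 1) \<le> \<rho> x + 1 / real (Suc n)" for x
      proof -
        have "min (real (Suc n)) (\<rho> x) \<le> \<rho> x" "0 \<le> 1 / real (Suc n)" by simp_all
        then have "k n x \<le> \<rho> x + 1 / real (Suc n)"
          unfolding k_def using \<rho>0[of x] by (intro max.boundedI) linarith+
        then show ?thesis using kp[of n x] by simp
      qed
    qed (use \<rho>i in auto)
    moreover have "(\<integral>x. \<rho> x + 1 / real (Suc n) \<partial>m) = 1 + V / real (Suc n)"
      using \<rho>i \<rho>1 by (simp add: V_def)
    ultimately show ?thesis by linarith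
  qed
  \<comment> \<open>Uniform in \<open>n\<close>, as Fatou's lemma requires: either truncation has
    only raised the value under the logarithm, or \<open>k n x\<close> is at least 1.\<close>
  have lb: "- 1 \<le> \<rho> x * ln (k n x)" for n x
  proof (cases "\<rho> x \<le> real (Suc n)")
    case True
    show ?thesis
    proof (cases "\<rho> x = 0")
      case False
      then have "\<rho> x > 0" using \<rho>0[of x] by simp
      moreover have "\<rho> x \<le> k n x" unfolding k_def using True by simp
      ultimately have "\<rho> x * ln (\<rho> x) \<le> \<rho> x * ln (k n x)" by (intro mult_left_mono ln_mono) auto
      moreover have "exp (0 - 1 :: real) \<le> 1" by simp
      ultimately show ?thesis using entropy_young[OF \<rho>0, of 0 x] by linarith
    qed simp
  next
    case False
    then have "k n x = real (Suc n)" unfolding k_def by (simp add: field_simps max_def)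
    then have "0 \<le> \<rho> x * ln (k n x)" using \<rho>0[of x] by simp
    then show ?thesis by linarith
  qed
  have lim: "(\<lambda>n. \<rho> x * ln (k n x)) \<longlonglongrightarrow> \<rho> x * ln (\<rho> x)" for x
  proof (cases "\<rho> x = 0")
    case False
    then have p: "\<rho> x > 0" using \<rho>0[of x] by simp
    obtain N where N: "max (\<rho> x) (1 / \<rho> x) \<le> real N" using real_arch_simple by blast
    have "k n x = \<rho> x" if "n \<ge> N" for n
    proof -
      have "real N \<le> real (Suc n)" using that by simp
      then have "\<rho> x \<le> real (Suc n)" and "1 / \<rho> x \<le> real (Suc n)" using N by auto
      moreover from this(2) have "1 / real (Suc n) \<le> \<rho> x" using p by (simp add: field_simps)
      ultimately show ?thesis unfolding k_def by simp
    qed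
    then have "\<forall>\<^sub>F n in sequentially. \<rho> x * ln (k n x) = \<rho> x * ln (\<rho> x)"
      unfolding eventually_sequentially by (intro exI[of _ N]) simp
    then show ?thesis by (rule tendsto_eventually)
  qed simp
  \<comment> \<open>From the test function 0. Without this sign, \<open>ennreal\<close> would
    truncate the upper bound and the inequality of reals could not be recovered.\<close>
  have EV: "0 \<le> E + V"
  proof -
    have "(\<integral>x. 0 \<partial>\<nu>) \<le> E + (\<integral>x. exp (0 - 1) \<partial>m)" by (rule dual) simp
    then have "0 \<le> E + exp (- 1) * V" by (simp add: V_def mult.commute)
    also have "exp (- 1) * V \<le> 1 * V" by (intro mult_right_mono) (auto simp: V_def)
    finally show ?thesis by simp
  qed
  \<comment> \<open>Adding 1 makes all integrands nonnegative; on both sides it contributes the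
    total mass \<open>V\<close>, which cancels at the end.\<close>
  have fatou: "(\<integral>\<^sup>+x. ennreal (\<rho> x * ln (\<rho> x) + 1) \<partial>m) \<le> ennreal (E + V)"
  proof -
    have "(\<integral>\<^sup>+x. ennreal (\<rho> x * ln (\<rho> x) + 1) \<partial>m) = (\<integral>\<^sup>+x. liminf (\<lambda>n. ennreal (\<rho> x * ln (k n x) + 1)) \<partial>m)"
    proof (rule nn_integral_cong)
      fix x
      have "(\<lambda>n. ennreal (\<rho> x * ln (k n x) + 1)) \<longlonglongrightarrow> ennreal (\<rho> x * ln (\<rho> x) + 1)"
        by (intro tendsto_ennrealI tendsto_add lim tendsto_const)
      then show "ennreal (\<rho> x * ln (\<rho> x) + 1) = liminf (\<lambda>n. ennreal (\<rho> x * ln (k n x) + 1))"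
        by (intro lim_imp_Liminf[symmetric]) auto
    qed
    also have "\<dots> \<le> liminf (\<lambda>n. \<integral>\<^sup>+x. ennreal (\<rho> x * ln (k n x) + 1) \<partial>m)"
      by (rule nn_integral_liminf) measurable
    also have "\<dots> \<le> liminf (\<lambda>n. ennreal (E + V / real (Suc n) + V))"
    proof (intro Liminf_mono always_eventually allI)
      fix n
      have "(\<integral>\<^sup>+x. ennreal (\<rho> x * ln (k n x) + 1) \<partial>m) = ennreal (\<integral>x. \<rho> x * ln (k n x) + 1 \<partial>m)"
      proof (rule nn_integral_eq_integral)
        show "AE x in m. 0 \<le> \<rho> x * ln (k n x) + 1"
        proof (rule AE_I2)
          show "0 \<le> \<rho> x * ln (k n x) + 1" for x using lb[of x n] by linarith
        qed
      qed (use ik in auto)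
      also have "(\<integral>x. \<rho> x * ln (k n x) + 1 \<partial>m) = (\<integral>x. \<rho> x * ln (k n x) \<partial>m) + V"
        using ik by (simp add: V_def)
      finally show "(\<integral>\<^sup>+x. ennreal (\<rho> x * ln (k n x) + 1) \<partial>m) \<le> ennreal (E + V / real (Suc n) + V)"
        using ub[of n] by (simp add: ennreal_leI)
    qed
    also have "\<dots> = ennreal (E + 0 + V)"
    proof (rule lim_imp_Liminf)
      have "(\<lambda>n. V / real (Suc n)) \<longlonglongrightarrow> 0"
        using LIMSEQ_Suc[OF lim_const_over_n[of V]] by simp
      then show "(\<lambda>n. ennreal (E + V / real (Suc n) + V)) \<longlonglongrightarrow> ennreal (E + 0 + V)"
        by (intro tendsto_ennrealI tendsto_add tendsto_const)
    qed simp
    finally show ?thesis by simp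
  qed
  have low: "0 \<le> \<rho> x * ln (\<rho> x) + 1" for x
  proof -
    have "exp (0 - 1 :: real) \<le> 1" by simp
    then show ?thesis using entropy_young[OF \<rho>0, of 0 x] by linarith
  qed
  have int1: "integrable m (\<lambda>x. \<rho> x * ln (\<rho> x) + 1)"
  proof (rule integrableI_nonneg)
    show "(\<integral>\<^sup>+x. ennreal (\<rho> x * ln (\<rho> x) + 1) \<partial>m) < \<infinity>" using fatou by (auto intro: le_less_trans)
  qed (use low in auto)
  then have int: "integrable m (\<lambda>x. \<rho> x * ln (\<rho> x))"
    using Bochner_Integration.integrable_diff[OF int1 m.integrable_const[of 1]] by simp
  have "ennreal (\<integral>x. \<rho> x * ln (\<rho> x) + 1 \<partial>m) \<le> ennreal (E + V)"
    using fatou nn_integral_eq_integral[OF int1] low by simp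
  then have "(\<integral>x. \<rho> x * ln (\<rho> x) + 1 \<partial>m) \<le> E + V" using EV by (simp add: ennreal_le_iff)
  moreover have "(\<integral>x. \<rho> x * ln (\<rho> x) + 1 \<partial>m) = (\<integral>x. \<rho> x * ln (\<rho> x) \<partial>m) + V"
    using int by (simp add: V_def)
  ultimately have "(\<integral>x. \<rho> x * ln (\<rho> x) \<partial>m) \<le> E" by simp
  then show ?thesis
    unfolding \<nu>\<rho> using Ent_density[OF m(1) \<rho> _ int] \<rho>0 by simp
qed

end

section \<open>Stability\<close>

lemma weighted_sum_add:
  fixes lam :: "nat \<Rightarrow> real"
  assumes "\<And>j. j \<in> I \<Longrightarrow> 0 \<le> lam j" "(\<Sum>j\<in>I. lam j) = 1" "\<And>j. j \<in> I \<Longrightarrow> F j \<le> G j + c"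
  shows "(\<Sum>j\<in>I. ennreal (lam j) * F j) \<le> (\<Sum>j\<in>I. ennreal (lam j) * G j) + c"
proof -
  have "(\<Sum>j\<in>I. ennreal (lam j) * F j) \<le> (\<Sum>j\<in>I. ennreal (lam j) * (G j + c))"
    using assms(3) by (intro sum_mono mult_left_mono) auto
  also have "\<dots> = (\<Sum>j\<in>I. ennreal (lam j) * G j) + (\<Sum>j\<in>I. ennreal (lam j)) * c"
    by (simp add: distrib_left sum.distrib sum_distrib_right)
  also have "(\<Sum>j\<in>I. ennreal (lam j)) = 1" using assms(1,2) by (simp add: sum_ennreal)
  finally show ?thesis by simp
qed

text \<open>Everything that happens at a fixed precision \<open>\<delta>\<close>. The entropy bound
  is recorded only in dual form, since \<open>\<nu>\<close> need not have finite entropy relative to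
  \<open>m\<close>; the reference measure there is still that of the approximating space. The index
  can be taken beyond any \<open>N\<close>, so that the limit \<open>\<delta>\<close> to 0 also
  drives it to infinity.\<close>

lemma approximate_barycenter:
  fixes X :: "'b set" and Xs :: "nat \<Rightarrow> 'a set" and E :: "nat \<Rightarrow> real"
  assumes cX: "compact_metric X d" and m: "finite_measure m" "sets m = sets (mborel X d)"
    and ci: "\<And>i. compact_metric (Xs i) (ds i)"
    and mi: "\<And>i. finite_measure (ms i)" "\<And>i. sets (ms i) = sets (mborel (Xs i) (ds i))"
    and bcd: "\<And>i. BCD K (Xs i) (ds i) (ms i)"
    and ap: "\<And>i. eps_approx (\<epsilon> i) (Xs i) (ds i) X d (\<phi> i)"
    and \<phi>: "\<And>i. \<phi> i \<in> measurable (mborel (Xs i) (ds i)) (mborel X d)"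
    and \<epsilon>: "\<epsilon> \<longlonglongrightarrow> 0"
    and wc: "\<And>g. continuous_map (Metric_space.mtopology X d) euclideanreal g \<Longrightarrow>
        (\<lambda>i. \<integral>y. g (\<phi> i y) \<partial>ms i) \<longlonglongrightarrow> (\<integral>x. g x \<partial>m)"
    and I: "finite I" "\<And>j. j \<in> I \<Longrightarrow> 0 < lam j" "(\<Sum>j\<in>I. lam j) = 1"
    and mus: "\<And>j. j \<in> I \<Longrightarrow> mus j \<in> Prob X d"
    and E: "\<And>j. j \<in> I \<Longrightarrow> Ent m (mus j) = ereal (E j)"
    and fV: "Var X d I lam mus < \<top>"
    and D: "\<And>x w. x \<in> X \<Longrightarrow> w \<in> X \<Longrightarrow> d x w \<le> D" "0 \<le> D" and \<delta>: "0 < \<delta>"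
  defines "err \<equiv> 5 * \<delta> * (2 * (D + \<delta>) + 5 * \<delta>)"
  shows "\<exists>i \<nu>. N \<le> i \<and> \<nu> \<in> Prob X d \<and>
      (\<Sum>j\<in>I. ennreal (lam j) * W2sq X d (mus j) \<nu>) \<le> Var X d I lam mus + ennreal (2 * err) \<and>
      (\<forall>g. continuous_map (Metric_space.mtopology X d) euclideanreal g \<longrightarrow>
        (\<integral>x. g x \<partial>\<nu>) \<le> (\<Sum>j\<in>I. lam j * E j) - K / 2 * enn2real (Var X d I lam mus) + (\<delta> + \<bar>K\<bar> / 2 * err)
          + (\<integral>y. exp (g (\<phi> i y) - 1) \<partial>ms i))"
proof -
  interpret X: compact_metric X d by (rule cX)
  have err: "0 \<le> err" unfolding err_def using \<delta> D(2) by simp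
  have I0: "0 \<le> lam j" if "j \<in> I" for j using I(2)[OF that] by simp
  obtain A \<psi> where pu: "partition_of_unity X d \<delta> A \<psi>" by (rule X.partition_of_unity_exists[OF \<delta>])
  have A: "finite A" and \<psi>c: "\<And>a. X.real_continuous (\<psi> a)"
    using pu unfolding partition_of_unity_def by blast+
  define c where "c j a = (\<integral>x. \<psi> a x \<partial>mus j)" for j a
  define r where "r i a = (\<integral>y. \<psi> a (\<phi> i y) \<partial>ms i)" for i a
  define r0 where "r0 a = (\<integral>x. \<psi> a x \<partial>m)" for a
  have rlim: "(\<lambda>i. r i a) \<longlonglongrightarrow> r0 a" for a unfolding r_def r0_def by (rule wc[OF \<psi>c])
  have jE: "(\<Sum>a\<in>A. c j a * ln (c j a / r0 a)) \<le> E j" and jpos: "\<And>a. a \<in> A \<Longrightarrow> 0 < c j a \<Longrightarrow> 0 < r0 a"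
    if j: "j \<in> I" for j
  proof -
    have "Ent m (mus j) \<noteq> \<infinity>" using E[OF j] by simp
    then obtain \<rho> where \<rho>: "\<rho> \<in> borel_measurable m" "\<forall>x\<in>space m. 0 \<le> \<rho> x"
      "mus j = density m (\<lambda>x. ennreal (\<rho> x))" "integrable m (\<lambda>x. \<rho> x * ln (\<rho> x))"
      "Ent m (mus j) = ereal (\<integral>x. \<rho> x * ln (\<rho> x) \<partial>m)"
      by (rule Ent_finiteE[OF m(1)])
    have p: "prob_space (mus j)" using mus[OF j] unfolding X.Prob_iff by simp
    have "(\<integral>x. \<rho> x * ln (\<rho> x) \<partial>m) = E j" using \<rho>(5) E[OF j] by simp
    then show "(\<Sum>a\<in>A. c j a * ln (c j a / r0 a)) \<le> E j" "\<And>a. a \<in> A \<Longrightarrow> 0 < c j a \<Longrightarrow> 0 < r0 a"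
      using X.entropy_partition_le[OF pu m \<rho>(1,2,3) p \<rho>(4)] unfolding c_def r0_def by simp_all
  qed
  have c0: "0 \<le> c j a" if j: "j \<in> I" for j a
  proof -
    have "space (mus j) = X" using mus[OF j] unfolding Prob_def by simp
    then show ?thesis unfolding c_def
      using pu by (intro integral_nonneg_AE AE_I2) (simp add: partition_of_unity_def)
  qed
  have ev1: "\<forall>\<^sub>F i in sequentially. \<epsilon> i \<le> \<delta>"
    using order_tendstoD(2)[OF \<epsilon> \<delta>] by (rule eventually_mono) simp
  \<comment> \<open>Positivity in the limit space comes from absolute continuity
    (\<open>jpos\<close>); finitely many convergent sequences then stay positive.\<close>
  have ev2: "\<forall>\<^sub>F i in sequentially. \<forall>j\<in>I. \<forall>a\<in>A. 0 < c j a \<longrightarrow> 0 < r i a"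
  proof (intro eventually_ball_finite ballI I(1) A)
    fix j a assume j: "j \<in> I" and a: "a \<in> A"
    show "\<forall>\<^sub>F i in sequentially. 0 < c j a \<longrightarrow> 0 < r i a"
    proof (cases "0 < c j a")
      case True
      from order_tendstoD(1)[OF rlim jpos[OF j a True]] show ?thesis by (rule eventually_mono) simp
    qed simp
  qed
  have ev3: "\<forall>\<^sub>F i in sequentially. \<forall>j\<in>I. (\<Sum>a\<in>A. c j a * ln (c j a / r i a)) < E j + \<delta>"
  proof (intro eventually_ball_finite ballI I(1))
    fix j assume j: "j \<in> I"
    have "(\<lambda>i. \<Sum>a\<in>A. c j a * ln (c j a / r i a)) \<longlonglongrightarrow> (\<Sum>a\<in>A. c j a * ln (c j a / r0 a))"
    proof (rule tendsto_sum)
      fix a assume a: "a \<in> A"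
      show "(\<lambda>i. c j a * ln (c j a / r i a)) \<longlonglongrightarrow> c j a * ln (c j a / r0 a)"
      \<comment> \<open>The logarithm need not converge when \<open>c j a = 0\<close>, but then its
        coefficient is zero; otherwise both arguments of the quotient have positive limits.\<close>
      proof (cases "c j a = 0")
        case False
        then have p: "0 < c j a" using c0[OF j, of a] by simp
        then have q: "0 < r0 a" by (rule jpos[OF j a])
        then show ?thesis using p by (intro tendsto_intros rlim) auto
      qed simp
    qed
    moreover have "(\<Sum>a\<in>A. c j a * ln (c j a / r0 a)) < E j + \<delta>" using jE[OF j] \<delta> by linarith
    ultimately show "\<forall>\<^sub>F i in sequentially. (\<Sum>a\<in>A. c j a * ln (c j a / r i a)) < E j + \<delta>"
      by (rule order_tendstoD(2))
  qed
  have "\<forall>\<^sub>F i in sequentially. N \<le> i \<and> \<epsilon> i \<le> \<delta> \<and> (\<forall>j\<in>I. \<forall>a\<in>A. 0 < c j a \<longrightarrow> 0 < r i a)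
      \<and> (\<forall>j\<in>I. (\<Sum>a\<in>A. c j a * ln (c j a / r i a)) < E j + \<delta>)"
    by (intro eventually_conj eventually_ge_at_top ev1 ev2 ev3)
  then obtain i where i: "N \<le> i" "\<epsilon> i \<le> \<delta>" "\<forall>j\<in>I. \<forall>a\<in>A. 0 < c j a \<longrightarrow> 0 < r i a"
    "\<forall>j\<in>I. (\<Sum>a\<in>A. c j a * ln (c j a / r i a)) < E j + \<delta>"
    using eventually_happens'[OF sequentially_bot] by blast
  interpret Y: compact_metric "Xs i" "ds i" by (rule ci)
  have "I \<noteq> {}" using I(3) by auto
  then obtain j0 where j0: "j0 \<in> I" by auto
  have "X \<noteq> {}" using mus[OF j0] prob_space.not_empty unfolding Prob_def by fastforce
  then obtain T where T: "T \<in> measurable (mborel X d) (mborel (Xs i) (ds i))"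
    and T': "\<And>w. w \<in> X \<Longrightarrow> d w (\<phi> i (T w)) \<le> 2 * \<delta>"
    using approx_inverse_exists[OF cX ci ap i(2) pu] by metis
  have rec: "recovery X d (Xs i) (ds i) (ms i) (\<phi> i) (\<epsilon> i) \<delta> A \<psi> T (mus j)" if j: "j \<in> I" for j
  proof (intro recovery.intro recovery_axioms.intro)
    show "0 < (\<integral>y. \<psi> a (\<phi> i y) \<partial>ms i)" if "a \<in> A" "0 < (\<integral>x. \<psi> a x \<partial>mus j)" for a
      using i(3) j that unfolding c_def r_def by blast
  qed (rule cX ci mi \<phi> ap i(2) \<delta> pu T T' mus[OF j] | assumption)+
  define \<mu>1 where "\<mu>1 j = recovery.recovered (ms i) (\<phi> i) A \<psi> (mus j)" for j
  have \<mu>1: "\<mu>1 j \<in> Prob (Xs i) (ds i)" if "j \<in> I" for j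
    unfolding \<mu>1_def by (rule recovery.recovered_Prob[OF rec[OF that]])
  have ent1: "Ent (ms i) (\<mu>1 j) \<le> ereal (E j + \<delta>)" if j: "j \<in> I" for j
  proof -
    have "Ent (ms i) (\<mu>1 j) \<le> ereal (\<Sum>a\<in>A. c j a * ln (c j a / r i a))"
      using recovery.Ent_recovered[OF rec[OF j]]
      unfolding \<mu>1_def recovery.c_def[OF rec[OF j]] recovery.r_def[OF rec[OF j]] c_def r_def .
    also have "\<dots> \<le> ereal (E j + \<delta>)" using i(4) j by (simp add: less_imp_le)
    finally show ?thesis .
  qed
  have fwd: "W2sq (Xs i) (ds i) (\<mu>1 j) (distr \<nu> (mborel (Xs i) (ds i)) T) \<le> W2sq X d (mus j) \<nu> + ennreal err"
    if j: "j \<in> I" for j \<nu>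
  proof -
    have "5 * \<delta> * (2 * D + 5 * \<delta>) \<le> err" unfolding err_def using \<delta> by (intro mult_left_mono) auto
    then have "ennreal (5 * \<delta> * (2 * D + 5 * \<delta>)) \<le> ennreal err" by (rule ennreal_leI)
    then show ?thesis
      using recovery.W2sq_forward[OF rec[OF j] D(1), of \<nu>] unfolding \<mu>1_def
      by (meson add_left_mono order_trans)
  qed
  have bwd: "W2sq X d (mus j) (distr \<nu> (mborel X d) (\<phi> i)) \<le> W2sq (Xs i) (ds i) (\<mu>1 j) \<nu> + ennreal err"
    if j: "j \<in> I" for j \<nu>
    using recovery.W2sq_backward[OF rec[OF j] D(1), of \<nu>] unfolding \<mu>1_def err_def .
  define V where "V = Var X d I lam mus"
  define V1 where "V1 = Var (Xs i) (ds i) I lam \<mu>1"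
  \<comment> \<open>Every competitor on X is sent by \<open>T\<close> to a competitor on the
    approximating space.\<close>
  have V1le: "V1 \<le> V + ennreal err"
  proof -
    have "V1 - ennreal err \<le> V"
      unfolding V_def Var_def
    proof (rule INF_greatest)
      fix \<nu> assume \<nu>: "\<nu> \<in> Prob X d"
      have \<nu>s: "sets \<nu> = sets (mborel X d)" and \<nu>p: "prob_space \<nu>" using \<nu> unfolding X.Prob_iff by blast+
      have "T \<in> measurable \<nu> (mborel (Xs i) (ds i))" using T unfolding measurable_cong_sets[OF \<nu>s refl] .
      then have P: "distr \<nu> (mborel (Xs i) (ds i)) T \<in> Prob (Xs i) (ds i)"
        unfolding Y.Prob_iff using prob_space.prob_space_distr[OF \<nu>p] by simp
      have "V1 \<le> (\<Sum>j\<in>I. ennreal (lam j) * W2sq (Xs i) (ds i) (\<mu>1 j) (distr \<nu> (mborel (Xs i) (ds i)) T))"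
        unfolding V1_def Var_def by (rule INF_lower[OF P])
      also have "\<dots> \<le> (\<Sum>j\<in>I. ennreal (lam j) * W2sq X d (mus j) \<nu>) + ennreal err"
        by (rule weighted_sum_add[OF I0 I(3) fwd])
      finally show "V1 - ennreal err \<le> (\<Sum>j\<in>I. ennreal (lam j) * W2sq X d (mus j) \<nu>)"
        by (simp add: ennreal_minus_le_iff add.commute)
    qed
    then show ?thesis by (simp add: ennreal_minus_le_iff add.commute)
  qed
  have V1fin: "V1 < \<top>" using V1le fV unfolding V_def by (auto intro: le_less_trans simp: less_top)
  have "fin_prob_on_P (Xs i) (ds i) I lam \<mu>1"
    unfolding fin_prob_on_P_def using I(1,3) I0 \<mu>1 by blast
  then obtain \<nu>1 where bar: "is_barycenter (Xs i) (ds i) I lam \<mu>1 \<nu>1"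
    and ent: "Ent (ms i) \<nu>1 \<le> (\<Sum>j\<in>I. ereal (lam j) * Ent (ms i) (\<mu>1 j)) - ereal (K / 2 * enn2real V1)"
    using bcd[of i] V1fin unfolding BCD_def V1_def by blast
  have \<nu>1: "\<nu>1 \<in> Prob (Xs i) (ds i)"
    and opt: "(\<Sum>j\<in>I. ennreal (lam j) * W2sq (Xs i) (ds i) (\<mu>1 j) \<nu>1) = V1"
    using bar unfolding is_barycenter_def V1_def by blast+
  have \<nu>1s: "sets \<nu>1 = sets (mborel (Xs i) (ds i))" and \<nu>1p: "prob_space \<nu>1"
    using \<nu>1 unfolding Y.Prob_iff by blast+
  define \<nu> where "\<nu> = distr \<nu>1 (mborel X d) (\<phi> i)"
  have \<phi>\<nu>: "\<phi> i \<in> measurable \<nu>1 (mborel X d)" using \<phi>[of i] unfolding measurable_cong_sets[OF \<nu>1s refl] .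
  have \<nu>: "\<nu> \<in> Prob X d"
    unfolding \<nu>_def X.Prob_iff using prob_space.prob_space_distr[OF \<nu>1p \<phi>\<nu>] by simp
  have up: "(\<Sum>j\<in>I. ennreal (lam j) * W2sq X d (mus j) \<nu>) \<le> V1 + ennreal err"
    unfolding opt[symmetric] \<nu>_def by (rule weighted_sum_add[OF I0 I(3) bwd])
  \<comment> \<open>Conversely, the image of the barycenter is a competitor on X.\<close>
  have Vle: "V \<le> V1 + ennreal err"
    using up INF_lower[OF \<nu>] unfolding V_def Var_def by (rule order_trans[rotated])
  \<comment> \<open>One \<open>err\<close> pays for the comparison of the variances, the other for
    mapping the barycenter back to X.\<close>
  have up': "(\<Sum>j\<in>I. ennreal (lam j) * W2sq X d (mus j) \<nu>) \<le> V + ennreal (2 * err)"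
  proof -
    have "V1 + ennreal err \<le> V + ennreal err + ennreal err" using V1le by (rule add_right_mono)
    also have "\<dots> = V + ennreal (2 * err)" using err by (simp add: add.assoc flip: ennreal_plus)
    finally show ?thesis using up by (rule order_trans[rotated])
  qed
  obtain v where v: "V = ennreal v" "0 \<le> v" using fV unfolding V_def by (cases "Var X d I lam mus") auto
  obtain v1 where v1: "V1 = ennreal v1" "0 \<le> v1" using V1fin by (cases V1) auto
  have "ennreal v1 \<le> ennreal (v + err)" "ennreal v \<le> ennreal (v1 + err)"
    using V1le Vle v v1 err by simp_all
  then have "v1 \<le> v + err" "v \<le> v1 + err" using v(2) v1(2) err by (simp_all only: ennreal_le_iff add_nonneg_nonneg)
  \<comment> \<open>A two-sided estimate, because the sign of \<open>K\<close> decides which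
    direction enters the entropy bound.\<close>
  then have vv: "\<bar>v1 - v\<bar> \<le> err" by linarith
  have ent\<nu>1: "Ent (ms i) \<nu>1 \<le> ereal ((\<Sum>j\<in>I. lam j * E j) - K / 2 * v + (\<delta> + \<bar>K\<bar> / 2 * err))"
  proof -
    have "(\<Sum>j\<in>I. ereal (lam j) * Ent (ms i) (\<mu>1 j)) \<le> (\<Sum>j\<in>I. ereal (lam j) * ereal (E j + \<delta>))"
      using ent1 I0 by (intro sum_mono ereal_mult_left_mono) auto
    also have "\<dots> = ereal (\<Sum>j\<in>I. lam j * (E j + \<delta>))" by simp
    also have "(\<Sum>j\<in>I. lam j * (E j + \<delta>)) = (\<Sum>j\<in>I. lam j * E j) + (\<Sum>j\<in>I. lam j) * \<delta>"
      by (simp add: distrib_left sum.distrib sum_distrib_right)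
    finally have s: "(\<Sum>j\<in>I. ereal (lam j) * Ent (ms i) (\<mu>1 j)) \<le> ereal ((\<Sum>j\<in>I. lam j * E j) + \<delta>)"
      by (simp add: I(3))
    have "Ent (ms i) \<nu>1 \<le> ereal ((\<Sum>j\<in>I. lam j * E j) + \<delta>) - ereal (K / 2 * v1)"
    proof (rule order_trans[OF _ ereal_minus_mono[OF s order_refl]])
      have "enn2real V1 = v1" using v1 by simp
      then show "Ent (ms i) \<nu>1 \<le> (\<Sum>j\<in>I. ereal (lam j) * Ent (ms i) (\<mu>1 j)) - ereal (K / 2 * v1)"
        using ent by simp
    qed
    then have e: "Ent (ms i) \<nu>1 \<le> ereal ((\<Sum>j\<in>I. lam j * E j) + \<delta> - K / 2 * v1)" by simp
    have "K / 2 * v - K / 2 * v1 \<le> \<bar>K / 2 * (v - v1)\<bar>" by (simp add: algebra_simps)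
    also have "\<dots> = \<bar>K\<bar> / 2 * \<bar>v1 - v\<bar>" by (simp add: abs_mult abs_minus_commute)
    also have "\<dots> \<le> \<bar>K\<bar> / 2 * err" using vv by (intro mult_left_mono) auto
    finally have "(\<Sum>j\<in>I. lam j * E j) + \<delta> - K / 2 * v1 \<le> (\<Sum>j\<in>I. lam j * E j) - K / 2 * v + (\<delta> + \<bar>K\<bar> / 2 * err)"
      by linarith
    then have "ereal ((\<Sum>j\<in>I. lam j * E j) + \<delta> - K / 2 * v1) \<le> ereal ((\<Sum>j\<in>I. lam j * E j) - K / 2 * v + (\<delta> + \<bar>K\<bar> / 2 * err))"
      by simp
    then show ?thesis by (rule order_trans[OF e])
  qed
  \<comment> \<open>The test function is composed with \<open>\<phi> i\<close>, so the easy half of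
    the duality on the approximating space is enough and no entropy of an image measure is
    computed.\<close>
  have dual: "(\<integral>x. g x \<partial>\<nu>) \<le> (\<Sum>j\<in>I. lam j * E j) - K / 2 * v + (\<delta> + \<bar>K\<bar> / 2 * err) + (\<integral>y. exp (g (\<phi> i y) - 1) \<partial>ms i)"
    if g: "X.real_continuous g" for g
  proof -
    obtain b where b: "\<And>x. x \<in> X \<Longrightarrow> \<bar>g x\<bar> \<le> b" using X.continuous_bounded[OF g] by metis
    have gb: "g \<in> borel_measurable (mborel X d)" by (rule X.continuous_borel[OF g])
    have g\<phi>: "(\<lambda>y. g (\<phi> i y)) \<in> borel_measurable (ms i)"
      using measurable_compose[OF \<phi> gb] unfolding measurable_cong_sets[OF mi(2) refl] .
    have sp: "space (ms i) = Xs i" using sets_eq_imp_space_eq[OF mi(2)] by simp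
    have \<phi>X: "\<phi> i y \<in> X" if "y \<in> Xs i" for y using ap[of i] that unfolding eps_approx_def by blast
    have "(\<integral>x. g x \<partial>\<nu>) = (\<integral>y. g (\<phi> i y) \<partial>\<nu>1)"
      unfolding \<nu>_def by (rule integral_distr[OF \<phi>\<nu> gb])
    also have "\<dots> \<le> (\<Sum>j\<in>I. lam j * E j) - K / 2 * v + (\<delta> + \<bar>K\<bar> / 2 * err) + (\<integral>y. exp (g (\<phi> i y) - 1) \<partial>ms i)"
      by (rule entropy_dual_le[where b=b, OF mi(1) \<nu>1p _ ent\<nu>1 g\<phi>]) (simp_all add: \<nu>1s mi(2) sp b \<phi>X)
    finally show ?thesis .
  qed
  have "enn2real V = v" using v by simp
  then show ?thesis
    using i(1) \<nu> up' dual unfolding V_def[symmetric] by (intro exI[of _ i] exI[of _ \<nu>]) simp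
qed

theorem theorem6p6:
  fixes K :: real
    and Xs :: "nat \<Rightarrow> 'a set" and ds :: "nat \<Rightarrow> 'a \<Rightarrow> 'a \<Rightarrow> real" and ms :: "nat \<Rightarrow> 'a measure"
    and X :: "'b set" and d :: "'b \<Rightarrow> 'b \<Rightarrow> real" and m :: "'b measure"
  assumes "\<And>i. compact_mms (Xs i) (ds i) (ms i)"
    and "\<And>i. BCD K (Xs i) (ds i) (ms i)"
    and "compact_mms X d m"
    and "mGH_converges Xs ds ms X d m"
  shows "BCD K X d m"
proof -
  have cX: "compact_metric X d" and m: "finite_measure m" "sets m = sets (mborel X d)"
    using assms(3) unfolding compact_mms_def compact_metric_def compact_metric_axioms_def by blast+
  have ci: "compact_metric (Xs i) (ds i)" and mi: "finite_measure (ms i)" "sets (ms i) = sets (mborel (Xs i) (ds i))" for i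
    using assms(1)[of i] unfolding compact_mms_def compact_metric_def compact_metric_axioms_def by blast+
  interpret X: compact_metric X d by (rule cX)
  obtain \<epsilon> \<phi> where \<epsilon>: "\<epsilon> \<longlonglongrightarrow> 0" and ap: "\<And>i. eps_approx (\<epsilon> i) (Xs i) (ds i) X d (\<phi> i)"
    and \<phi>m: "\<And>i. \<phi> i \<in> measurable (ms i) (mborel X d)"
    and wc': "\<And>f. X.real_continuous f \<Longrightarrow> bounded (f ` X) \<Longrightarrow>
          (\<lambda>i. integral\<^sup>L (distr (ms i) (mborel X d) (\<phi> i)) f) \<longlonglongrightarrow> integral\<^sup>L m f"
    using assms(4) unfolding mGH_converges_def by blast
  have \<phi>: "\<phi> i \<in> measurable (mborel (Xs i) (ds i)) (mborel X d)" for i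
    using \<phi>m[of i] unfolding measurable_cong_sets[OF mi(2) refl] .
  have wc: "(\<lambda>i. \<integral>y. g (\<phi> i y) \<partial>ms i) \<longlonglongrightarrow> (\<integral>x. g x \<partial>m)" if g: "X.real_continuous g" for g
  proof -
    obtain b where "\<And>x. x \<in> X \<Longrightarrow> \<bar>g x\<bar> \<le> b" using X.continuous_bounded[OF g] by metis
    then have "bounded (g ` X)" by (intro boundedI[of _ b]) auto
    from wc'[OF g this] show ?thesis
      using integral_distr[OF \<phi>m X.continuous_borel[OF g]] by simp
  qed
  obtain D where D: "0 \<le> D" "\<And>x w. x \<in> X \<Longrightarrow> w \<in> X \<Longrightarrow> d x w \<le> D" using X.dist_bounded by blast
  show ?thesis
    unfolding BCD_def
  proof (intro allI impI)
    fix I0 lam mus assume H: "fin_prob_on_P X d I0 lam mus \<and> Var X d I0 lam mus < \<top>"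
    \<comment> \<open>Zero weights contribute nothing to any of the sums, even against an infinite
      entropy. With the remaining weights positive, a single infinite entropy makes the whole sum
      infinite.\<close>
    define I where "I = {j \<in> I0. 0 < lam j}"
    have I0: "finite I0" "\<And>j. j \<in> I0 \<Longrightarrow> 0 \<le> lam j" "(\<Sum>j\<in>I0. lam j) = 1" "\<And>j. j \<in> I0 \<Longrightarrow> mus j \<in> Prob X d"
      using H unfolding fin_prob_on_P_def by blast+
    have II: "finite I" "I \<subseteq> I0" using I0(1) unfolding I_def by auto
    have out: "lam j = 0" if "j \<in> I0 - I" for j using that I0(2)[of j] unfolding I_def by auto
    have "(\<Sum>j\<in>I0. lam j) = (\<Sum>j\<in>I. lam j)"
      by (rule sum.mono_neutral_right[OF I0(1) II(2)]) (use out in blast)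
    then have I: "\<And>j. j \<in> I \<Longrightarrow> 0 < lam j" "(\<Sum>j\<in>I. lam j) = 1" "\<And>j. j \<in> I \<Longrightarrow> mus j \<in> Prob X d"
      using I0(3) I0(4)[OF subsetD[OF II(2)]] unfolding I_def by simp_all
    have eqn: "(\<Sum>j\<in>I0. ennreal (lam j) * F j) = (\<Sum>j\<in>I. ennreal (lam j) * F j)" for F
      by (rule sum.mono_neutral_right[OF I0(1) II(2)]) (simp add: out)
    have eqe: "(\<Sum>j\<in>I0. ereal (lam j) * F j) = (\<Sum>j\<in>I. ereal (lam j) * F j)" for F
      by (rule sum.mono_neutral_right[OF I0(1) II(2)]) (simp add: out flip: zero_ereal_def)
    have Veq: "Var X d I0 lam mus = Var X d I lam mus" unfolding Var_def eqn ..
    have beq: "is_barycenter X d I0 lam mus \<nu> = is_barycenter X d I lam mus \<nu>" for \<nu>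
      unfolding is_barycenter_def eqn Veq ..
    have fV: "Var X d I lam mus < \<top>" using H Veq by simp
    have "\<exists>\<nu>. is_barycenter X d I lam mus \<nu> \<and> Ent m \<nu> \<le> (\<Sum>j\<in>I. ereal (lam j) * Ent m (mus j))
        - ereal (K / 2 * enn2real (Var X d I lam mus))"
    \<comment> \<open>In the infinite case the entropy bound is void; otherwise all entropies are
      real, as the recovery construction requires.\<close>
    proof (cases "\<exists>j\<in>I. Ent m (mus j) = \<infinity>")
      case True
      then obtain j where j: "j \<in> I" "Ent m (mus j) = \<infinity>" by blast
      then have "ereal (lam j) * Ent m (mus j) = \<infinity>" using I(1)[OF j(1)] by simp
      then have "(\<Sum>j\<in>I. ereal (lam j) * Ent m (mus j)) = \<infinity>"
        using j(1) II(1) unfolding sum_Pinfty by blast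
      moreover obtain \<nu> where "is_barycenter X d I lam mus \<nu>" by (rule X.barycenter_exists[OF II(1) I(3) fV])
      ultimately show ?thesis by (intro exI[of _ \<nu>]) simp
    next
      case False
      have "\<exists>e. Ent m (mus j) = ereal e" if j: "j \<in> I" for j
      proof -
        have "Ent m (mus j) \<noteq> \<infinity>" using False j by blast
        then show ?thesis by (rule Ent_finiteE[OF m(1)]) blast
      qed
      then have "\<forall>j\<in>I. \<exists>e. Ent m (mus j) = ereal e" by blast
      from bchoice[OF this] obtain E where E': "\<forall>j\<in>I. Ent m (mus j) = ereal (E j)" ..
      then have E: "\<And>j. j \<in> I \<Longrightarrow> Ent m (mus j) = ereal (E j)" by simp
      define err where "err \<delta> = 5 * \<delta> * (2 * (D + \<delta>) + 5 * \<delta>)" for \<delta> :: real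
      define E0 where "E0 = (\<Sum>j\<in>I. lam j * E j) - K / 2 * enn2real (Var X d I lam mus)"
      define \<delta> where "\<delta> n = 1 / real (Suc n)" for n
      have \<delta>: "\<delta> n > 0" for n unfolding \<delta>_def by simp
      \<comment> \<open>Precision \<open>1 / (n+1)\<close> and index at least \<open>n\<close> are
        coupled, so one sequence serves both limits.\<close>
      define Q where "Q n i \<nu> \<longleftrightarrow> n \<le> i \<and> \<nu> \<in> Prob X d \<and>
          (\<Sum>j\<in>I. ennreal (lam j) * W2sq X d (mus j) \<nu>) \<le> Var X d I lam mus + ennreal (2 * err (\<delta> n)) \<and>
          (\<forall>g. X.real_continuous g \<longrightarrow>
            (\<integral>x. g x \<partial>\<nu>) \<le> E0 + (\<delta> n + \<bar>K\<bar> / 2 * err (\<delta> n)) + (\<integral>y. exp (g (\<phi> i y) - 1) \<partial>ms i))"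
        for n i \<nu>
      have "\<exists>i \<nu>. Q n i \<nu>" for n
        unfolding Q_def err_def E0_def
        by (rule approximate_barycenter[OF cX m ci mi assms(2) ap \<phi> \<epsilon> wc II(1) I E fV D(2,1) \<delta>])
      then have "\<forall>n. \<exists>p. Q n (fst p) (snd p)" by simp
      from choice[OF this] obtain p where "\<forall>n. Q n (fst (p n)) (snd (p n))" ..
      note p = this[unfolded Q_def]
      have P: "snd (p n) \<in> Prob X d" for n using p by blast
      obtain k \<nu> where k: "strict_mono (k :: nat \<Rightarrow> nat)" and \<nu>: "\<nu> \<in> Prob X d"
        and conv: "X.weakly_converges ((\<lambda>n. snd (p n)) \<circ> k) \<nu>"
        by (rule X.Prob_weakly_compact[OF P])
      have "\<delta> \<longlonglongrightarrow> 0" unfolding \<delta>_def[abs_def] using LIMSEQ_Suc[OF lim_1_over_n] by simp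
      from LIMSEQ_subseq_LIMSEQ[OF this k] have \<delta>k: "(\<lambda>n. \<delta> (k n)) \<longlonglongrightarrow> 0" by (simp add: o_def)
      have errk: "(\<lambda>n. err (\<delta> (k n))) \<longlonglongrightarrow> 0"
        unfolding err_def by (rule tendsto_eq_intros \<delta>k | simp)+
      have "is_barycenter X d I lam mus \<nu>"
      proof (rule X.barycenter_limit[OF II(1) I(3) \<nu> _ conv, where e="\<lambda>n. ennreal (2 * err (\<delta> (k n)))"])
        show "(\<lambda>n. ennreal (2 * err (\<delta> (k n)))) \<longlonglongrightarrow> 0"
          using tendsto_ennrealI[OF tendsto_mult_right_zero[OF errk, of 2]] by simp
        show "((\<lambda>n. snd (p n)) \<circ> k) n \<in> Prob X d" for n using P by simp
        show "(\<Sum>j\<in>I. ennreal (lam j) * W2sq X d (mus j) (((\<lambda>n. snd (p n)) \<circ> k) n))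
            \<le> Var X d I lam mus + ennreal (2 * err (\<delta> (k n)))" for n
          using p by simp
      qed
      moreover have "Ent m \<nu> \<le> ereal E0"
      proof (rule X.Ent_le_of_dual[OF m \<nu>])
        fix g assume g: "X.real_continuous g"
        \<comment> \<open>Continuity of the exponential term makes it a test function for the weak
          convergence of the reference measures.\<close>
        have ge: "X.real_continuous (\<lambda>x. exp (g x - 1))"
        proof -
          have "X.real_continuous (\<lambda>x. g x - 1)" using g by (intro continuous_intros)
          then have "X.real_continuous (exp \<circ> (\<lambda>x. g x - 1))"
            by (rule continuous_map_compose) (simp add: continuous_on_exp)
          then show ?thesis by (simp add: o_def)
        qed
        show "(\<integral>x. g x \<partial>\<nu>) \<le> E0 + (\<integral>x. exp (g x - 1) \<partial>m)"
        proof (rule LIMSEQ_le)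
          show "(\<lambda>n. \<integral>x. g x \<partial>snd (p (k n))) \<longlonglongrightarrow> (\<integral>x. g x \<partial>\<nu>)"
            using conv g unfolding X.weakly_converges_def by simp
          \<comment> \<open>The chosen indices need not be monotone; that they tend to infinity
            suffices for composing with the weak convergence.\<close>
          have "filterlim (\<lambda>n. fst (p (k n))) at_top sequentially"
          proof (rule filterlim_at_top_mono[OF filterlim_ident always_eventually])
            show "\<forall>n. n \<le> fst (p (k n))" using p seq_suble[OF k] by (meson order_trans)
          qed
          from filterlim_compose[OF wc[OF ge] this]
          have "(\<lambda>n. \<integral>y. exp (g (\<phi> (fst (p (k n))) y) - 1) \<partial>ms (fst (p (k n)))) \<longlonglongrightarrow> (\<integral>x. exp (g x - 1) \<partial>m)" .
          moreover have "(\<lambda>n. E0 + (\<delta> (k n) + \<bar>K\<bar> / 2 * err (\<delta> (k n)))) \<longlonglongrightarrow> E0 + (0 + \<bar>K\<bar> / 2 * 0)"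
            by (intro tendsto_intros \<delta>k errk)
          ultimately show "(\<lambda>n. E0 + (\<delta> (k n) + \<bar>K\<bar> / 2 * err (\<delta> (k n)))
              + (\<integral>y. exp (g (\<phi> (fst (p (k n))) y) - 1) \<partial>ms (fst (p (k n))))) \<longlonglongrightarrow> E0 + (\<integral>x. exp (g x - 1) \<partial>m)"
            using tendsto_add by fastforce
          show "\<exists>N. \<forall>n\<ge>N. (\<integral>x. g x \<partial>snd (p (k n))) \<le> E0 + (\<delta> (k n) + \<bar>K\<bar> / 2 * err (\<delta> (k n)))
              + (\<integral>y. exp (g (\<phi> (fst (p (k n))) y) - 1) \<partial>ms (fst (p (k n))))"
            using p g by blast
        qed
      qed
      moreover have "(\<Sum>j\<in>I. ereal (lam j) * Ent m (mus j)) - ereal (K / 2 * enn2real (Var X d I lam mus)) = ereal E0"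
        unfolding E0_def by (simp add: E)
      ultimately show ?thesis by auto
    qed
    then show "\<exists>\<nu>. is_barycenter X d I0 lam mus \<nu> \<and> Ent m \<nu> \<le> (\<Sum>j\<in>I0. ereal (lam j) * Ent m (mus j))
        - ereal (K / 2 * enn2real (Var X d I0 lam mus))"
      unfolding beq eqe Veq .
  qed
qed

end
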